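(* If $S$ is a compact regular surface (with or without boundary) in $\mathbb{R}^3$ and $p\in S$, then $$\mathrm{Area}(i_q(S))\sim\frac{\pi}{|p-q|^2},\qquad q\to p,\quad \overline{pq}\perp T_pS.$$ If $S$ is also closed and orientable (so $S$ and $i_q(S)$ have enclosed volumes), then $$\mathrm{Volume}(i_q(S))\sim\frac{\pi}{6|p-q|^3},\qquad q\to p,\quad \overline{pq}\perp T_pS,$$ and (consequently) $$v(i_q(S))=\frac{\mathrm{Volume}(i_q(S))}{(4\pi/3)\,\big(\mathrm{Area}(i_q(S))/(4\pi)\big)^{3/2}}\longrightarrow 1,\qquad q\to p,\quad \overline{pq}\perp T_pS.$$
   Context: For $q\in\mathbb{R}^3$, $i_q(\mathbf x)=q+(\mathbf x-q)/\|\mathbf x-q\|^2$ is inversion in the unit sphere centered at $q$. $T_pS$ is the tangent plane of $S$ at $p$, and the limits are taken as $q$ approaches $p$ with the segment $\overline{pq}$ orthogonal to $T_pS$. $\mathrm{Area}(\cdot)$ is surface area, and $\mathrm{Volume}(\cdot)$ of a closed orientable surface is its enclosed volume. The quantity $v(\cdot)$ is the reduced volume (isoperimetric ratio) of a closed surface, given by the displayed formula. $f\sim g$ means $f/g\to1$.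
   Formalization: The point p is required not to lie on the boundary of S; at a boundary point the claim fails, since there Area(i_q(S)) is asymptotic to π/(2|p−q|²), as for a flat closed disc with p on its rim. *)

theory Defs
  imports "HOL-Analysis.Analysis" "HOL-Library.Landau_Symbols"
begin

definition C1_on :: "('a::euclidean_space \<Rightarrow> 'b::euclidean_space) \<Rightarrow> 'a set \<Rightarrow> bool" where
  "C1_on f U \<longleftrightarrow>
     (\<forall>u\<in>U. f differentiable (at u)) \<and>
     (\<forall>v. continuous_on U (\<lambda>u. frechet_derivative f (at u) v))"

definition half_plane :: "(real^2) set" where
  "half_plane = {u. 0 \<le> u $ 1}"

(* A local parametrization, allowing boundary points: the map is defined and C1 on an open
   subset U of the plane, but only its restriction to the part of U in the closed half-plane
   parametrizes S.  Charts at interior points are those with U inside the open half-plane,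
   which is no restriction, since any small disc can be translated into it. *)
definition surface_chart :: "(real^3) set \<Rightarrow> (real^2 \<Rightarrow> real^3) \<Rightarrow> (real^2) set \<Rightarrow> bool" where
  "surface_chart S x U \<longleftrightarrow>
     open U \<and> C1_on x U \<and>
     (\<forall>u\<in>U. inj (frechet_derivative x (at u))) \<and>
     openin (top_of_set S) (x ` (U \<inter> half_plane)) \<and>
     (\<exists>y. homeomorphism (U \<inter> half_plane) (x ` (U \<inter> half_plane)) x y)"

(* Only C1 is required, so surfaces of every higher smoothness class are included. *)
definition regular_surface :: "(real^3) set \<Rightarrow> bool" where
  "regular_surface S \<longleftrightarrow>
     (\<forall>p\<in>S. \<exists>x U. surface_chart S x U \<and> p \<in> x ` (U \<inter> half_plane))"

definition surface_boundary :: "(real^3) set \<Rightarrow> (real^3) set" where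
  "surface_boundary S = {p. \<exists>x U u. surface_chart S x U \<and> u \<in> U \<and> u $ 1 = 0 \<and> x u = p}"

definition closed_surface :: "(real^3) set \<Rightarrow> bool" where
  "closed_surface S \<longleftrightarrow> regular_surface S \<and> compact S \<and> surface_boundary S = {}"

(* The tangent plane as a linear subspace of directions; the affine plane is its translate by p. *)
definition tangent_plane :: "(real^3) set \<Rightarrow> real^3 \<Rightarrow> (real^3) set" where
  "tangent_plane S p = {v. \<exists>x U u. surface_chart S x U \<and> u \<in> U \<inter> half_plane \<and> x u = p \<and>
                                   v \<in> range (frechet_derivative x (at u))}"

definition orientable_surface :: "(real^3) set \<Rightarrow> bool" where
  "orientable_surface S \<longleftrightarrow>
     (\<exists>N :: real^3 \<Rightarrow> real^3. continuous_on S N \<and>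
        (\<forall>p\<in>S. norm (N p) = 1 \<and> (\<forall>v\<in>tangent_plane S p. orthogonal (N p) v)))"

definition area_element :: "(real^2 \<Rightarrow> real^3) \<Rightarrow> real^2 \<Rightarrow> real" where
  "area_element x u =
     norm (cross3 (frechet_derivative x (at u) (axis 1 1)) (frechet_derivative x (at u) (axis 2 1)))"

(* S is cut into finitely many disjoint Borel pieces, each lying in one coordinate patch, and the
   area integrals of the pieces are added.  By the change of variables formula, the total does
   not depend on the choice of pieces and charts. *)
definition has_surface_area :: "(real^3) set \<Rightarrow> ennreal \<Rightarrow> bool" where
  "has_surface_area S a \<longleftrightarrow>
     (\<exists>(n::nat) x U A.
        (\<forall>i<n. surface_chart S (x i) (U i) \<and> A i \<in> sets borel \<and> A i \<subseteq> U i \<inter> half_plane) \<and>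
        disjoint_family_on (\<lambda>i. x i ` A i) {..<n} \<and>
        (\<Union>i<n. x i ` A i) = S \<and>
        a = (\<Sum>i<n. \<integral>\<^sup>+ u\<in>A i. ennreal (area_element (x i) u) \<partial>lborel))"

definition surface_area :: "(real^3) set \<Rightarrow> real" where
  "surface_area S = enn2real (THE a. has_surface_area S a)"

(* inside S is the union of the bounded components of the complement of S. *)
definition enclosed_volume :: "(real^3) set \<Rightarrow> real" where
  "enclosed_volume S = measure lborel (inside S)"

definition reduced_volume :: "(real^3) set \<Rightarrow> real" where
  "reduced_volume S =
     enclosed_volume S / ((4 * pi / 3) * (surface_area S / (4 * pi)) powr (3 / 2))"

definition sphere_inversion :: "real^3 \<Rightarrow> real^3 \<Rightarrow> real^3" where
  "sphere_inversion q x = q + (1 / (norm (x - q))\<^sup>2) *\<^sub>R (x - q)"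

(* The filter of q tending to p, q \<noteq> p, with the segment from p to q orthogonal to the
   tangent plane; both sides of the surface are included. *)
definition normal_approach :: "(real^3) set \<Rightarrow> real^3 \<Rightarrow> (real^3) filter" where
  "normal_approach S p = at p within {q. \<forall>v\<in>tangent_plane S p. orthogonal (q - p) v}"

end

theory Submission
  imports Defs "HOL-Real_Asymp.Real_Asymp"
begin

text \<open>
  The points \<open>q\<close> of the filter are \<open>q = p + t n\<close> with \<open>n\<close> a unit normal at \<open>p\<close> and \<open>t \<rightarrow> 0\<close>.

  Inversion multiplies the area element at \<open>x\<close> by \<open>\<bar>x - q\<bar>\<^sup>-\<^sup>4\<close>, so the part of \<open>S\<close> away from \<open>p\<close>
  contributes a bounded area. In a chart around \<open>p\<close>, blowing up by the factor \<open>1/t\<close> turns the rest into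
  an integral that converges, by dominated convergence, to the integral of
  \<open>1/(1 + \<bar>v\<bar>\<^sup>2)\<^sup>2\<close> over the tangent plane, which is \<open>\<pi>\<close>.

  The inside of the inverted surface is, up to the point \<open>q\<close>, the image of all components of the complement
  of \<open>S\<close> except the one containing \<open>q\<close>. A closed oriented surface separates the points \<open>p + t n\<close>
  and \<open>p - t n\<close>: otherwise a loop crossing \<open>S\<close> once would give a map from space to the circle that does not
  lift to the line. Hence, after scaling by \<open>t\<close> about \<open>q\<close>, the inside converges pointwise to the
  image of a half-space, a ball of radius \<open>1/2\<close>, while staying in a fixed ball.
\<close>

section \<open>Charts and their normals\<close>

text \<open>The constants come from one model: a plane at distance 1 from the center inverts to a
  sphere of diameter 1, of area \<pi> and volume \<pi>/6, so its reduced volume is 1. The integrand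
  \<open>1/(1 + |v|^2)^2\<close> is \<open>|v - n|^-4\<close> for v in the plane orthogonal to n.
  Regularity is only C1, so no tubular neighbourhood can be relied on. What replaces it is strict
  differentiability: chords between any two points of S near p are as flat as desired against the
  tangent plane. The domination of the area integral, the distance from q to S and the separation
  argument all rest on this. The point p has to avoid the boundary, since there the blow-up would
  show only half of the tangent plane and halve the area limit. \<open>surface_area\<close> is a
  definite description over all chart decompositions. Once its uniqueness is known, the
  decomposition may be chosen to suit p, with a full parameter disc around p as one piece.\<close>

lemma linear_norm_le_sum_Basis:
  fixes f :: "'a::euclidean_space \<Rightarrow> 'b::real_normed_vector"
  assumes "linear f"
  shows "norm (f v) \<le> (\<Sum>b\<in>Basis. norm (f b)) * norm v"
proof -
  have "f v = f (\<Sum>b\<in>Basis. (v \<bullet> b) *\<^sub>R b)"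
    by (simp add: euclidean_representation)
  also have "\<dots> = (\<Sum>b\<in>Basis. (v \<bullet> b) *\<^sub>R f b)"
    using assms by (simp add: linear_sum linear_cmul)
  also have "norm \<dots> \<le> (\<Sum>b\<in>Basis. norm ((v \<bullet> b) *\<^sub>R f b))"
    by (rule norm_sum)
  also have "\<dots> \<le> (\<Sum>b\<in>Basis. norm (f b) * norm v)"
    by (rule sum_mono) (simp add: Basis_le_norm mult.commute[of _ "norm v"] mult_right_mono)
  finally show ?thesis by (simp add: sum_distrib_right)
qed

section \<open>C1 maps and strict differentiability\<close>

lemma C1_on_has_derivative:
  assumes "C1_on f U" "u \<in> U"
  shows "(f has_derivative frechet_derivative f (at u)) (at u)"
  using assms by (auto simp: C1_on_def frechet_derivative_works)

lemma C1_on_linear: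
  assumes "C1_on f U" "u \<in> U"
  shows "linear (frechet_derivative f (at u))"
  using C1_on_has_derivative[OF assms] has_derivative_linear by blast

lemma C1_on_continuous_on:
  assumes "C1_on f U"
  shows "continuous_on U f"
  using assms unfolding C1_on_def
  by (meson continuous_at_imp_continuous_on differentiable_imp_continuous_within)

lemma C1_on_subset:
  assumes "C1_on f U" "V \<subseteq> U"
  shows "C1_on f V"
  using assms unfolding C1_on_def by (meson continuous_on_subset subsetD)

text \<open>Strict differentiability: the error is relative to \<open>u - v\<close> with both points
  free, not only for \<open>v = u0\<close>. It follows from the mean value inequality on a ball
  where the derivative varies by at most \<open>e\<close>.\<close>

lemma C1_on_strict:
  assumes "open U" "C1_on f U" "u0 \<in> U" "e > 0"
  obtains d where "d > 0" "ball u0 d \<subseteq> U"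
    "\<And>u v. u \<in> ball u0 d \<Longrightarrow> v \<in> ball u0 d \<Longrightarrow>
       norm (f u - f v - frechet_derivative f (at u0) (u - v)) \<le> e * norm (u - v)"
proof -
  let ?D = "\<lambda>u. frechet_derivative f (at u)"
  \<comment> \<open>\<open>C1_on\<close> makes the derivative continuous only for each fixed
    direction. Summing over the finite basis gives a continuous function that dominates the operator
    norm of \<open>?D u - ?D u0\<close>.\<close>
  define F where "F u = (\<Sum>b\<in>Basis. norm (?D u b - ?D u0 b))" for u
  have "continuous_on U F"
    using assms(2) unfolding F_def C1_on_def
    by (intro continuous_on_sum continuous_on_norm continuous_on_diff continuous_on_const) blast
  then have "open (F -` {..<e} \<inter> U)"
    using \<open>open U\<close> continuous_on_open_vimage[of U F] by (metis open_lessThan)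
  moreover have "u0 \<in> F -` {..<e} \<inter> U" using assms by (auto simp: F_def)
  ultimately obtain d where d: "d > 0" "ball u0 d \<subseteq> F -` {..<e} \<inter> U"
    using openE by blast
  have "norm (f u - f v - ?D u0 (u - v)) \<le> e * norm (u - v)"
    if uv: "u \<in> ball u0 d" "v \<in> ball u0 d" for u v
  proof -
    have "norm (f u - f v - ?D u0 (u - v)) \<le> norm (u - v) * e"
    proof (rule differentiable_bound_linearization[where S = "ball u0 d" and f' = ?D])
      show "v + t *\<^sub>R (u - v) \<in> ball u0 d" if "t \<in> {0..1}" for t
        using convexD_alt[OF convex_ball uv(2,1), of t] that by (simp add: algebra_simps)
      show "(f has_derivative ?D w) (at w within ball u0 d)" if "w \<in> ball u0 d" for w
        using C1_on_has_derivative[OF assms(2)] d that has_derivative_at_withinI by blast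
      show "onorm (?D w - ?D u0) \<le> e" if "w \<in> ball u0 d" for w
      proof (rule onorm_bound)
        have w: "w \<in> U" "F w < e" using d that by auto
        have "linear (?D w - ?D u0)"
          using C1_on_linear[OF assms(2)] w assms(3)
          by (simp add: fun_diff_def linear_compose_sub)
        from linear_norm_le_sum_Basis[OF this]
        have "norm ((?D w - ?D u0) h) \<le> F w * norm h" for h
          by (simp add: F_def)
        then show "norm ((?D w - ?D u0) h) \<le> e * norm h" for h
          by (meson w(2) less_imp_le mult_right_mono norm_ge_zero order_trans)
      qed (use assms in auto)
    qed (use d in auto)
    then show ?thesis by (simp add: mult.commute)
  qed
  then show ?thesis using d that by auto
qed

section \<open>Charts and the shape of the surface near a point\<close>

lemma surface_chartD:
  assumes "surface_chart S x U"
  shows "open U" "C1_on x U" "u \<in> U \<Longrightarrow> inj (frechet_derivative x (at u))"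
    "x ` (U \<inter> half_plane) \<subseteq> S" "continuous_on U x" "inj_on x (U \<inter> half_plane)"
proof -
  show "open U" "C1_on x U" "u \<in> U \<Longrightarrow> inj (frechet_derivative x (at u))"
    using assms unfolding surface_chart_def by blast+
  then show "continuous_on U x" using C1_on_continuous_on by blast
  show "x ` (U \<inter> half_plane) \<subseteq> S"
    using assms openin_imp_subset unfolding surface_chart_def by blast
  show "inj_on x (U \<inter> half_plane)"
    using assms unfolding surface_chart_def by (metis homeomorphism_apply1 inj_on_inverseI)
qed

lemma surface_chart_openin:
  assumes "surface_chart S x U" "open V"
  shows "openin (top_of_set S) (x ` (U \<inter> half_plane \<inter> V))"
proof -
  obtain y where y: "homeomorphism (U \<inter> half_plane) (x ` (U \<inter> half_plane)) x y"
    using assms(1) unfolding surface_chart_def by blast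
  have "openin (top_of_set (U \<inter> half_plane)) (U \<inter> half_plane \<inter> V)"
    using assms(2) by (simp add: openin_open_Int)
  then have "openin (top_of_set (x ` (U \<inter> half_plane))) (x ` (U \<inter> half_plane \<inter> V))"
    by (rule homeomorphism_imp_open_map[OF y])
  then show ?thesis
    using assms(1) openin_trans unfolding surface_chart_def by blast
qed

lemma surface_chart_Int_open:
  assumes "surface_chart S x U" "open V"
  shows "surface_chart S x (U \<inter> V)"
proof -
  obtain y where y: "homeomorphism (U \<inter> half_plane) (x ` (U \<inter> half_plane)) x y"
    using assms(1) unfolding surface_chart_def by blast
  have eq: "U \<inter> V \<inter> half_plane = U \<inter> half_plane \<inter> V" by blast
  have "homeomorphism (U \<inter> V \<inter> half_plane) (x ` (U \<inter> V \<inter> half_plane)) x y"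
    by (rule homeomorphism_of_subsets[OF y]) auto
  moreover have "openin (top_of_set S) (x ` (U \<inter> V \<inter> half_plane))"
    using surface_chart_openin[OF assms] unfolding eq .
  moreover have "C1_on x (U \<inter> V)"
    using surface_chartD(2)[OF assms(1)] C1_on_subset by blast
  ultimately show ?thesis
    using assms unfolding surface_chart_def by blast
qed

text \<open>Points of \<open>S\<close> that are close in space also have close parameters, because a
  chart is a homeomorphism onto a relatively open subset. No other sheet of \<open>S\<close> comes
  near, so estimates made in a chart become statements about \<open>S\<close> in a ball of
  space.\<close>

lemma surface_chart_nbhd:
  assumes "surface_chart S x U" "open V" "u0 \<in> U \<inter> half_plane \<inter> V"
  obtains r where "r > 0" "S \<inter> ball (x u0) r \<subseteq> x ` (U \<inter> half_plane \<inter> V)"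
proof -
  have "x u0 \<in> x ` (U \<inter> half_plane \<inter> V)" using assms(3) by blast
  then obtain r where "r > 0" "ball (x u0) r \<inter> S \<subseteq> x ` (U \<inter> half_plane \<inter> V)"
    using surface_chart_openin[OF assms(1,2)] openin_contains_ball by meson
  then show ?thesis using that by (metis Int_commute)
qed

text \<open>An injective derivative is bounded below, so near \<open>u0\<close> the chart cannot
  contract distances by more than a fixed factor. The strict differentiability error can then be
  measured by distances on \<open>S\<close> instead of distances of parameters.\<close>

lemma surface_chart_bounded_below:
  assumes "surface_chart S x U" "u0 \<in> U" "e > 0"
  obtains c d where "c > 0" "d > 0" "ball u0 d \<subseteq> U"
    "\<And>u v. u \<in> ball u0 d \<Longrightarrow> v \<in> ball u0 d \<Longrightarrow> c * norm (u - v) \<le> norm (x u - x v)"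
    "\<And>u v. u \<in> ball u0 d \<Longrightarrow> v \<in> ball u0 d \<Longrightarrow>
       norm (x u - x v - frechet_derivative x (at u0) (u - v)) \<le> e * norm (x u - x v)"
proof -
  let ?D = "frechet_derivative x (at u0)"
  have "linear ?D" "inj ?D"
    using assms surface_chartD[OF assms(1)] C1_on_linear by blast+
  then obtain B where B: "B > 0" "\<And>h. B * norm h \<le> norm (?D h)"
    using linear_inj_bounded_below_pos by blast
  \<comment> \<open>\<open>B / 2\<close> leaves half of the lower bound \<open>B\<close> of the
    derivative for the chart itself; \<open>e * (B / 2)\<close> becomes \<open>e\<close> after
    division by that half.\<close>
  define e' where "e' = min (B / 2) (e * (B / 2))"
  have "e' > 0" using B assms by (simp add: e'_def)
  with assms surface_chartD[OF assms(1)] obtain d where d: "d > 0" "ball u0 d \<subseteq> U"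
    "\<And>u v. u \<in> ball u0 d \<Longrightarrow> v \<in> ball u0 d \<Longrightarrow> norm (x u - x v - ?D (u - v)) \<le> e' * norm (u - v)"
    using C1_on_strict[of U x u0 e'] by metis
  have 1: "B / 2 * norm (u - v) \<le> norm (x u - x v)" if "u \<in> ball u0 d" "v \<in> ball u0 d" for u v
  proof -
    have "B * norm (u - v) \<le> norm (?D (u - v))" by (rule B)
    also have "\<dots> \<le> norm (x u - x v) + norm (x u - x v - ?D (u - v))"
      by (metis norm_minus_commute norm_triangle_sub)
    also have "norm (x u - x v - ?D (u - v)) \<le> B / 2 * norm (u - v)"
      by (rule order_trans[OF d(3)[OF that]], rule mult_right_mono) (simp_all add: e'_def)
    finally show ?thesis by simp
  qed
  have 2: "norm (x u - x v - ?D (u - v)) \<le> e * norm (x u - x v)"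
    if "u \<in> ball u0 d" "v \<in> ball u0 d" for u v
  proof -
    have "norm (x u - x v - ?D (u - v)) \<le> e * (B / 2) * norm (u - v)"
      by (rule order_trans[OF d(3)[OF that]], rule mult_right_mono) (simp_all add: e'_def)
    also have "\<dots> \<le> e * norm (x u - x v)"
      using 1[OF that] assms(3) by (simp add: mult.assoc)
    finally show ?thesis .
  qed
  show ?thesis using that[of "B / 2" d] B(1) d(1,2) 1 2 by simp
qed

text \<open>A chord differs from a tangent vector by a small fraction of its own length, so its
  normal component is small. Both ends may move, which a uniform estimate over all of
  \<open>S\<close> needs later.\<close>

lemma surface_cone:
  assumes "surface_chart S x U" "u0 \<in> U \<inter> half_plane" "norm N = 1"
    "\<And>v. N \<bullet> frechet_derivative x (at u0) v = 0" "e > 0"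
  obtains r where "r > 0"
    "\<And>a b. a \<in> S \<inter> ball (x u0) r \<Longrightarrow> b \<in> S \<inter> ball (x u0) r \<Longrightarrow> \<bar>(a - b) \<bullet> N\<bar> \<le> e * norm (a - b)"
proof -
  let ?D = "frechet_derivative x (at u0)"
  obtain d where d: "d > 0" and
    est: "\<And>u v. u \<in> ball u0 d \<Longrightarrow> v \<in> ball u0 d \<Longrightarrow>
       norm (x u - x v - ?D (u - v)) \<le> e * norm (x u - x v)"
    using surface_chart_bounded_below[OF assms(1) _ assms(5), of u0] assms(2) by (metis IntD1)
  obtain r where r: "r > 0" "S \<inter> ball (x u0) r \<subseteq> x ` (U \<inter> half_plane \<inter> ball u0 d)"
    using surface_chart_nbhd[OF assms(1), of "ball u0 d" u0] assms(2) d by auto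
  have "\<bar>(a - b) \<bullet> N\<bar> \<le> e * norm (a - b)"
    if ab: "a \<in> S \<inter> ball (x u0) r" "b \<in> S \<inter> ball (x u0) r" for a b
  proof -
    obtain u v where uv: "u \<in> ball u0 d" "v \<in> ball u0 d" "x u = a" "x v = b"
      using ab r by blast
    have "(a - b) \<bullet> N = (x u - x v - ?D (u - v)) \<bullet> N"
      using assms(4)[of "u - v"] uv by (simp add: inner_diff_left inner_diff_right inner_commute)
    also have "\<bar>\<dots>\<bar> \<le> norm (x u - x v - ?D (u - v)) * norm N"
      by (rule Cauchy_Schwarz_ineq2)
    also have "\<dots> \<le> e * norm (a - b)" using est[OF uv(1,2)] uv(3,4) assms(3) by simp
    finally show ?thesis .
  qed
  then show ?thesis using r that by blast
qed

lemma unit_normal_exists: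
  fixes D :: "real^2 \<Rightarrow> real^3"
  assumes "linear D"
  obtains N where "norm N = 1" "\<And>v. N \<bullet> D v = 0"
proof -
  have "dim (range D) \<le> dim (UNIV :: (real^2) set)" by (rule dim_image_le[OF assms])
  then have "dim (range D) < DIM(real^3)" by simp
  from orthogonal_to_subspace_exists[OF this] obtain n where
    n: "n \<noteq> 0" "\<And>y. y \<in> span (range D) \<Longrightarrow> orthogonal n y" by blast
  have "n \<bullet> D v = 0" for v
    using n(2)[of "D v"] by (simp add: orthogonal_def span_base)
  then have "sgn n \<bullet> D v = 0" for v by (simp add: sgn_div_norm)
  then show ?thesis using that[of "sgn n"] n(1) by (auto simp: norm_sgn)
qed

text \<open>The orthogonal complement of the plane \<open>range D\<close> in three dimensions is a
  line, and \<open>N\<close> spans it.\<close>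

lemma parallel_normal:
  fixes D :: "real^2 \<Rightarrow> real^3"
  assumes "linear D" "inj D" "norm N = 1" "\<And>v. N \<bullet> D v = 0" "\<And>v. w \<bullet> D v = 0"
  shows "w = (w \<bullet> N) *\<^sub>R N"
proof -
  define A where "A = {y. \<forall>z\<in>range D. orthogonal z y}"
  have sub: "subspace (range D)" using assms(1) by (simp add: linear_subspace_image)
  have "dim A + dim (range D) = dim (UNIV :: (real^3) set)"
    using dim_subspace_orthogonal_to_vectors[OF sub subspace_UNIV] by (simp add: A_def)
  moreover have "dim (range D) = 2"
    using dim_image_eq[OF assms(1), of UNIV] assms(2) by simp
  ultimately have dimA: "dim A = 1" by simp
  have "subspace A"
    unfolding A_def by (rule subspace_orthogonal_to_vectors)
  have NA: "N \<in> A" "w \<in> A"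
    using assms(4,5) by (auto simp: A_def orthogonal_def inner_commute)
  have "N \<noteq> 0" using assms(3) by auto
  have "span {N} = A"
    using \<open>N \<noteq> 0\<close> NA dimA \<open>subspace A\<close>
    by (intro subspace_dim_equal) (auto simp: span_minimal dim_singleton intro: span_minimal)
  then obtain k where k: "w = k *\<^sub>R N" using NA by (metis imageE span_singleton)
  then show ?thesis using assms(3) by (simp add: dot_square_norm)
qed

section \<open>Surface area is well defined\<close>

text \<open>Bridge between the area integrals, which are nonnegative and possibly infinite, and the
  absolutely integrable functions of the change of variables formula. Measurability is asked only of
  the product with the indicator, since an area element is controlled only on its chart
  domain.\<close>

lemma absolutely_integrable_iff_nn_integral:
  fixes h :: "'a::euclidean_space \<Rightarrow> real"
  assumes "(\<lambda>u. indicator A u * h u) \<in> borel_measurable borel" "\<And>u. u \<in> A \<Longrightarrow> 0 \<le> h u"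
  shows "h absolutely_integrable_on A \<longleftrightarrow> (\<integral>\<^sup>+u\<in>A. ennreal (h u) \<partial>lborel) < \<infinity>"
    and "h absolutely_integrable_on A \<Longrightarrow>
           (\<integral>\<^sup>+u\<in>A. ennreal (h u) \<partial>lborel) = ennreal (integral A h)"
proof -
  let ?f = "\<lambda>u. indicator A u * h u"
  have nn: "(\<integral>\<^sup>+u\<in>A. ennreal (h u) \<partial>lborel) = (\<integral>\<^sup>+u. ennreal (?f u) \<partial>lborel)"
    by (intro nn_integral_cong) (auto simp: indicator_def)
  have f0: "0 \<le> ?f u" for u using assms(2) by (auto simp: indicator_def)
  have iff: "h absolutely_integrable_on A \<longleftrightarrow> integrable lborel ?f"
    using assms(1) by (simp add: set_integrable_def integrable_completion)
  show "h absolutely_integrable_on A \<longleftrightarrow> (\<integral>\<^sup>+u\<in>A. ennreal (h u) \<partial>lborel) < \<infinity>"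
    unfolding iff nn integrable_iff_bounded using assms(1) f0 by simp
  assume h: "h absolutely_integrable_on A"
  then have "(\<integral>\<^sup>+u. ennreal (?f u) \<partial>lborel) = ennreal (integral\<^sup>L lborel ?f)"
    using iff f0 by (intro nn_integral_eq_integral) auto
  also have "integral\<^sup>L lborel ?f = integral A h"
    using set_lebesgue_integral_eq_integral(2)[OF h] assms(1)
    by (simp add: set_lebesgue_integral_def integral_completion)
  finally show "(\<integral>\<^sup>+u\<in>A. ennreal (h u) \<partial>lborel) = ennreal (integral A h)" using nn by simp
qed

text \<open>The formula for absolutely integrable functions is an equivalence: if one side is not
  integrable, neither is the other, and then both nonnegative integrals are infinite.\<close>

lemma nn_integral_change_of_variables:
  fixes g :: "real^'m::{finite,wellorder} \<Rightarrow> real^'m::_" and h k :: "real^'m::_ \<Rightarrow> real"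
  assumes A: "A \<in> sets borel"
    and der: "\<And>u. u \<in> A \<Longrightarrow> (g has_derivative g' u) (at u within A)" and inj: "inj_on g A"
    and h: "(\<lambda>u. indicator A u * h u) \<in> borel_measurable borel"
    and k: "(\<lambda>w. indicator (g ` A) w * k w) \<in> borel_measurable borel"
    and k0: "\<And>u. u \<in> A \<Longrightarrow> 0 \<le> k (g u)"
    and eq: "\<And>u. u \<in> A \<Longrightarrow> h u = \<bar>det (matrix (g' u))\<bar> * k (g u)"
  shows "(\<integral>\<^sup>+u\<in>A. ennreal (h u) \<partial>lborel) = (\<integral>\<^sup>+w\<in>g ` A. ennreal (k w) \<partial>lborel)"
proof -
  have h0: "0 \<le> h u" if "u \<in> A" for u using eq k0 that by simp
  \<comment> \<open>The formula speaks of vector-valued integrands, so scalars enter it as vectors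
    in \<open>real^1\<close>.\<close>
  let ?K = "\<lambda>w. vec (k w) :: real^1"
  have AL: "A \<in> sets lebesgue" using A by simp
  have "h absolutely_integrable_on A \<and> integral A h = b \<longleftrightarrow>
        k absolutely_integrable_on (g ` A) \<and> integral (g ` A) k = b" for b
  proof -
    let ?H = "\<lambda>u. \<bar>det (matrix (g' u))\<bar> *\<^sub>R ?K (g u)"
    have H: "h absolutely_integrable_on A \<longleftrightarrow> ?H absolutely_integrable_on A"
      unfolding absolutely_integrable_on_1_iff
      by (rule set_integrable_cong) (auto simp: eq)
    have H': "integral A h = integral A ?H $ 1" if "?H absolutely_integrable_on A"
      using that set_lebesgue_integral_eq_integral(1)[OF that] eq
      by (subst integral_on_1_eq) (auto intro!: integral_cong)
    have K: "k absolutely_integrable_on (g ` A) \<longleftrightarrow> ?K absolutely_integrable_on (g ` A)"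
      by (simp add: absolutely_integrable_on_1_iff)
    have K': "integral (g ` A) k = integral (g ` A) ?K $ 1"
      by (subst integral_on_1_eq) simp
    show ?thesis
      using has_absolute_integral_change_of_variables[OF AL der inj, of ?K "vec b"] H H' K K'
      by (auto simp: vec_eq_iff)
  qed
  note key = this
  note Ah = absolutely_integrable_iff_nn_integral[OF h h0]
  have k0': "w \<in> g ` A \<Longrightarrow> 0 \<le> k w" for w using k0 by auto
  note Ak = absolutely_integrable_iff_nn_integral[OF k k0']
  show ?thesis
  proof (cases "h absolutely_integrable_on A")
    case True
    then show ?thesis using key Ah Ak by metis
  next
    case False
    then have "\<not> k absolutely_integrable_on (g ` A)" using key by blast
    then show ?thesis using False Ah(1) Ak(1)
      by (metis infinity_ennreal_def top.not_eq_extremum)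
  qed
qed

section \<open>Transition maps between charts\<close>

lemma borel_continuous_preimage:
  fixes f :: "'a::topological_space \<Rightarrow> 'b::topological_space"
  assumes "continuous_on E f" "E \<in> sets borel" "B \<in> sets borel"
  shows "{u \<in> E. f u \<in> B} \<in> sets borel"
proof -
  have "f -` B \<inter> space (restrict_space borel E) \<in> sets (restrict_space borel E)"
    by (rule measurable_sets[OF borel_measurable_continuous_on_restrict[OF assms(1)] assms(3)])
  then have "f -` B \<inter> E \<in> sets borel"
    using assms(2) by (simp add: sets_restrict_space_iff)
  moreover have "{u \<in> E. f u \<in> B} = f -` B \<inter> E" by blast
  ultimately show ?thesis by simp
qed

text \<open>The cross product is bilinear and alternating, so precomposing with a linear map of the
  plane multiplies it by the determinant.\<close>

lemma cross3_linear_comp: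
  fixes D :: "real^2 \<Rightarrow> real^3" and M :: "real^2 \<Rightarrow> real^2"
  assumes "linear D"
  shows "cross3 (D (M (axis 1 1))) (D (M (axis 2 1))) =
         det (matrix M) *\<^sub>R cross3 (D (axis 1 1)) (D (axis 2 1))"
proof -
  have ex: "v = v $ 1 *\<^sub>R axis 1 1 + v $ 2 *\<^sub>R axis 2 1" for v :: "real^2"
    by (simp add: vec_eq_iff forall_2 axis_def)
  have D: "D v = v $ 1 *\<^sub>R D (axis 1 1) + v $ 2 *\<^sub>R D (axis 2 1)" for v
    by (subst ex[of v]) (simp only: linear_add[OF assms] linear_cmul[OF assms])
  show ?thesis
    unfolding D[of "M _"]
    by (simp add: cross_add_left cross_add_right cross_mult_left cross_mult_right det_2 matrix_def
        cross_skew[of "D (axis 2 1)" "D (axis 1 1)"] scaleR_left_diff_distrib[symmetric] mult.commute)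
qed

lemma area_element_continuous:
  assumes "C1_on x U"
  shows "continuous_on U (area_element x)"
  using assms unfolding area_element_def C1_on_def
  by (intro continuous_on_norm continuous_on_cross) blast+

lemma area_element_nonneg: "0 \<le> area_element x u"
  by (simp add: area_element_def)

lemma borel_half_plane: "half_plane \<in> sets borel"
proof -
  have "closed half_plane" unfolding half_plane_def
    by (rule closed_Collect_le) (auto intro!: continuous_intros)
  then show ?thesis by simp
qed

lemma area_element_indicator_borel:
  assumes "C1_on x U" "A \<in> sets borel" "A \<subseteq> U"
  shows "(\<lambda>u. indicator A u * area_element x u) \<in> borel_measurable borel"
  using borel_measurable_continuous_on_indicator[OF assms(2), of "area_element x"]
    continuous_on_subset[OF area_element_continuous[OF assms(1)] assms(3)] by simp

text \<open>The transition is \<open>z \<circ> x\<close> with \<open>z\<close> the inverse of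
  \<open>y\<close> on its image. Parameters may lie on the edge of the half-plane, so it is
  differentiated within \<open>E\<close> only, and the chain rule for area elements is recovered
  from the uniqueness of derivatives within \<open>E\<close>.\<close>

lemma chart_transition:
  assumes cx: "surface_chart S x U" and cy: "surface_chart S y W"
    and E_def: "E = {u \<in> U \<inter> half_plane. x u \<in> y ` (W \<inter> half_plane)}"
  obtains \<phi> \<phi>' where "continuous_on E \<phi>" "E \<in> sets borel"
    "\<And>u. u \<in> E \<Longrightarrow> \<phi> u \<in> W \<inter> half_plane" "\<And>u. u \<in> E \<Longrightarrow> y (\<phi> u) = x u"
    "\<And>u. u \<in> E \<Longrightarrow> (\<phi> has_derivative \<phi>' u) (at u within E)"
    "\<And>u. u \<in> E \<Longrightarrow> area_element x u = \<bar>det (matrix (\<phi>' u))\<bar> * area_element y (\<phi> u)"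
proof -
  obtain z where z: "homeomorphism (W \<inter> half_plane) (y ` (W \<inter> half_plane)) y z"
    using cy unfolding surface_chart_def by blast
  define \<phi> where "\<phi> = z \<circ> x"
  let ?Dx = "\<lambda>u. frechet_derivative x (at u)"
  let ?Dy = "\<lambda>u. frechet_derivative y (at u)"
  note X = surface_chartD[OF cx] and Y = surface_chartD[OF cy]
  have contx: "continuous_on (U \<inter> half_plane) x"
    using X(5) continuous_on_subset by blast
  have \<phi>W: "\<phi> u \<in> W \<inter> half_plane" and y\<phi>: "y (\<phi> u) = x u" if "u \<in> E" for u
    using that z by (auto simp: E_def \<phi>_def homeomorphism_def)
  have cont\<phi>: "continuous_on E \<phi>"
    unfolding \<phi>_def
    by (rule continuous_on_compose)
      (use contx homeomorphism_cont2[OF z] in \<open>auto simp: E_def intro: continuous_on_subset\<close>)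
  have "openin (top_of_set S) (y ` (W \<inter> half_plane))"
    using cy unfolding surface_chart_def by blast
  then obtain T where T: "open T" "y ` (W \<inter> half_plane) = S \<inter> T"
    using openin_open by blast
  have E_eq: "E = {u \<in> U \<inter> half_plane. x u \<in> T}"
    using X(4) unfolding E_def T(2) by blast
  obtain T' where T': "open T'" "T' \<inter> U = x -` T \<inter> U"
    using continuous_on_open_invariant[THEN iffD1, OF X(5)] T(1) by blast
  \<comment> \<open>\<open>E\<close> is relatively open in the half-plane. This makes it Borel and
    later leaves room around each of its points.\<close>
  have E_eq': "E = (U \<inter> T') \<inter> half_plane" using E_eq T'(2) by blast
  have Eb: "E \<in> sets borel"
    using X(1) T'(1) borel_half_plane unfolding E_eq' by auto
  have "\<exists>L. (\<phi> has_derivative L) (at u within E) \<and> linear L \<and> ?Dx u = ?Dy (\<phi> u) \<circ> L"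
    if u: "u \<in> E" for u
  proof -
    let ?w = "\<phi> u"
    have wW: "?w \<in> W" "?w \<in> W \<inter> half_plane" using \<phi>W u by auto
    have linD: "linear (?Dy ?w)" using C1_on_linear Y(2) wW by blast
    \<comment> \<open>The derivative of \<open>y\<close> maps two dimensions into three and has only
      a left inverse; that is enough to differentiate \<open>z\<close> along the image of
      \<open>y\<close>.\<close>
    obtain L where L: "linear L" "L \<circ> ?Dy ?w = id"
      using linear_injective_left_inverse[OF linD Y(3)[OF wW(1)]] by blast
    have dery: "(y has_derivative ?Dy ?w) (at ?w within T)" for T
      using C1_on_has_derivative[OF Y(2) wW(1)] has_derivative_at_withinI by blast
    have derx: "(x has_derivative ?Dx u) (at u within E)"
      using C1_on_has_derivative[OF X(2)] u has_derivative_at_withinI unfolding E_def by blast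
    have "(z has_derivative L) (at (y ?w) within y ` (W \<inter> half_plane))"
    proof (rule has_derivative_inverse_within[OF dery _ wW(2) L])
      show "continuous (at (y ?w) within y ` (W \<inter> half_plane)) z"
        using homeomorphism_cont2[OF z] wW(2) continuous_on_eq_continuous_within by blast
      show "\<And>x. x \<in> W \<inter> half_plane \<Longrightarrow> z (y x) = x"
        using homeomorphism_apply1[OF z] .
    qed
    then have "(z has_derivative L) (at (x u) within x ` E)"
      unfolding y\<phi>[OF u]
      by (rule has_derivative_subset) (auto simp: E_def)
    then have d\<phi>: "(\<phi> has_derivative L \<circ> ?Dx u) (at u within E)"
      unfolding \<phi>_def by (rule diff_chain_within[OF derx])
    have "(y \<circ> \<phi> has_derivative ?Dy ?w \<circ> (L \<circ> ?Dx u)) (at u within E)"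
      by (rule diff_chain_within[OF d\<phi> dery])
    then have "(x has_derivative ?Dy ?w \<circ> (L \<circ> ?Dx u)) (at u within E)"
      by (rule has_derivative_transform[OF u, rotated]) (simp add: y\<phi>)
    with derx have "?Dx u = ?Dy ?w \<circ> (L \<circ> ?Dx u)"
    proof (rule frechet_derivative_unique_within)
      \<comment> \<open>Derivatives within \<open>E\<close> are unique as soon as \<open>E\<close>
        contains arbitrarily short steps in every basis direction. Positive steps never leave the
        half-plane.\<close>
      fix i :: "real^2" and e :: real assume i: "i \<in> Basis" and "e > 0"
      have "u \<in> U \<inter> T'" using u E_eq' by blast
      then obtain r where r: "r > 0" "ball u r \<subseteq> U \<inter> T'"
        using openE[of "U \<inter> T'" u] X(1) T'(1) by blast
      define d where "d = min e r / 2"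
      have d: "0 < d" "d < e" "d < r" using \<open>e > 0\<close> r(1) by (auto simp: d_def)
      have "u + d *\<^sub>R i \<in> ball u r" using i d by (simp add: dist_norm)
      moreover have "0 \<le> u $ 1" using u by (simp add: E_def half_plane_def)
      then have "u + d *\<^sub>R i \<in> half_plane"
        using i d by (auto simp: half_plane_def Basis_vec_def axis_def)
      ultimately have "u + d *\<^sub>R i \<in> E" using r(2) E_eq' by blast
      then show "\<exists>d. 0 < \<bar>d\<bar> \<and> \<bar>d\<bar> < e \<and> u + d *\<^sub>R i \<in> E" using d by (intro exI[of _ d]) simp
    qed
    moreover have "linear (L \<circ> ?Dx u)"
      using L(1) derx has_derivative_linear linear_compose by blast
    ultimately show ?thesis using d\<phi> by blast
  qed
  then obtain \<phi>' where \<phi>': "\<And>u. u \<in> E \<Longrightarrow> (\<phi> has_derivative \<phi>' u) (at u within E)"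
    "\<And>u. u \<in> E \<Longrightarrow> ?Dx u = ?Dy (\<phi> u) \<circ> \<phi>' u"
    by metis
  have "area_element x u = \<bar>det (matrix (\<phi>' u))\<bar> * area_element y (\<phi> u)" if u: "u \<in> E" for u
  proof -
    have "linear (?Dy (\<phi> u))" using C1_on_linear Y(2) \<phi>W[OF u] by blast
    then show ?thesis
      unfolding area_element_def \<phi>'(2)[OF u] o_def by (simp add: cross3_linear_comp)
  qed
  with that cont\<phi> Eb \<phi>W y\<phi> \<phi>'(1) show ?thesis by blast
qed

text \<open>Both integrals run over parameters of the same part of \<open>S\<close>, and the
  transition carries one parameter set bijectively onto the other. Each set is Borel because it is
  cut out by the preimage of a Borel set under a transition.\<close>

lemma chart_overlap_area:
  assumes cx: "surface_chart S x U" and cy: "surface_chart S y W"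
    and A: "A \<in> sets borel" "A \<subseteq> U \<inter> half_plane" and B: "B \<in> sets borel" "B \<subseteq> W \<inter> half_plane"
  shows "{u \<in> A. x u \<in> y ` B} \<in> sets borel"
    and "(\<integral>\<^sup>+u\<in>{u \<in> A. x u \<in> y ` B}. ennreal (area_element x u) \<partial>lborel) =
         (\<integral>\<^sup>+w\<in>{w \<in> B. y w \<in> x ` A}. ennreal (area_element y w) \<partial>lborel)"
proof -
  \<comment> \<open>Stated for arbitrary charts so that it can be used again with the two roles
    exchanged.\<close>
  have *: "{u \<in> A. x u \<in> y ` B} \<in> sets borel"
    if cx: "surface_chart S x U" and cy: "surface_chart S y W"
    and A: "A \<in> sets borel" "A \<subseteq> U \<inter> half_plane" and B: "B \<in> sets borel" "B \<subseteq> W \<inter> half_plane"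
    for x y U W A B
  proof -
    define E where E: "E = {u \<in> U \<inter> half_plane. x u \<in> y ` (W \<inter> half_plane)}"
    obtain \<phi> \<phi>' where \<phi>: "continuous_on E \<phi>" "E \<in> sets borel"
      "\<And>u. u \<in> E \<Longrightarrow> \<phi> u \<in> W \<inter> half_plane" "\<And>u. u \<in> E \<Longrightarrow> y (\<phi> u) = x u"
      "\<And>u. u \<in> E \<Longrightarrow> (\<phi> has_derivative \<phi>' u) (at u within E)"
      "\<And>u. u \<in> E \<Longrightarrow> area_element x u = \<bar>det (matrix (\<phi>' u))\<bar> * area_element y (\<phi> u)"
      by (rule chart_transition[OF cx cy E]) (rule that; assumption)
    have inj: "inj_on y (W \<inter> half_plane)" using surface_chartD[OF cy] by blast
    have "{u \<in> A. x u \<in> y ` B} = A \<inter> {u \<in> E. \<phi> u \<in> B}"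
    proof (rule set_eqI, safe)
      fix u w assume u: "u \<in> A" "x u = y w" "w \<in> B"
      then show uE: "u \<in> E" using A B by (auto simp: E)
      then have "y (\<phi> u) = y w" using \<phi>(4) u by simp
      then have "\<phi> u = w" using inj \<phi>(3)[OF uE] u(3) B(2) by (meson inj_onD subsetD)
      then show "\<phi> u \<in> B" using u by simp
    next
      fix u assume "u \<in> A" "u \<in> E" "\<phi> u \<in> B"
      then show "x u \<in> y ` B" using \<phi>(4) by (metis image_eqI)
    qed
    then show ?thesis using borel_continuous_preimage[OF \<phi>(1,2) B(1)] A(1) by auto
  qed
  let ?P = "{u \<in> A. x u \<in> y ` B}" and ?Q = "{w \<in> B. y w \<in> x ` A}"
  show P: "?P \<in> sets borel" by (rule *[OF cx cy A B])
  have Q: "?Q \<in> sets borel" by (rule *[OF cy cx B A])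
  define E where E: "E = {u \<in> U \<inter> half_plane. x u \<in> y ` (W \<inter> half_plane)}"
  obtain \<phi> \<phi>' where \<phi>c: "continuous_on E \<phi>" "E \<in> sets borel"
    and \<phi>: "\<And>u. u \<in> E \<Longrightarrow> \<phi> u \<in> W \<inter> half_plane" "\<And>u. u \<in> E \<Longrightarrow> y (\<phi> u) = x u"
      "\<And>u. u \<in> E \<Longrightarrow> (\<phi> has_derivative \<phi>' u) (at u within E)"
      "\<And>u. u \<in> E \<Longrightarrow> area_element x u = \<bar>det (matrix (\<phi>' u))\<bar> * area_element y (\<phi> u)"
    by (rule chart_transition[OF cx cy E]) (rule that; assumption)
  have injy: "inj_on y (W \<inter> half_plane)" using surface_chartD[OF cy] by blast
  have injx: "inj_on x (U \<inter> half_plane)" using surface_chartD[OF cx] by blast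
  have PE: "?P \<subseteq> E" using A B by (auto simp: E)
  have \<phi>_eq: "\<phi> u = w" if "u \<in> E" "w \<in> B" "x u = y w" for u w
    using that \<phi>(1,2) injy B(2) by (metis inj_onD subsetD)
  have img: "\<phi> ` ?P = ?Q"
  proof (rule set_eqI, safe)
    fix u w assume u: "u \<in> A" "x u = y w" "w \<in> B"
    then have "u \<in> E" using PE by auto
    then have "\<phi> u = w" using \<phi>_eq u by simp
    then show "\<phi> u \<in> B" "y (\<phi> u) \<in> x ` A" using u by (auto intro: rev_image_eqI)
  next
    fix w u assume u: "w \<in> B" "y w = x u" "u \<in> A"
    then have "u \<in> ?P" by force
    then show "w \<in> \<phi> ` ?P" using \<phi>_eq[of u w] u PE by auto
  qed
  have injP: "inj_on \<phi> ?P"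
  proof (rule inj_onI)
    fix u v assume uv: "u \<in> ?P" "v \<in> ?P" "\<phi> u = \<phi> v"
    then have "u \<in> E" "v \<in> E" using PE by blast+
    then have "x u = x v" using \<phi>(2) uv(3) by metis
    moreover have "u \<in> U \<inter> half_plane" "v \<in> U \<inter> half_plane"
      using uv A(2) by blast+
    ultimately show "u = v" using injx by (meson inj_onD)
  qed
  show "(\<integral>\<^sup>+u\<in>?P. ennreal (area_element x u) \<partial>lborel) = (\<integral>\<^sup>+w\<in>?Q. ennreal (area_element y w) \<partial>lborel)"
    unfolding img[symmetric]
  proof (rule nn_integral_change_of_variables[OF P _ injP])
    show "(\<phi> has_derivative \<phi>' u) (at u within ?P)" if "u \<in> ?P" for u
      using \<phi>(3) PE that by (meson has_derivative_subset subsetD)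
    show "(\<lambda>u. indicator ?P u * area_element x u) \<in> borel_measurable borel"
      using surface_chartD(2)[OF cx] P A(2) by (intro area_element_indicator_borel) auto
    show "(\<lambda>w. indicator (\<phi> ` ?P) w * area_element y w) \<in> borel_measurable borel"
      unfolding img using surface_chartD(2)[OF cy] Q B(2) by (intro area_element_indicator_borel) auto
  qed (use \<phi>(4) PE in \<open>auto simp: area_element_nonneg\<close>)
qed

text \<open>Common refinement: both sums are cut along all intersections of a piece of one
  decomposition with a piece of the other, and each intersection has the same area in either
  chart.\<close>

lemma has_surface_area_unique:
  assumes "has_surface_area S a" "has_surface_area S b"
  shows "a = b"
proof -
  let ?I = "\<lambda>x A. \<integral>\<^sup>+ u\<in>A. ennreal (area_element x u) \<partial>lborel"
  obtain n :: nat and x U A where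
    x: "\<And>i. i < n \<Longrightarrow> surface_chart S (x i) (U i) \<and> A i \<in> sets borel \<and> A i \<subseteq> U i \<inter> half_plane"
    and dx: "disjoint_family_on (\<lambda>i. x i ` A i) {..<n}" and ux: "(\<Union>i<n. x i ` A i) = S"
    and a: "a = (\<Sum>i<n. ?I (x i) (A i))"
    using assms(1) unfolding has_surface_area_def by auto
  obtain m :: nat and y W B where
    y: "\<And>j. j < m \<Longrightarrow> surface_chart S (y j) (W j) \<and> B j \<in> sets borel \<and> B j \<subseteq> W j \<inter> half_plane"
    and dy: "disjoint_family_on (\<lambda>i. y i ` B i) {..<m}" and uy: "(\<Union>j<m. y j ` B j) = S"
    and b: "b = (\<Sum>j<m. ?I (y j) (B j))"
    using assms(2) unfolding has_surface_area_def by auto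
  have split: "?I x A = (\<Sum>j<m. ?I x {u \<in> A. x u \<in> y j ` B j})"
    if x: "surface_chart S x U" "A \<in> sets borel" "A \<subseteq> U \<inter> half_plane" "x ` A \<subseteq> S"
      and y: "\<And>j. j < m \<Longrightarrow> surface_chart S (y j) (W j) \<and> B j \<in> sets borel \<and> B j \<subseteq> W j \<inter> half_plane"
      and dy: "disjoint_family_on (\<lambda>i. y i ` B i) {..<m}" and uy: "(\<Union>j<m. y j ` B j) = S"
    for x U A and y :: "nat \<Rightarrow> real^2 \<Rightarrow> real^3" and W B and m :: nat
  proof -
    have P: "{u \<in> A. x u \<in> y j ` B j} \<in> sets borel" if "j < m" for j
      using chart_overlap_area(1)[OF x(1)] y[OF that] x by blast
    have meas: "(\<lambda>u. ennreal (area_element x u) * indicator {u \<in> A. x u \<in> y j ` B j} u)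
        \<in> borel_measurable borel" if "j < m" for j
    proof -
      have "(\<lambda>u. indicator {u \<in> A. x u \<in> y j ` B j} u * area_element x u) \<in> borel_measurable borel"
        using surface_chartD(2)[OF x(1)] P[OF that] x(3) by (intro area_element_indicator_borel) auto
      then have "(\<lambda>u. ennreal (indicator {u \<in> A. x u \<in> y j ` B j} u * area_element x u))
          \<in> borel_measurable borel" by simp
      then show ?thesis by (rule measurable_cong[THEN iffD1, rotated]) (auto simp: indicator_def)
    qed
    \<comment> \<open>Exactly one piece of the other decomposition contains \<open>x u\<close>, so
      the indicators of the overlaps add up to that of \<open>A\<close>.\<close>
    have ind: "(indicator A u :: ennreal) = (\<Sum>j<m. indicator {u \<in> A. x u \<in> y j ` B j} u)" for u
    proof (cases "u \<in> A")
      case True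
      then obtain i where i: "i < m" "x u \<in> y i ` B i" using x(4) uy by blast
      have "x u \<notin> y j ` B j" if "j < m" "j \<noteq> i" for j
        using i that dy unfolding disjoint_family_on_def by blast
      then have "(indicator {u \<in> A. x u \<in> y j ` B j} u :: ennreal) = (if j = i then 1 else 0)"
        if "j < m" for j
        using that i True by auto
      then show ?thesis using True i(1) by simp
    qed simp
    have "?I x A = (\<integral>\<^sup>+ u. (\<Sum>j<m. ennreal (area_element x u) * indicator {u \<in> A. x u \<in> y j ` B j} u) \<partial>lborel)"
      by (simp add: ind sum_distrib_left)
    also have "\<dots> = (\<Sum>j<m. ?I x {u \<in> A. x u \<in> y j ` B j})"
      by (rule nn_integral_sum) (use meas in auto)
    finally show ?thesis .
  qed
  have "a = (\<Sum>i<n. \<Sum>j<m. ?I (x i) {u \<in> A i. x i u \<in> y j ` B j})"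
    unfolding a
    by (rule sum.cong[OF refl], rule split[OF _ _ _ _ y dy uy]) (use x ux in auto)
  also have "\<dots> = (\<Sum>i<n. \<Sum>j<m. ?I (y j) {w \<in> B j. y j w \<in> x i ` A i})"
  proof (intro sum.cong refl)
    fix i j assume "i \<in> {..<n}" "j \<in> {..<m}"
    then show "?I (x i) {u \<in> A i. x i u \<in> y j ` B j} = ?I (y j) {w \<in> B j. y j w \<in> x i ` A i}"
      using x[of i] y[of j] by (intro chart_overlap_area(2)[of S "x i" "U i" "y j" "W j"]) auto
  qed
  also have "\<dots> = (\<Sum>j<m. \<Sum>i<n. ?I (y j) {w \<in> B j. y j w \<in> x i ` A i})"
    by (rule sum.swap)
  also have "\<dots> = b"
    unfolding b
    by (rule sum.cong[OF refl], rule split[OF _ _ _ _ x dx ux, symmetric]) (use y uy in auto)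
  finally show ?thesis .
qed

lemma surface_area_eqI:
  assumes "has_surface_area S a"
  shows "surface_area S = enn2real a"
proof -
  have "(THE a. has_surface_area S a) = a"
    using assms has_surface_area_unique by blast
  then show ?thesis by (simp add: surface_area_def)
qed

section \<open>Sphere inversion\<close>

text \<open>The center is fixed instead of being sent to infinity. This makes inversion an
  involution of the whole space, at the price of a discontinuity at \<open>q\<close>.\<close>

lemma sphere_inversion_self [simp]: "sphere_inversion q q = q"
  by (simp add: sphere_inversion_def)

lemma norm_sphere_inversion: "norm (sphere_inversion q x - q) = 1 / norm (x - q)"
  by (simp add: sphere_inversion_def power2_eq_square)

lemma sphere_inversion_involution [simp]: "sphere_inversion q (sphere_inversion q x) = x"
proof (cases "x = q")
  case False
  then have "norm (x - q) \<noteq> 0" by simp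
  then have "sphere_inversion q (sphere_inversion q x) = q + (norm (x - q))\<^sup>2 *\<^sub>R (sphere_inversion q x - q)"
    unfolding sphere_inversion_def[of q "sphere_inversion q x"] norm_sphere_inversion
    by (simp add: power_one_over)
  also have "\<dots> = x"
    using \<open>norm (x - q) \<noteq> 0\<close> by (simp add: sphere_inversion_def)
  finally show ?thesis .
qed simp

lemma sphere_inversion_eq_iff [simp]: "sphere_inversion q x = sphere_inversion q y \<longleftrightarrow> x = y"
  by (metis sphere_inversion_involution)

lemma sphere_inversion_eq_center [simp]: "sphere_inversion q x = q \<longleftrightarrow> x = q"
  by (metis sphere_inversion_involution sphere_inversion_self)

lemma sphere_inversion_image_iff: "y \<in> sphere_inversion q ` S \<longleftrightarrow> sphere_inversion q y \<in> S"
  by (metis image_iff sphere_inversion_involution)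

lemma continuous_on_sphere_inversion:
  assumes "q \<notin> S"
  shows "continuous_on S (sphere_inversion q)"
  unfolding sphere_inversion_def[abs_def] using assms by (auto intro!: continuous_intros)

lemma homeomorphism_sphere_inversion:
  assumes "q \<notin> S"
  shows "homeomorphism S (sphere_inversion q ` S) (sphere_inversion q) (sphere_inversion q)"
  unfolding homeomorphism_def using assms
  by (auto simp: image_image continuous_on_sphere_inversion sphere_inversion_image_iff)

text \<open>\<open>|r|^-2\<close> times the reflection in the plane orthogonal to
  \<open>r\<close>.\<close>

definition inversion_derivative :: "real^3 \<Rightarrow> real^3 \<Rightarrow> real^3" where
  "inversion_derivative r v = (1 / (norm r)\<^sup>2) *\<^sub>R v - (2 * (r \<bullet> v) / (norm r) ^ 4) *\<^sub>R r"

lemma has_derivative_sphere_inversion: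
  assumes "x \<noteq> q"
  shows "(sphere_inversion q has_derivative inversion_derivative (x - q)) (at x)"
proof -
  have i: "norm z ^ 2 = z \<bullet> z" for z :: "real^3" by (rule power2_norm_eq_inner)
  have n4: "norm z ^ 4 = (z \<bullet> z) ^ 2" for z :: "real^3"
    by (metis i power_mult num_double numeral_times_numeral)
  have r': "(x - q) \<bullet> (x - q) \<noteq> 0" using assms by simp
  have d2: "((\<lambda>x. x - q) has_derivative (\<lambda>v. v)) (at x)"
    by (auto intro!: derivative_eq_intros)
  have d1: "((\<lambda>x. 1 / ((x - q) \<bullet> (x - q))) has_derivative
      (\<lambda>v. - (2 * ((x - q) \<bullet> v)) / ((x - q) \<bullet> (x - q))\<^sup>2)) (at x)"
    unfolding inverse_eq_divide[symmetric]
    by (rule has_derivative_eq_rhs[OF Deriv.has_derivative_inverse[OF r' has_derivative_inner[OF d2 d2]]])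
      (use r' in \<open>simp add: fun_eq_iff inner_commute power2_eq_square field_simps del: inner_eq_zero_iff\<close>)
  have "((\<lambda>x. q + (1 / ((x - q) \<bullet> (x - q))) *\<^sub>R (x - q)) has_derivative inversion_derivative (x - q)) (at x)"
    by (rule has_derivative_eq_rhs[OF has_derivative_add[OF has_derivative_const has_derivative_scaleR[OF d1 d2]]])
      (simp add: inversion_derivative_def[abs_def] i n4)
  then show ?thesis unfolding sphere_inversion_def[abs_def] i .
qed

text \<open>Conformality: the reflection preserves inner products, and the factor
  \<open>|r|^-2\<close> enters twice.\<close>

lemma inner_inversion_derivative:
  assumes "r \<noteq> 0"
  shows "inversion_derivative r v \<bullet> inversion_derivative r w = (v \<bullet> w) / norm r ^ 4"
proof -
  have "norm r ^ 2 = r \<bullet> r" by (rule power2_norm_eq_inner)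
  then have i: "r \<bullet> r = norm r ^ 2" by simp
  have n: "norm r \<noteq> 0" using assms by simp
  have "inversion_derivative r v \<bullet> inversion_derivative r w =
     (1 / (norm r)\<^sup>2) * (1 / (norm r)\<^sup>2) * (v \<bullet> w)
     - (1 / (norm r)\<^sup>2) * (2 * (r \<bullet> w) / norm r ^ 4) * (r \<bullet> v)
     - (1 / (norm r)\<^sup>2) * (2 * (r \<bullet> v) / norm r ^ 4) * (r \<bullet> w)
     + (2 * (r \<bullet> v) / norm r ^ 4) * (2 * (r \<bullet> w) / norm r ^ 4) * norm r ^ 2"
    unfolding inversion_derivative_def
    by (simp add: inner_diff_left inner_diff_right inner_commute i algebra_simps)
  also have "\<dots> = (v \<bullet> w) / norm r ^ 4"
    using n by (simp add: field_simps eval_nat_numeral)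
  finally show ?thesis .
qed

text \<open>Lagrange's identity writes the squared area of a parallelogram in inner products, each
  of which scales by \<open>|r|^-4\<close>.\<close>

lemma norm_cross3_inversion_derivative:
  assumes "r \<noteq> 0"
  shows "norm (cross3 (inversion_derivative r v) (inversion_derivative r w)) = norm (cross3 v w) / norm r ^ 4"
proof (rule power2_eq_imp_eq)
  have sq: "(norm (cross3 a b))\<^sup>2 = (a \<bullet> a) * (b \<bullet> b) - (a \<bullet> b)\<^sup>2" for a b
    using norm_cross_dot[of a b] by (simp add: power_mult_distrib power2_norm_eq_inner)
  show "(norm (cross3 (inversion_derivative r v) (inversion_derivative r w)))\<^sup>2 =
      (norm (cross3 v w) / norm r ^ 4)\<^sup>2"
    unfolding power_divide sq inner_inversion_derivative[OF assms]
    by (simp add: diff_divide_distrib power2_eq_square)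
qed auto

lemma linear_inversion_derivative: "linear (inversion_derivative r)"
  by (rule linearI)
    (auto simp: inversion_derivative_def inner_add_right algebra_simps add_divide_distrib)

lemma inj_inversion_derivative:
  assumes "r \<noteq> 0"
  shows "inj (inversion_derivative r)"
proof (rule linear_injective_0[OF linear_inversion_derivative, THEN iffD2], safe)
  fix v assume "inversion_derivative r v = 0"
  then have "(v \<bullet> v) / norm r ^ 4 = 0"
    using inner_inversion_derivative[OF assms, of v v] by simp
  then show "v = 0" using assms by simp
qed

lemma frechet_derivative_inversion_comp:
  assumes "C1_on x U" "u \<in> U" "x u \<noteq> q"
  shows "(sphere_inversion q \<circ> x has_derivative
           inversion_derivative (x u - q) \<circ> frechet_derivative x (at u)) (at u)"
    and "frechet_derivative (sphere_inversion q \<circ> x) (at u) =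
           inversion_derivative (x u - q) \<circ> frechet_derivative x (at u)"
proof -
  show "(sphere_inversion q \<circ> x has_derivative
           inversion_derivative (x u - q) \<circ> frechet_derivative x (at u)) (at u)"
    by (rule diff_chain_at[OF C1_on_has_derivative[OF assms(1,2)] has_derivative_sphere_inversion[OF assms(3)]])
  then show "frechet_derivative (sphere_inversion q \<circ> x) (at u) =
           inversion_derivative (x u - q) \<circ> frechet_derivative x (at u)"
    using frechet_derivative_at by metis
qed

lemma area_element_inversion_comp:
  assumes "C1_on x U" "u \<in> U" "x u \<noteq> q"
  shows "area_element (sphere_inversion q \<circ> x) u = area_element x u / norm (x u - q) ^ 4"
  using assms(3) unfolding area_element_def frechet_derivative_inversion_comp(2)[OF assms]
  by (simp add: norm_cross3_inversion_derivative)

text \<open>That \<open>q\<close> is not in \<open>S\<close> does not keep it out of the image of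
  \<open>U\<close>: beyond the half-plane the map \<open>x\<close> may leave \<open>S\<close>, and
  the inverted chart would not be C1 where it meets \<open>q\<close>.\<close>

lemma surface_chart_inversion:
  assumes cx: "surface_chart S x U" and q: "q \<notin> S" and qU: "q \<notin> x ` U"
  shows "surface_chart (sphere_inversion q ` S) (sphere_inversion q \<circ> x) U"
  unfolding surface_chart_def
proof (intro conjI ballI)
  note X = surface_chartD[OF cx]
  have ne: "x u \<noteq> q" if "u \<in> U" for u using qU that by blast
  show "open U" by (rule X(1))
  show "C1_on (sphere_inversion q \<circ> x) U"
    unfolding C1_on_def
  proof (intro conjI ballI allI)
    fix u assume "u \<in> U"
    then show "sphere_inversion q \<circ> x differentiable at u"
      using frechet_derivative_inversion_comp(1)[OF X(2)] ne differentiableI by blast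
  next
    fix v
    have "continuous_on U (\<lambda>u. frechet_derivative x (at u) v)"
      using X(2) by (auto simp: C1_on_def)
    then have "continuous_on U (\<lambda>u. inversion_derivative (x u - q) (frechet_derivative x (at u) v))"
      unfolding inversion_derivative_def using X(5) ne by (intro continuous_intros) auto
    then show "continuous_on U (\<lambda>u. frechet_derivative (sphere_inversion q \<circ> x) (at u) v)"
      by (rule continuous_on_eq) (simp add: frechet_derivative_inversion_comp(2)[OF X(2)] ne)
  qed
  show "inj (frechet_derivative (sphere_inversion q \<circ> x) (at u))" if "u \<in> U" for u
    unfolding frechet_derivative_inversion_comp(2)[OF X(2) that ne[OF that]]
    using X(3)[OF that] inj_inversion_derivative[of "x u - q"] ne[OF that] by (intro inj_compose) auto
  have "openin (top_of_set S) (x ` (U \<inter> half_plane))"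
    using cx by (simp add: surface_chart_def)
  from homeomorphism_imp_open_map[OF homeomorphism_sphere_inversion[OF q] this]
  show "openin (top_of_set (sphere_inversion q ` S)) ((sphere_inversion q \<circ> x) ` (U \<inter> half_plane))"
    by (simp add: image_comp)
  obtain y where y: "homeomorphism (U \<inter> half_plane) (x ` (U \<inter> half_plane)) x y"
    using cx unfolding surface_chart_def by blast
  have "q \<notin> x ` (U \<inter> half_plane)" using q X(4) by blast
  from homeomorphism_compose[OF y homeomorphism_sphere_inversion[OF this]]
  show "\<exists>y. homeomorphism (U \<inter> half_plane) ((sphere_inversion q \<circ> x) ` (U \<inter> half_plane)) (sphere_inversion q \<circ> x) y"
    by (auto simp: image_comp)
qed

lemma has_surface_area_inversion:
  fixes n :: nat
  assumes x: "\<And>i. i < n \<Longrightarrow> surface_chart S (x i) (U i) \<and> A i \<in> sets borel \<and> A i \<subseteq> U i \<inter> half_plane"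
    and dx: "disjoint_family_on (\<lambda>i. x i ` A i) {..<n}" and ux: "(\<Union>i<n. x i ` A i) = S"
    and q: "q \<notin> S"
  shows "has_surface_area (sphere_inversion q ` S)
    (\<Sum>i<n. \<integral>\<^sup>+ u\<in>A i. ennreal (area_element (x i) u / norm (x i u - q) ^ 4) \<partial>lborel)"
proof -
  \<comment> \<open>The charts lose the parameters sent to \<open>q\<close>, while the pieces
    \<open>A i\<close> stay as they are because they map into \<open>S\<close>.\<close>
  let ?V = "\<lambda>i. {u \<in> U i. x i u \<noteq> q}"
  have V: "surface_chart (sphere_inversion q ` S) (sphere_inversion q \<circ> x i) (?V i)" if "i < n" for i
  proof -
    have "open (x i -` (- {q}) \<inter> U i)"
      using x[OF that] surface_chartD(1,5) continuous_on_open_vimage by blast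
    moreover have "x i -` (- {q}) \<inter> U i = ?V i" by blast
    ultimately have "surface_chart S (x i) (U i \<inter> ?V i)"
      using surface_chart_Int_open x[OF that] by simp
    moreover have "U i \<inter> ?V i = ?V i" by blast
    ultimately show ?thesis using surface_chart_inversion[OF _ q] by auto
  qed
  have AV: "A i \<subseteq> ?V i \<inter> half_plane" if "i < n" for i
    using x[OF that] ux q that by blast
  have "(\<Sum>i<n. \<integral>\<^sup>+ u\<in>A i. ennreal (area_element (x i) u / norm (x i u - q) ^ 4) \<partial>lborel) =
      (\<Sum>i<n. \<integral>\<^sup>+ u\<in>A i. ennreal (area_element (sphere_inversion q \<circ> x i) u) \<partial>lborel)"
  proof (intro sum.cong refl nn_integral_cong)
    fix i u assume i: "i \<in> {..<n}"
    then have "u \<in> A i \<Longrightarrow> area_element (sphere_inversion q \<circ> x i) u = area_element (x i) u / norm (x i u - q) ^ 4"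
      using AV[of i] x[of i] surface_chartD(2)[of S "x i" "U i"]
      by (intro area_element_inversion_comp[of _ "U i"]) auto
    then show "ennreal (area_element (x i) u / norm (x i u - q) ^ 4) * indicator (A i) u =
        ennreal (area_element (sphere_inversion q \<circ> x i) u) * indicator (A i) u"
      by (auto simp: indicator_def)
  qed
  moreover have "disjoint_family_on (\<lambda>i. (sphere_inversion q \<circ> x i) ` A i) {..<n}"
    using dx unfolding disjoint_family_on_def image_comp[symmetric]
    by (simp add: image_Int[symmetric] inj_on_def)
  moreover have "(\<Union>i<n. (sphere_inversion q \<circ> x i) ` A i) = sphere_inversion q ` S"
    unfolding image_comp[symmetric] ux[symmetric] by blast
  ultimately show ?thesis
    unfolding has_surface_area_def
    using V AV x by (intro exI[of _ n] exI[of _ "\<lambda>i. sphere_inversion q \<circ> x i"] exI[of _ ?V] exI[of _ A]) auto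
qed

section \<open>Finite chart decompositions\<close>

text \<open>An area element may blow up at the edge of the chart domain; on a closed disc inside the
  domain it is bounded by compactness. The bound \<open>M\<close> later provides the
  domination.\<close>

lemma small_chart_exists:
  assumes "surface_chart S x U" "u0 \<in> U"
  obtains r M where "r > 0" "ball u0 r \<subseteq> U" "surface_chart S x (ball u0 r)"
    "\<And>u. u \<in> ball u0 r \<Longrightarrow> area_element x u \<le> M"
    "(\<integral>\<^sup>+u\<in>ball u0 r. ennreal (area_element x u) \<partial>lborel) < \<infinity>"
proof -
  note X = surface_chartD[OF assms(1)]
  obtain r where r: "r > 0" "cball u0 r \<subseteq> U"
    using X(1) assms(2) open_contains_cball by blast
  have br: "ball u0 r \<subseteq> U" using r by (meson ball_subset_cball order_trans)
  have "compact (area_element x ` cball u0 r)"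
    using area_element_continuous[OF X(2)] r(2) by (intro compact_continuous_image) (auto intro: continuous_on_subset)
  then have "bounded (area_element x ` cball u0 r)" by (rule compact_imp_bounded)
  then obtain M where "\<And>y. y \<in> area_element x ` cball u0 r \<Longrightarrow> norm y \<le> M"
    unfolding bounded_iff by blast
  then have M: "area_element x u \<le> M" if "u \<in> ball u0 r" for u
    using that ball_subset_cball[of u0 r] by fastforce
  have "(\<integral>\<^sup>+u\<in>ball u0 r. ennreal (area_element x u) \<partial>lborel) \<le>
      (\<integral>\<^sup>+u. ennreal M * indicator (ball u0 r) u \<partial>lborel)"
    using M by (intro nn_integral_mono) (auto simp: indicator_def intro: ennreal_leI)
  also have "\<dots> = ennreal M * emeasure lborel (ball u0 r)"
    by (rule nn_integral_cmult_indicator) simp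
  also have "\<dots> < \<infinity>"
    using emeasure_lborel_ball_finite[of u0 r] by (simp add: ennreal_mult_less_top)
  finally have fin: "(\<integral>\<^sup>+u\<in>ball u0 r. ennreal (area_element x u) \<partial>lborel) < \<infinity>" .
  have "U \<inter> ball u0 r = ball u0 r" using br by blast
  then have "surface_chart S x (ball u0 r)"
    using surface_chart_Int_open[OF assms(1), of "ball u0 r"] by simp
  then show ?thesis using that r(1) br fin M by blast
qed

text \<open>Compactness gives finitely many small charts, and each one gives up what earlier ones
  cover. The prescribed chart comes first and so keeps its whole domain: its piece contains a
  neighbourhood in \<open>S\<close> of each of its points.\<close>

lemma finite_chart_decomposition:
  assumes S: "regular_surface S" "compact S"
    and x0: "surface_chart S x0 U0" "(\<integral>\<^sup>+u\<in>U0. ennreal (area_element x0 u) \<partial>lborel) < \<infinity>"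
  obtains n :: nat and x U A where "0 < n" "x 0 = x0" "A 0 = U0 \<inter> half_plane"
    "\<And>i. i < n \<Longrightarrow> surface_chart S (x i) (U i) \<and> A i \<in> sets borel \<and> A i \<subseteq> U i \<inter> half_plane"
    "disjoint_family_on (\<lambda>i. x i ` A i) {..<n}" "(\<Union>i<n. x i ` A i) = S"
    "\<And>i. i < n \<Longrightarrow> (\<integral>\<^sup>+u\<in>A i. ennreal (area_element (x i) u) \<partial>lborel) < \<infinity>"
proof -
  let ?small = "\<lambda>x U. surface_chart S x U \<and> (\<integral>\<^sup>+u\<in>U. ennreal (area_element x u) \<partial>lborel) < \<infinity>"
  have "\<exists>c. ?small (fst c) (snd c) \<and> z \<in> fst c ` (snd c \<inter> half_plane)" if z: "z \<in> S" for z
  proof -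
    obtain x U u where x: "surface_chart S x U" "u \<in> U \<inter> half_plane" "z = x u"
      using S(1) z unfolding regular_surface_def by blast
    have "u \<in> U" using x(2) by simp
    obtain r M where "r > 0" "ball u r \<subseteq> U" "surface_chart S x (ball u r)"
      "\<And>v. v \<in> ball u r \<Longrightarrow> area_element x v \<le> M"
      "(\<integral>\<^sup>+v\<in>ball u r. ennreal (area_element x v) \<partial>lborel) < \<infinity>"
      by (rule small_chart_exists[OF x(1) \<open>u \<in> U\<close>]) (rule that; assumption)
    then show ?thesis using x by (intro exI[of _ "(x, ball u r)"]) auto
  qed
  then have "\<forall>z\<in>S. \<exists>c. ?small (fst c) (snd c) \<and> z \<in> fst c ` (snd c \<inter> half_plane)"
    by blast
  then obtain F where F: "\<forall>z\<in>S. ?small (fst (F z)) (snd (F z)) \<and> z \<in> fst (F z) ` (snd (F z) \<inter> half_plane)"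
    by (rule bchoice[THEN exE])
  define X where "X z = fst (F z)" for z
  define V where "V z = snd (F z)" for z
  have XV: "?small (X z) (V z)" "z \<in> X z ` (V z \<inter> half_plane)" if "z \<in> S" for z
    using F that unfolding X_def V_def by blast+
  have "\<exists>T. open T \<and> X z ` (V z \<inter> half_plane) = S \<inter> T" if "z \<in> S" for z
    using XV(1)[OF that] unfolding surface_chart_def openin_open by blast
  then obtain T where T: "\<And>z. z \<in> S \<Longrightarrow> open (T z)"
    "\<And>z. z \<in> S \<Longrightarrow> X z ` (V z \<inter> half_plane) = S \<inter> T z" by metis
  have "S \<subseteq> (\<Union>z\<in>S. T z)" using XV(2) T(2) by blast
  then obtain C where C: "C \<subseteq> S" "finite C" "S \<subseteq> (\<Union>z\<in>C. T z)"
    using compactE_image[OF S(2), of S T] T(1) by blast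
  obtain zs where zs: "set zs = C" using C(2) finite_list by blast
  define n where "n = Suc (length zs)"
  define x where "x i = (if i = 0 then x0 else X (zs ! (i - 1)))" for i
  define U where "U i = (if i = 0 then U0 else V (zs ! (i - 1)))" for i
  define A where "A i = {u \<in> U i \<inter> half_plane. \<forall>j<i. x i u \<notin> x j ` (U j \<inter> half_plane)}" for i
  have small: "?small (x i) (U i)" if "i < n" for i
  proof (cases i)
    case (Suc k)
    then have "zs ! k \<in> S" using that C(1) zs by (auto simp: n_def)
    then show ?thesis using XV(1) Suc by (simp add: x_def U_def)
  qed (use x0 in \<open>simp add: x_def U_def\<close>)
  have Hb: "U i \<inter> half_plane \<in> sets borel" if "i < n" for i
    using small[OF that] surface_chartD(1) borel_half_plane by auto
  have Ab: "A i \<in> sets borel" if i: "i < n" for i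
  proof -
    have "{u \<in> U i \<inter> half_plane. x i u \<in> x j ` (U j \<inter> half_plane)} \<in> sets borel" if "j < i" for j
    proof -
      have j: "j < n" using i that by simp
      show ?thesis
        by (rule chart_overlap_area(1)[OF conjunct1[OF small[OF i]] conjunct1[OF small[OF j]]
              Hb[OF i] order_refl Hb[OF j] order_refl])
    qed
    then have "U i \<inter> half_plane - (\<Union>j<i. {u \<in> U i \<inter> half_plane. x i u \<in> x j ` (U j \<inter> half_plane)}) \<in> sets borel"
      using Hb[OF i] by (intro sets.Diff sets.finite_UN) auto
    moreover have "U i \<inter> half_plane - (\<Union>j<i. {u \<in> U i \<inter> half_plane. x i u \<in> x j ` (U j \<inter> half_plane)}) = A i"
      by (auto simp: A_def)
    ultimately show ?thesis by simp
  qed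
  have AU: "A i \<subseteq> U i \<inter> half_plane" for i by (auto simp: A_def)
  have disj: "x i ` A i \<inter> x j ` A j = {}" if "i < j" for i j
  proof -
    have no: "x j u \<notin> x i ` (U i \<inter> half_plane)" if "u \<in> A j" for u
      using that \<open>i < j\<close> by (auto simp: A_def[of j])
    show ?thesis
    proof (rule equals0I)
      fix z assume "z \<in> x i ` A i \<inter> x j ` A j"
      then obtain u v where "z = x i u" "u \<in> A i" "z = x j v" "v \<in> A j" by (elim IntE imageE)
      then show False using no[of v] AU[of i] by (metis imageI subsetD)
    qed
  qed
  have dis: "disjoint_family_on (\<lambda>i. x i ` A i) {..<n}"
    unfolding disjoint_family_on_def using disj by (metis inf_commute linorder_neqE_nat)
  have un: "(\<Union>i<n. x i ` A i) = S"
  proof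
    show "(\<Union>i<n. x i ` A i) \<subseteq> S"
      using small surface_chartD(4) AU by blast
    show "S \<subseteq> (\<Union>i<n. x i ` A i)"
    proof
      fix z assume "z \<in> S"
      then obtain c where c: "c \<in> C" "z \<in> T c" using C(3) by blast
      then obtain k where k: "k < length zs" "zs ! k = c" using zs by (metis in_set_conv_nth)
      have "z \<in> X c ` (V c \<inter> half_plane)" using T(2) c C(1) \<open>z \<in> S\<close> by blast
      then have ex: "z \<in> x (Suc k) ` (U (Suc k) \<inter> half_plane)" using k by (simp add: x_def U_def)
      \<comment> \<open>The piece containing \<open>z\<close> belongs to the first chart whose image
        contains \<open>z\<close>.\<close>
      define P where "P i \<longleftrightarrow> z \<in> x i ` (U i \<inter> half_plane)" for i
      have Pk: "P (Suc k)" using ex by (simp add: P_def)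
      define i where "i = (LEAST i. P i)"
      have i: "z \<in> x i ` (U i \<inter> half_plane)"
        using LeastI[of P, OF Pk] unfolding i_def P_def .
      have "i \<le> Suc k" unfolding i_def by (rule Least_le[of P, OF Pk])
      then have "i < n" using k by (simp add: n_def)
      have "z \<notin> x j ` (U j \<inter> half_plane)" if "j < i" for j
        using not_less_Least[of j P] that unfolding i_def P_def by blast
      with i have "z \<in> x i ` A i" unfolding A_def by blast
      with \<open>i < n\<close> show "z \<in> (\<Union>i<n. x i ` A i)" by blast
    qed
  qed
  have fin: "(\<integral>\<^sup>+u\<in>A i. ennreal (area_element (x i) u) \<partial>lborel) < \<infinity>" if "i < n" for i
  proof -
    have "(\<integral>\<^sup>+u\<in>A i. ennreal (area_element (x i) u) \<partial>lborel) \<le>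
        (\<integral>\<^sup>+u\<in>U i. ennreal (area_element (x i) u) \<partial>lborel)"
      using AU[of i] by (intro nn_integral_mono) (auto simp: indicator_def)
    then show ?thesis using small[OF that] by (meson le_less_trans)
  qed
  show ?thesis
  proof (rule that[of n x A U])
    show "0 < n" "x 0 = x0" "A 0 = U0 \<inter> half_plane"
      by (auto simp: n_def x_def A_def U_def)
    show "surface_chart S (x i) (U i) \<and> A i \<in> sets borel \<and> A i \<subseteq> U i \<inter> half_plane" if "i < n" for i
      using small[OF that] Ab[OF that] AU[of i] by blast
  qed (use dis un fin in auto)
qed

section \<open>The local area integral\<close>

lemma nn_integral_inverse_square_norm_plane:
  "(\<integral>\<^sup>+ v. ennreal (1 / (1 + (norm v)\<^sup>2)\<^sup>2) \<partial>(lborel :: (real^2) measure)) = ennreal pi"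
proof -
  \<comment> \<open>Layer cake: \<open>1/(1 + a\<^sup>2)\<^sup>2\<close> is the integral of this kernel over \<open>{a..}\<close>.\<close>
  let ?k = "\<lambda>s::real. 4 * s / (1 + s\<^sup>2) ^ 3"
  have pos: "0 < 1 + s\<^sup>2" for s :: real by (simp add: add_pos_nonneg)
  have inner: "(\<integral>\<^sup>+ s. ennreal (?k s) * indicator {a..} s \<partial>lborel) = ennreal (1 / (1 + a\<^sup>2)\<^sup>2)"
    if "0 \<le> a" for a :: real
  proof -
    have "(\<integral>\<^sup>+ s. ennreal (?k s) * indicator {a..} s \<partial>lborel) = ennreal (0 - (- 1 / (1 + a\<^sup>2)\<^sup>2))"
    proof (rule nn_integral_FTC_atLeast)
      show "DERIV (\<lambda>s. - 1 / (1 + s\<^sup>2)\<^sup>2) s :> ?k s" for s :: real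
        using pos[of s] by (auto intro!: derivative_eq_intros simp: divide_simps)
          (simp add: eval_nat_numeral algebra_simps)
      show "((\<lambda>s::real. - 1 / (1 + s\<^sup>2)\<^sup>2) \<longlongrightarrow> 0) at_top" by real_asymp
    qed (use that in auto)
    then show ?thesis by simp
  qed
  \<comment> \<open>Exchanging the two integrals leaves, for each \<open>s\<close>, a disc of radius
    \<open>s\<close>, whose area is the factor \<open>pi * s\<^sup>2\<close>.\<close>
  have outer: "(\<integral>\<^sup>+ s. ennreal (pi * s\<^sup>2 * ?k s) * indicator {0..} s \<partial>lborel) = ennreal pi"
  proof -
    have "(\<integral>\<^sup>+ s. ennreal (pi * s\<^sup>2 * ?k s) * indicator {0..} s \<partial>lborel) =
        ennreal (pi - pi * 0 ^ 4 / (1 + 0\<^sup>2)\<^sup>2)"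
    proof (rule nn_integral_FTC_atLeast)
      show "DERIV (\<lambda>s. pi * s ^ 4 / (1 + s\<^sup>2)\<^sup>2) s :> pi * s\<^sup>2 * ?k s" for s :: real
        using pos[of s] by (auto intro!: derivative_eq_intros simp: divide_simps)
          (simp add: eval_nat_numeral algebra_simps)
      show "((\<lambda>s::real. pi * s ^ 4 / (1 + s\<^sup>2)\<^sup>2) \<longlongrightarrow> pi) at_top" by real_asymp
    qed auto
    then show ?thesis by simp
  qed
  have "(\<integral>\<^sup>+ v. ennreal (1 / (1 + (norm v)\<^sup>2)\<^sup>2) \<partial>(lborel :: (real^2) measure)) =
      (\<integral>\<^sup>+ v. (\<integral>\<^sup>+ s. ennreal (?k s) * indicator {norm (v :: real^2)..} s \<partial>lborel) \<partial>lborel)"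
    by (simp add: inner)
  also have "\<dots> = (\<integral>\<^sup>+ s. (\<integral>\<^sup>+ v. ennreal (?k s) * indicator {norm (v :: real^2)..} s \<partial>lborel) \<partial>lborel)"
  proof (rule lborel_pair.Fubini'[symmetric])
    have "(\<lambda>x :: (real^2) \<times> real. ennreal (?k (snd x)) * (if norm (fst x) \<le> snd x then 1 else 0))
        \<in> borel_measurable (lborel \<Otimes>\<^sub>M lborel)"
      by measurable
    then show "(\<lambda>(v :: real^2, s). ennreal (?k s) * indicator {norm v..} s)
        \<in> borel_measurable (lborel \<Otimes>\<^sub>M lborel)"
      by (simp add: case_prod_unfold indicator_def of_bool_def)
  qed
  also have "\<dots> = (\<integral>\<^sup>+ s. ennreal (pi * s\<^sup>2 * ?k s) * indicator {0..} s \<partial>lborel)"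
  proof (rule nn_integral_cong)
    fix s :: real
    have "(\<integral>\<^sup>+ v. ennreal (?k s) * indicator {norm (v :: real^2)..} s \<partial>lborel) =
        (\<integral>\<^sup>+ v. ennreal (?k s) * indicator (cball (0 :: real^2) s) v \<partial>lborel)"
      by (intro nn_integral_cong) (auto simp: indicator_def)
    also have "\<dots> = ennreal (?k s) * emeasure lborel (cball (0 :: real^2) s)"
      by (rule nn_integral_cmult_indicator) simp
    also have "\<dots> = ennreal (pi * s\<^sup>2 * ?k s) * indicator {0..} s"
    proof (cases "s \<ge> 0")
      case True
      then show ?thesis
        by (simp add: emeasure_cball unit_ball_vol_2 ennreal_mult[symmetric] mult.commute)
    qed simp
    finally show "(\<integral>\<^sup>+ v. ennreal (?k s) * indicator {norm (v :: real^2)..} s \<partial>lborel) =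
        ennreal (pi * s\<^sup>2 * ?k s) * indicator {0..} s" .
  qed
  also note outer
  finally show ?thesis .
qed

lemma has_derivative_directional:
  fixes f :: "'a::real_normed_vector \<Rightarrow> 'b::real_normed_vector"
  assumes "(f has_derivative D) (at u)"
  shows "((\<lambda>t. (1 / t) *\<^sub>R (f (u + t *\<^sub>R w) - f u)) \<longlongrightarrow> D w) (at 0)"
proof -
  have "((\<lambda>t. u + t *\<^sub>R w) has_derivative (\<lambda>t. t *\<^sub>R w)) (at 0)"
    by (auto intro!: derivative_eq_intros)
  moreover have "(f has_derivative D) (at (u + 0 *\<^sub>R w))" using assms by simp
  ultimately have "((\<lambda>t. f (u + t *\<^sub>R w)) has_derivative (\<lambda>t. D (t *\<^sub>R w))) (at (0 :: real))"
    using has_derivative_compose[of "\<lambda>t. u + t *\<^sub>R w" "\<lambda>t. t *\<^sub>R w" 0 UNIV f D] by simp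
  then have "((\<lambda>t. norm (f (u + t *\<^sub>R w) - f u - D (t *\<^sub>R w)) / norm t) \<longlongrightarrow> 0) (at (0 :: real))"
    by (simp add: has_derivative_at)
  then have "((\<lambda>t. norm ((1 / t) *\<^sub>R (f (u + t *\<^sub>R w) - f u) - D w)) \<longlongrightarrow> 0) (at 0)"
  proof (rule Lim_transform_eventually)
    show "\<forall>\<^sub>F t in at 0. norm (f (u + t *\<^sub>R w) - f u - D (t *\<^sub>R w)) / norm t =
        norm ((1 / t) *\<^sub>R (f (u + t *\<^sub>R w) - f u) - D w)"
    proof (rule eventually_at_ball'[THEN eventually_mono, of 1])
      fix t :: real assume t: "t \<in> ball 0 1 \<and> t \<noteq> 0 \<and> t \<in> UNIV"
      have "D (t *\<^sub>R w) = t *\<^sub>R D w"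
        using assms has_derivative_linear linear_cmul by blast
      then have "(1 / t) *\<^sub>R (f (u + t *\<^sub>R w) - f u) - D w =
          (1 / t) *\<^sub>R (f (u + t *\<^sub>R w) - f u - D (t *\<^sub>R w))"
        using t by (simp add: scaleR_diff_right)
      then show "norm (f (u + t *\<^sub>R w) - f u - D (t *\<^sub>R w)) / norm t =
          norm ((1 / t) *\<^sub>R (f (u + t *\<^sub>R w) - f u) - D w)" by simp
    qed simp
  qed
  then show ?thesis by (simp add: tendsto_norm_zero_iff LIM_zero_iff)
qed

text \<open>The assumption caps the mixed term of the expanded square by \<open>|t| |h|\<close>,
  which is at most half of \<open>|h|^2 + t^2\<close>.\<close>

lemma norm_diff_normal_ge:
  fixes h N :: "'a::real_inner"
  assumes "norm N = 1" "\<bar>h \<bullet> N\<bar> \<le> 1 / 2 * norm h"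
  shows "1 / 2 * ((norm h)\<^sup>2 + t\<^sup>2) \<le> (norm (h - t *\<^sub>R N))\<^sup>2"
proof -
  have "(norm (h - t *\<^sub>R N))\<^sup>2 = (norm h)\<^sup>2 - 2 * (t * (h \<bullet> N)) + t\<^sup>2"
  proof -
    have "N \<bullet> N = 1" using assms(1) by (simp add: dot_square_norm)
    then show ?thesis
      unfolding power2_norm_eq_inner
      by (simp add: inner_diff_left inner_diff_right inner_commute power2_eq_square)
  qed
  moreover have "2 * (t * (h \<bullet> N)) \<le> \<bar>t\<bar> * norm h"
  proof -
    have "t * (h \<bullet> N) \<le> \<bar>t\<bar> * \<bar>h \<bullet> N\<bar>" by (metis abs_ge_self abs_mult)
    also have "\<dots> \<le> \<bar>t\<bar> * (1 / 2 * norm h)" by (rule mult_left_mono[OF assms(2)]) simp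
    finally show ?thesis by simp
  qed
  moreover have "0 \<le> (norm h)\<^sup>2 - 2 * (\<bar>t\<bar> * norm h) + t\<^sup>2"
    using zero_le_power2[of "norm h - \<bar>t\<bar>"] by (simp add: power2_diff mult.commute mult.left_commute)
  ultimately show ?thesis by argo
qed

lemma nn_integral_normal_distance:
  fixes D :: "real^2 \<Rightarrow> real^3"
  assumes "linear D" "inj D"
  shows "(\<integral>\<^sup>+ w. ennreal (norm (cross3 (D (axis 1 1)) (D (axis 2 1))) / (1 + (norm (D w))\<^sup>2)\<^sup>2) \<partial>lborel) = ennreal pi"
proof -
  define a b where "a = D (axis 1 1)" and "b = D (axis 2 1)"
  have a0: "norm a \<noteq> 0"
    using linear_injective_0[OF assms(1)] assms(2) by (auto simp: a_def)
  \<comment> \<open>The Cholesky factor of the first fundamental form, so that \<open>\<bar>M w\<bar> = \<bar>D w\<bar>\<close>.\<close>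
  define M where "M w = (vector [norm a * w $ 1 + (a \<bullet> b) / norm a * w $ 2,
      norm (cross3 a b) / norm a * w $ 2] :: real^2)" for w :: "real^2"
  have linM: "linear M"
    by (rule linearI) (auto simp: M_def vec_eq_iff forall_2 algebra_simps)
  have ex: "v = v $ 1 *\<^sub>R axis 1 1 + v $ 2 *\<^sub>R axis 2 1" for v :: "real^2"
    by (simp add: vec_eq_iff forall_2 axis_def)
  have D: "D v = v $ 1 *\<^sub>R a + v $ 2 *\<^sub>R b" for v
    unfolding a_def b_def
    by (subst ex[of v]) (simp only: linear_add[OF assms(1)] linear_cmul[OF assms(1)])
  have normM: "(norm (M w))\<^sup>2 = (norm (D w))\<^sup>2" for w
  proof -
    have "(norm (M w))\<^sup>2 = (norm a * w $ 1 + (a \<bullet> b) / norm a * w $ 2)\<^sup>2 + (norm (cross3 a b) / norm a * w $ 2)\<^sup>2"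
      unfolding power2_norm_eq_inner by (simp add: inner_vec_def sum_2 M_def power2_eq_square)
    also have "\<dots> = (norm a)\<^sup>2 * (w $ 1)\<^sup>2 + 2 * (a \<bullet> b) * w $ 1 * w $ 2
        + ((norm (cross3 a b))\<^sup>2 + (a \<bullet> b)\<^sup>2) / (norm a)\<^sup>2 * (w $ 2)\<^sup>2"
      using a0 by (simp add: field_simps power2_eq_square)
    also have "\<dots> = (norm a)\<^sup>2 * (w $ 1)\<^sup>2 + 2 * (a \<bullet> b) * w $ 1 * w $ 2 + (norm b)\<^sup>2 * (w $ 2)\<^sup>2"
      unfolding norm_cross_dot using a0 by (simp add: power_mult_distrib)
    also have "\<dots> = (norm (D w))\<^sup>2"
      unfolding D power2_norm_eq_inner
      by (simp add: inner_add_left inner_add_right inner_commute power2_eq_square algebra_simps)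
    finally show ?thesis .
  qed
  have injM: "inj M"
  proof (rule linear_injective_0[OF linM, THEN iffD2], safe)
    fix v assume "M v = 0"
    then have "D v = 0" using normM[of v] by simp
    then show "v = 0" using linear_injective_0[OF assms(1)] assms(2) by blast
  qed
  have rangeM: "range M = UNIV" using linear_injective_imp_surjective[OF linM injM] by auto
  have detM: "\<bar>det (matrix M)\<bar> = norm (cross3 a b)"
    using a0 by (simp add: det_2 matrix_def M_def axis_def)
  have "(\<integral>\<^sup>+ w\<in>UNIV. ennreal (norm (cross3 a b) / (1 + (norm (D w))\<^sup>2)\<^sup>2) \<partial>lborel) =
      (\<integral>\<^sup>+ w\<in>M ` UNIV. ennreal (1 / (1 + (norm w)\<^sup>2)\<^sup>2) \<partial>lborel)"
  proof (rule nn_integral_change_of_variables)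
    show "(M has_derivative M) (at u within UNIV)" for u
      using linM by (simp add: linear_imp_has_derivative)
    have "continuous_on UNIV D" using assms(1) by (simp add: linear_continuous_on linear_conv_bounded_linear)
    then have "continuous_on UNIV (\<lambda>w. norm (cross3 a b) / (1 + (norm (D w))\<^sup>2)\<^sup>2)"
      by (intro continuous_intros) (auto simp: add_nonneg_eq_0_iff)
    then have "(\<lambda>w. norm (cross3 a b) / (1 + (norm (D w))\<^sup>2)\<^sup>2) \<in> borel_measurable borel"
      by (rule borel_measurable_continuous_onI)
    then show "(\<lambda>u. indicat_real UNIV u * (norm (cross3 a b) / (1 + (norm (D u))\<^sup>2)\<^sup>2)) \<in> borel_measurable borel"
      by simp
  qed (use injM in \<open>auto simp: detM normM rangeM\<close>)
  then show ?thesis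
    using nn_integral_inverse_square_norm_plane by (simp add: rangeM a_def b_def)
qed

text \<open>Substituting \<open>u = u0 + t w\<close> replaces the chart by its linearization in the
  limit. The limit is the same for every small radius because the blown-up disc fills the plane in
  any case; this freedom lets the disc be shrunk into the half-plane afterwards.\<close>

lemma local_area_limit:
  assumes cx: "surface_chart S x U" "u0 \<in> U"
    and N: "norm N = 1" "\<And>v. N \<bullet> frechet_derivative x (at u0) v = 0"
  obtains \<rho>0 where "\<rho>0 > 0" "ball u0 \<rho>0 \<subseteq> U"
    "(\<integral>\<^sup>+u\<in>ball u0 \<rho>0. ennreal (area_element x u) \<partial>lborel) < \<infinity>"
    "\<And>\<rho>. 0 < \<rho> \<Longrightarrow> \<rho> \<le> \<rho>0 \<Longrightarrow>
      ((\<lambda>t. ennreal (t\<^sup>2) * (\<integral>\<^sup>+u\<in>ball u0 \<rho>. ennreal (area_element x u / norm (x u - (x u0 + t *\<^sub>R N)) ^ 4) \<partial>lborel))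
        \<longlongrightarrow> ennreal pi) (at 0)"
proof -
  note X = surface_chartD[OF cx(1)]
  let ?D = "frechet_derivative x (at u0)"
  define p where "p = x u0"
  have linD: "linear ?D" and injD: "inj ?D"
    using C1_on_linear[OF X(2) cx(2)] X(3)[OF cx(2)] by auto
  obtain c d where c: "c > 0" and d: "d > 0" "ball u0 d \<subseteq> U"
    and lower: "\<And>u v. u \<in> ball u0 d \<Longrightarrow> v \<in> ball u0 d \<Longrightarrow> c * norm (u - v) \<le> norm (x u - x v)"
    and est: "\<And>u v. u \<in> ball u0 d \<Longrightarrow> v \<in> ball u0 d \<Longrightarrow>
       norm (x u - x v - ?D (u - v)) \<le> 1 / 2 * norm (x u - x v)"
    using surface_chart_bounded_below[OF cx, of "1 / 2"] by auto
  obtain r M where r: "r > 0" "ball u0 r \<subseteq> U" "surface_chart S x (ball u0 r)"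
    and M: "\<And>u. u \<in> ball u0 r \<Longrightarrow> area_element x u \<le> M"
    and fin: "(\<integral>\<^sup>+u\<in>ball u0 r. ennreal (area_element x u) \<partial>lborel) < \<infinity>"
    by (rule small_chart_exists[OF cx]) (rule that; assumption)
  define \<rho>0 where "\<rho>0 = min d r"
  have \<rho>0: "\<rho>0 > 0" "\<rho>0 \<le> d" "\<rho>0 \<le> r" using d r by (auto simp: \<rho>0_def)
  have M0: "0 \<le> M" using M[of u0] area_element_nonneg[of x u0] r(1) by simp
  \<comment> \<open>One constant for both terms: \<open>c\<^sup>2\<close> converts parameter
    distance into distance on \<open>S\<close>, and 1 is the coefficient of
    \<open>t\<^sup>2\<close>.\<close>
  define m where "m = min 1 (c\<^sup>2)"
  have m: "m > 0" "m \<le> 1" "m \<le> c\<^sup>2" using c by (auto simp: m_def)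
  have dist: "m / 2 * ((norm (u - u0))\<^sup>2 + t\<^sup>2) \<le> (norm (x u - (p + t *\<^sub>R N)))\<^sup>2" if "u \<in> ball u0 d" for u t
  proof -
    have u0: "u0 \<in> ball u0 d" using d by simp
    have "(x u - p) \<bullet> N = (x u - p - ?D (u - u0)) \<bullet> N"
      using N(2)[of "u - u0"] by (simp add: inner_diff_left inner_diff_right inner_commute)
    then have "\<bar>(x u - p) \<bullet> N\<bar> \<le> norm (x u - p - ?D (u - u0)) * norm N"
      by (metis Cauchy_Schwarz_ineq2)
    also have "\<dots> \<le> 1 / 2 * norm (x u - p)" using est[OF that u0] N(1) by (simp add: p_def)
    finally have "1 / 2 * ((norm (x u - p))\<^sup>2 + t\<^sup>2) \<le> (norm (x u - p - t *\<^sub>R N))\<^sup>2"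
      using norm_diff_normal_ge[OF N(1)] by blast
    moreover have "c\<^sup>2 * (norm (u - u0))\<^sup>2 \<le> (norm (x u - p))\<^sup>2"
      using lower[OF that u0] c unfolding p_def power_mult_distrib[symmetric]
      by (intro power_mono) auto
    moreover have "m * (norm (u - u0))\<^sup>2 \<le> c\<^sup>2 * (norm (u - u0))\<^sup>2" "m * t\<^sup>2 \<le> 1 * t\<^sup>2"
      using m by (intro mult_right_mono; simp)+
    ultimately show ?thesis by (simp add: algebra_simps)
  qed
  have lim: "((\<lambda>t. ennreal (t\<^sup>2) * (\<integral>\<^sup>+u\<in>ball u0 \<rho>. ennreal (area_element x u / norm (x u - (p + t *\<^sub>R N)) ^ 4) \<partial>lborel))
        \<longlongrightarrow> ennreal pi) (at 0)" if \<rho>: "0 < \<rho>" "\<rho> \<le> \<rho>0" for \<rho>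
  proof -
    define k where "k t u = area_element x u / norm (x u - (p + t *\<^sub>R N)) ^ 4" for t u
    \<comment> \<open>Two powers of \<open>t\<close> normalize the area and two are the Jacobian of
      the blow-up. Together they turn the denominator into
      \<open>|(x u - p)/t - N|^4\<close>.\<close>
    define h where "h t w = t ^ 4 * k t (u0 + t *\<^sub>R w)" for t w
    \<comment> \<open>Extension by zero puts all \<open>t\<close> on the same domain, the whole
      plane, for dominated convergence.\<close>
    define H where "H t w = ennreal (h t w) * indicator (ball 0 (\<rho> / \<bar>t\<bar>)) w" for t w
    define L where "L w = norm (cross3 (?D (axis 1 1)) (?D (axis 2 1))) / (1 + (norm (?D w))\<^sup>2)\<^sup>2" for w
    have \<rho>d: "ball u0 \<rho> \<subseteq> ball u0 d" "ball u0 \<rho> \<subseteq> ball u0 r" "ball u0 \<rho> \<subseteq> U"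
      using \<rho> \<rho>0 d by (auto simp: subset_eq)
    have ne: "x u - (p + t *\<^sub>R N) \<noteq> 0" if "u \<in> ball u0 \<rho>" "t \<noteq> 0" for u t
    proof
      assume "x u - (p + t *\<^sub>R N) = 0"
      then have "m / 2 * ((norm (u - u0))\<^sup>2 + t\<^sup>2) \<le> 0" using dist[of u t] \<rho>d that by auto
      moreover have "0 < (norm (u - u0))\<^sup>2 + t\<^sup>2" using that by (simp add: add_nonneg_pos)
      ultimately show False using m by (simp add: mult_le_0_iff)
    qed
    have kcont: "continuous_on (ball u0 \<rho>) (k t)" if "t \<noteq> 0" for t
      unfolding k_def using ne that \<rho>d(3) X(5) area_element_continuous[OF X(2)]
      by (intro continuous_intros) (auto intro: continuous_on_subset)
    have gball: "(\<lambda>w. u0 + t *\<^sub>R w) ` ball 0 (\<rho> / \<bar>t\<bar>) = ball u0 \<rho>" if t: "t \<noteq> 0" for t :: real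
    proof (rule set_eqI, rule iffI)
      fix u assume "u \<in> ball u0 \<rho>"
      then have "(1 / t) *\<^sub>R (u - u0) \<in> ball 0 (\<rho> / \<bar>t\<bar>)" "u = u0 + t *\<^sub>R ((1 / t) *\<^sub>R (u - u0))"
        using t by (auto simp: dist_norm norm_minus_commute divide_strict_right_mono)
      then show "u \<in> (\<lambda>w. u0 + t *\<^sub>R w) ` ball 0 (\<rho> / \<bar>t\<bar>)" by (rule rev_image_eqI)
    qed (use t in \<open>auto simp: dist_norm pos_less_divide_eq mult.commute\<close>)
    have hcont: "continuous_on (ball 0 (\<rho> / \<bar>t\<bar>)) (h t)" if "t \<noteq> 0" for t
      unfolding h_def
      by (intro continuous_intros continuous_on_compose2[OF kcont[OF that]]) (use gball[OF that] in auto)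
    have subst: "ennreal (t\<^sup>2) * (\<integral>\<^sup>+u\<in>ball u0 \<rho>. ennreal (k t u) \<partial>lborel) = (\<integral>\<^sup>+w. H t w \<partial>lborel)"
      if t: "t \<noteq> 0" for t
    proof -
      have ind: "ennreal a * indicator B w = ennreal (indicat_real B w * a)" for a B and w :: "real^2"
        by (cases "w \<in> B") auto
      have k0: "0 \<le> k t u" for u by (simp add: k_def area_element_nonneg)
      have "continuous_on (ball 0 (\<rho> / \<bar>t\<bar>)) (\<lambda>w. t\<^sup>2 * k t (u0 + t *\<^sub>R w))"
        by (intro continuous_intros continuous_on_compose2[OF kcont[OF t]]) (use gball[OF t] in auto)
      from borel_measurable_continuous_on_indicator[OF _ this]
      have meas: "(\<lambda>u. indicat_real (ball 0 (\<rho> / \<bar>t\<bar>)) u * (t\<^sup>2 * k t (u0 + t *\<^sub>R u))) \<in> borel_measurable borel"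
        by simp
      have "(\<integral>\<^sup>+w\<in>ball 0 (\<rho> / \<bar>t\<bar>). ennreal (t\<^sup>2 * k t (u0 + t *\<^sub>R w)) \<partial>lborel) =
          (\<integral>\<^sup>+u\<in>(\<lambda>w. u0 + t *\<^sub>R w) ` ball 0 (\<rho> / \<bar>t\<bar>). ennreal (k t u) \<partial>lborel)"
      proof (rule nn_integral_change_of_variables)
        show "((\<lambda>w. u0 + t *\<^sub>R w) has_derivative (\<lambda>v. t *\<^sub>R v)) (at u within ball 0 (\<rho> / \<bar>t\<bar>))" for u
          by (auto intro!: derivative_eq_intros)
        have "\<bar>det (matrix (\<lambda>v :: real^2. t *\<^sub>R v))\<bar> = t\<^sup>2"
          by (simp add: det_2 matrix_def axis_def power2_eq_square)
        then show "t\<^sup>2 * k t (u0 + t *\<^sub>R w) = \<bar>det (matrix (\<lambda>v :: real^2. t *\<^sub>R v))\<bar> * k t (u0 + t *\<^sub>R w)" for w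
          by simp
        show "(\<lambda>u. indicat_real (ball 0 (\<rho> / \<bar>t\<bar>)) u * (t\<^sup>2 * k t (u0 + t *\<^sub>R u))) \<in> borel_measurable borel"
          by (rule meas)
        show "(\<lambda>w. indicat_real ((\<lambda>w. u0 + t *\<^sub>R w) ` ball 0 (\<rho> / \<bar>t\<bar>)) w * k t w) \<in> borel_measurable borel"
          unfolding gball[OF t]
          using borel_measurable_continuous_on_indicator[OF _ kcont[OF t]] by simp
      qed (use t k0 in \<open>auto simp: inj_on_def\<close>)
      then have "(\<integral>\<^sup>+u\<in>ball u0 \<rho>. ennreal (k t u) \<partial>lborel) =
          (\<integral>\<^sup>+w\<in>ball 0 (\<rho> / \<bar>t\<bar>). ennreal (t\<^sup>2 * k t (u0 + t *\<^sub>R w)) \<partial>lborel)"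
        unfolding gball[OF t] by simp
      then have "ennreal (t\<^sup>2) * (\<integral>\<^sup>+u\<in>ball u0 \<rho>. ennreal (k t u) \<partial>lborel) =
          ennreal (t\<^sup>2) * (\<integral>\<^sup>+w. ennreal (indicator (ball 0 (\<rho> / \<bar>t\<bar>)) w * (t\<^sup>2 * k t (u0 + t *\<^sub>R w))) \<partial>lborel)"
        by (simp only: ind)
      also have "\<dots> = (\<integral>\<^sup>+w. ennreal (t\<^sup>2) * ennreal (indicator (ball 0 (\<rho> / \<bar>t\<bar>)) w * (t\<^sup>2 * k t (u0 + t *\<^sub>R w))) \<partial>lborel)"
      proof (rule nn_integral_cmult[symmetric])
        show "(\<lambda>u. ennreal (indicat_real (ball 0 (\<rho> / \<bar>t\<bar>)) u * (t\<^sup>2 * k t (u0 + t *\<^sub>R u)))) \<in> borel_measurable lborel"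
          using meas by simp
      qed
      also have "\<dots> = (\<integral>\<^sup>+w. H t w \<partial>lborel)"
      proof (rule nn_integral_cong)
        fix w :: "real^2"
        have "ennreal (t\<^sup>2) * ennreal (t\<^sup>2 * K) = ennreal (t ^ 4 * K)" if "0 \<le> K" for K
        proof -
          have "ennreal (t\<^sup>2) * ennreal (t\<^sup>2 * K) = ennreal (t\<^sup>2 * (t\<^sup>2 * K))"
            using that by (intro ennreal_mult[symmetric]) auto
          also have "t\<^sup>2 * (t\<^sup>2 * K) = t ^ 4 * K" by (simp add: eval_nat_numeral)
          finally show ?thesis .
        qed
        then show "ennreal (t\<^sup>2) * ennreal (indicator (ball 0 (\<rho> / \<bar>t\<bar>)) w * (t\<^sup>2 * k t (u0 + t *\<^sub>R w))) = H t w"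
          using k0 by (auto simp: H_def h_def indicator_def)
      qed
      finally show ?thesis .
    qed
    \<comment> \<open>By \<open>dist\<close> the powers of \<open>t\<close> cancel and the
      dominating function no longer depends on \<open>t\<close>. The factor 4 is the square of the 2
      in \<open>m / 2\<close>.\<close>
    have bound: "H t w \<le> ennreal (4 * M / m\<^sup>2) * ennreal (1 / (1 + (norm w)\<^sup>2)\<^sup>2)" if t: "t \<noteq> 0" for t w
    proof (cases "w \<in> ball 0 (\<rho> / \<bar>t\<bar>)")
      case True
      let ?u = "u0 + t *\<^sub>R w"
      have u: "?u \<in> ball u0 \<rho>" using gball[OF t] True by blast
      let ?q = "(norm (x ?u - (p + t *\<^sub>R N)))\<^sup>2"
      have pos: "0 < m / 2 * (t\<^sup>2 * (1 + (norm w)\<^sup>2))"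
        using m(1) t by (simp add: add_pos_nonneg)
      have "m / 2 * (t\<^sup>2 * (1 + (norm w)\<^sup>2)) = m / 2 * ((norm (?u - u0))\<^sup>2 + t\<^sup>2)"
        by (simp add: power_mult_distrib algebra_simps)
      also have "\<dots> \<le> ?q" using dist \<rho>d(1) u by blast
      finally have q: "m / 2 * (t\<^sup>2 * (1 + (norm w)\<^sup>2)) \<le> ?q" .
      have "k t ?u = area_element x ?u / ?q\<^sup>2"
        unfolding k_def by (simp add: power_mult[symmetric])
      also have "\<dots> \<le> M / (m / 2 * (t\<^sup>2 * (1 + (norm w)\<^sup>2)))\<^sup>2"
        using M[of ?u] \<rho>d(2) u M0 pos q
        by (intro frac_le power_mono) auto
      finally have "h t w \<le> t ^ 4 * (M / (m / 2 * (t\<^sup>2 * (1 + (norm w)\<^sup>2)))\<^sup>2)"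
        unfolding h_def by (intro mult_left_mono) auto
      also have "\<dots> = 4 * M / m\<^sup>2 * (1 / (1 + (norm w)\<^sup>2)\<^sup>2)"
      proof -
        have "t ^ 4 * (M / (m / 2 * (t\<^sup>2 * B))\<^sup>2) = 4 * M / m\<^sup>2 * (1 / B\<^sup>2)" if "B \<noteq> 0" for B
          using t m(1) that by (simp add: field_simps eval_nat_numeral)
        moreover have "1 + (norm w)\<^sup>2 \<noteq> 0" by (simp add: add_nonneg_eq_0_iff)
        ultimately show ?thesis by blast
      qed
      finally have "ennreal (h t w) \<le> ennreal (4 * M / m\<^sup>2 * (1 / (1 + (norm w)\<^sup>2)\<^sup>2))"
        by (rule ennreal_leI)
      also have "\<dots> = ennreal (4 * M / m\<^sup>2) * ennreal (1 / (1 + (norm w)\<^sup>2)\<^sup>2)"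
        using M0 m(1) by (intro ennreal_mult) auto
      finally show ?thesis using True by (simp add: H_def)
    qed (simp add: H_def)
    have ptw: "((\<lambda>t. H t w) \<longlongrightarrow> ennreal (L w)) (at 0)" for w
    proof -
      have der: "((\<lambda>t. (1 / t) *\<^sub>R (x (u0 + t *\<^sub>R w) - p)) \<longlongrightarrow> ?D w) (at 0)"
        unfolding p_def by (rule has_derivative_directional[OF C1_on_has_derivative[OF X(2) cx(2)]])
      \<comment> \<open>\<open>?D w\<close> is tangent and \<open>N\<close> is normal, so Pythagoras
        produces the summand 1 of the limit integrand.\<close>
      have DN: "(norm (?D w - N))\<^sup>2 = 1 + (norm (?D w))\<^sup>2"
      proof -
        have "N \<bullet> N = 1" using N(1) by (simp add: dot_square_norm)
        then show ?thesis
          using N(2)[of w] unfolding power2_norm_eq_inner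
          by (simp add: inner_diff_left inner_diff_right inner_commute)
      qed
      then have "norm (?D w - N) \<noteq> 0"
        by (metis add_nonneg_eq_0_iff power_zero_numeral zero_le_one zero_le_power2 zero_neq_one)
      moreover have "isCont (area_element x) u0"
        using area_element_continuous[OF X(2)] X(1) cx(2) continuous_on_eq_continuous_at by blast
      then have "((\<lambda>t. area_element x (u0 + t *\<^sub>R w)) \<longlongrightarrow> area_element x u0) (at 0)"
        by (rule isCont_tendsto_compose) (auto intro!: tendsto_eq_intros)
      ultimately have "((\<lambda>t. area_element x (u0 + t *\<^sub>R w) / norm ((1 / t) *\<^sub>R (x (u0 + t *\<^sub>R w) - p) - N) ^ 4)
          \<longlongrightarrow> area_element x u0 / norm (?D w - N) ^ 4) (at 0)"
        using der by (intro tendsto_intros) auto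
      moreover have "area_element x u0 / norm (?D w - N) ^ 4 = L w"
      proof -
        have "norm (?D w - N) ^ 4 = ((norm (?D w - N))\<^sup>2)\<^sup>2" by (simp add: power_mult[symmetric])
        then show ?thesis unfolding DN by (simp add: L_def area_element_def)
      qed
      ultimately have "((\<lambda>t. ennreal (area_element x (u0 + t *\<^sub>R w) / norm ((1 / t) *\<^sub>R (x (u0 + t *\<^sub>R w) - p) - N) ^ 4))
          \<longlongrightarrow> ennreal (L w)) (at 0)" by (intro tendsto_ennrealI) simp
      moreover have "\<forall>\<^sub>F t in at 0. ennreal (area_element x (u0 + t *\<^sub>R w) / norm ((1 / t) *\<^sub>R (x (u0 + t *\<^sub>R w) - p) - N) ^ 4) = H t w"
      proof -
        have "((\<lambda>t. \<bar>t\<bar> * norm w) \<longlongrightarrow> 0) (at 0)" by (auto intro!: tendsto_eq_intros)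
        then have "\<forall>\<^sub>F t in at 0. \<bar>t\<bar> * norm w < \<rho>" using \<rho>(1) order_tendstoD(2) by blast
        moreover have "\<forall>\<^sub>F t in at (0::real). t \<noteq> 0" by (simp add: eventually_at_filter)
        ultimately show ?thesis
        proof eventually_elim
          case (elim t)
          let ?z = "x (u0 + t *\<^sub>R w) - (p + t *\<^sub>R N)"
          have "(1 / t) *\<^sub>R (x (u0 + t *\<^sub>R w) - p) - N = (1 / t) *\<^sub>R ?z"
            using elim(2) by (simp add: algebra_simps)
          then have "norm ((1 / t) *\<^sub>R (x (u0 + t *\<^sub>R w) - p) - N) ^ 4 = norm ?z ^ 4 / t ^ 4"
            by (simp add: power_divide)
          moreover have "w \<in> ball 0 (\<rho> / \<bar>t\<bar>)"
            using elim by (simp add: pos_less_divide_eq mult.commute)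
          ultimately show ?case using elim(2) by (simp add: H_def h_def k_def mult.commute)
        qed
      qed
      ultimately show ?thesis by (rule Lim_transform_eventually)
    qed
    have Hmeas: "H t \<in> borel_measurable lborel" if t: "t \<noteq> 0" for t
    proof -
      have "(\<lambda>w. indicat_real (ball 0 (\<rho> / \<bar>t\<bar>)) w * h t w) \<in> borel_measurable borel"
        using borel_measurable_continuous_on_indicator[OF _ hcont[OF t]] by simp
      then have "(\<lambda>w. ennreal (indicat_real (ball 0 (\<rho> / \<bar>t\<bar>)) w * h t w)) \<in> borel_measurable lborel" by simp
      then show ?thesis
        by (rule measurable_cong[THEN iffD1, rotated]) (auto simp: H_def indicator_def)
    qed
    have "((\<lambda>t. \<integral>\<^sup>+w. H t w \<partial>lborel) \<longlongrightarrow> ennreal pi) (at 0)"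
      unfolding tendsto_at_iff_sequentially comp_def
    proof (intro allI impI)
      fix T :: "nat \<Rightarrow> real" assume T: "\<forall>i. T i \<in> UNIV - {0}" "T \<longlonglongrightarrow> 0"
      then have T0: "T i \<noteq> 0" for i by auto
      have at0: "filterlim T (at 0) sequentially" using T by (simp add: filterlim_at)
      have "(\<lambda>i. \<integral>\<^sup>+w. H (T i) w \<partial>lborel) \<longlonglongrightarrow> (\<integral>\<^sup>+w. ennreal (L w) \<partial>lborel)"
      proof (rule nn_integral_dominated_convergence)
        show "(\<lambda>w. ennreal (L w)) \<in> borel_measurable lborel"
        proof -
          have "continuous_on UNIV ?D" using linD by (simp add: linear_continuous_on linear_conv_bounded_linear)
          then have "continuous_on UNIV L" unfolding L_def
            by (intro continuous_intros) (auto simp: add_nonneg_eq_0_iff)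
          then have "L \<in> borel_measurable borel" by (rule borel_measurable_continuous_onI)
          then show ?thesis by simp
        qed
        show "(\<integral>\<^sup>+w. ennreal (4 * M / m\<^sup>2) * ennreal (1 / (1 + (norm (w :: real^2))\<^sup>2)\<^sup>2) \<partial>lborel) < \<infinity>"
          by (subst nn_integral_cmult)
            (auto simp: nn_integral_inverse_square_norm_plane ennreal_mult_less_top)
        show "AE w in lborel. (\<lambda>i. H (T i) w) \<longlonglongrightarrow> ennreal (L w)"
          by (intro AE_I2 filterlim_compose[OF ptw at0])
      qed (use T0 Hmeas bound in auto)
      then show "(\<lambda>i. \<integral>\<^sup>+w. H (T i) w \<partial>lborel) \<longlonglongrightarrow> ennreal pi"
        using nn_integral_normal_distance[OF linD injD] by (simp add: L_def)
    qed
    moreover have "\<forall>\<^sub>F t in at 0. (\<integral>\<^sup>+w. H t w \<partial>lborel) =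
        ennreal (t\<^sup>2) * (\<integral>\<^sup>+u\<in>ball u0 \<rho>. ennreal (k t u) \<partial>lborel)"
      using subst by (simp add: eventually_at_filter)
    ultimately have "((\<lambda>t. ennreal (t\<^sup>2) * (\<integral>\<^sup>+u\<in>ball u0 \<rho>. ennreal (k t u) \<partial>lborel)) \<longlongrightarrow> ennreal pi) (at 0)"
      by (rule Lim_transform_eventually)
    then show ?thesis by (simp add: k_def)
  qed
  have "(\<integral>\<^sup>+u\<in>ball u0 \<rho>0. ennreal (area_element x u) \<partial>lborel) \<le>
      (\<integral>\<^sup>+u\<in>ball u0 r. ennreal (area_element x u) \<partial>lborel)"
    using \<rho>0 by (intro nn_integral_mono) (auto simp: indicator_def)
  then have "(\<integral>\<^sup>+u\<in>ball u0 \<rho>0. ennreal (area_element x u) \<partial>lborel) < \<infinity>"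
    using fin by (meson le_less_trans)
  moreover have "ball u0 \<rho>0 \<subseteq> U" using d(2) \<rho>0(2) by (meson ball_subset_ball_iff order_trans subset_ball)
  ultimately show ?thesis using that \<rho>0(1) lim by (simp add: p_def)
qed

section \<open>Separation by a closed oriented surface\<close>

lemma closed_surface_chart:
  assumes "closed_surface S" "z \<in> S"
  obtains x U u where "surface_chart S x U" "u \<in> U" "0 < u $ 1" "x u = z"
    "\<And>v. frechet_derivative x (at u) v \<in> tangent_plane S z"
proof -
  obtain x U u where x: "surface_chart S x U" "u \<in> U \<inter> half_plane" "z = x u"
    using assms unfolding closed_surface_def regular_surface_def by blast
  have "u $ 1 \<noteq> 0"
  proof
    assume "u $ 1 = 0"
    then have "z \<in> surface_boundary S"
      using x unfolding surface_boundary_def by blast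
    then show False using assms(1) by (simp add: closed_surface_def)
  qed
  moreover have "0 \<le> u $ 1" using x(2) by (simp add: half_plane_def)
  moreover have "frechet_derivative x (at u) v \<in> tangent_plane S z" for v
    using x unfolding tangent_plane_def by blast
  ultimately show ?thesis using that[OF x(1), of u] x by simp
qed

text \<open>First variation: the squared distance to \<open>y\<close> is minimal over
  \<open>S\<close> at \<open>z\<close>, so its derivative along the surface vanishes and
  \<open>y - z\<close> is normal. As \<open>S\<close> has no boundary, a full disc of parameters
  around \<open>z\<close> can compete.\<close>

lemma nearest_point_normal:
  assumes S: "closed_surface S" and z: "z \<in> S" "dist y z = infdist y S"
    and N: "norm n = 1" "\<And>v. v \<in> tangent_plane S z \<Longrightarrow> orthogonal n v"
  shows "y - z = infdist y S *\<^sub>R n \<or> y - z = - infdist y S *\<^sub>R n"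
proof -
  obtain x U u where x: "surface_chart S x U" "u \<in> U" "0 < u $ 1" "x u = z"
    and tp: "\<And>v. frechet_derivative x (at u) v \<in> tangent_plane S z"
    by (rule closed_surface_chart[OF S z(1)]) (rule that; assumption)
  note X = surface_chartD[OF x(1)]
  let ?D = "frechet_derivative x (at u)"
  have linD: "linear ?D" using C1_on_linear[OF X(2) x(2)] .
  let ?f = "\<lambda>w. (x w - y) \<bullet> (x w - y)"
  have "(x has_derivative ?D) (at u)" using C1_on_has_derivative[OF X(2) x(2)] .
  then have d: "((\<lambda>w. x w - y) has_derivative ?D) (at u)"
    using has_derivative_diff[OF _ has_derivative_const, of x ?D "at u" y] by simp
  have "(?f has_derivative (\<lambda>v. (x u - y) \<bullet> ?D v + ?D v \<bullet> (x u - y))) (at u)"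
    by (rule has_derivative_inner[OF d d])
  moreover have "open (U \<inter> {w. 0 < w $ 1})"
    using X(1) by (intro open_Int open_Collect_less) (auto intro!: continuous_intros)
  then obtain e where e: "e > 0" "ball u e \<subseteq> U \<inter> {w. 0 < w $ 1}"
    using x(2,3) openE[of "U \<inter> {w. 0 < w $ 1}" u] by blast
  moreover have "?f u \<le> ?f w" if "w \<in> ball u e" for w
  proof -
    have "w \<in> U \<inter> half_plane" using that e by (auto simp: half_plane_def)
    then have "x w \<in> S" using X(4) by blast
    then have "dist y z \<le> dist y (x w)" using z(2) infdist_le by metis
    then have "norm (x u - y) \<le> norm (x w - y)" by (simp add: x(4) dist_norm norm_minus_commute)
    then show ?thesis by (simp add: dot_square_norm power_mono)
  qed
  ultimately have "(\<lambda>v. (x u - y) \<bullet> ?D v + ?D v \<bullet> (x u - y)) = (\<lambda>v. 0)"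
    by (intro differential_zero_maxmin[of u "ball u e" ?f]) auto
  note eq0 = this
  have "(x u - y) \<bullet> ?D v = 0" for v
    using fun_cong[OF eq0, of v] inner_commute[of "?D v" "x u - y"] by simp
  then have perp: "(y - z) \<bullet> ?D v = 0" for v
    by (simp add: x(4) inner_diff_left)
  have nD: "n \<bullet> ?D v = 0" for v using N(2)[OF tp] by (simp add: orthogonal_def)
  define k where "k = (y - z) \<bullet> n"
  have k: "y - z = k *\<^sub>R n"
    unfolding k_def by (rule parallel_normal[OF linD X(3)[OF x(2)] N(1) nD perp])
  then have "\<bar>k\<bar> = infdist y S" using z(2) N(1) by (simp add: dist_norm)
  then have "k = infdist y S \<or> k = - infdist y S" by (auto simp: abs_if split: if_splits)
  then show ?thesis using k by (elim disjE) simp_all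
qed

locale oriented_surface =
  fixes S :: "(real^3) set" and N :: "real^3 \<Rightarrow> real^3"
  assumes closed_surface: "closed_surface S"
    and continuous_normal: "continuous_on S N"
    and norm_normal: "z \<in> S \<Longrightarrow> norm (N z) = 1"
    and normal_orthogonal: "z \<in> S \<Longrightarrow> v \<in> tangent_plane S z \<Longrightarrow> orthogonal (N z) v"
begin

lemma compact_S: "compact S"
  using closed_surface by (simp add: closed_surface_def)

text \<open>Near each point chords are flat and the normal varies little. A Lebesgue number of this
  cover gives one scale \<open>e\<close> for all of \<open>S\<close>, at which \<open>N a\<close>
  can replace the normal at the center of the covering ball.\<close>

lemma uniform_secant:
  obtains e where "e > 0"
    "\<And>a b. a \<in> S \<Longrightarrow> b \<in> S \<Longrightarrow> dist a b < e \<Longrightarrow> \<bar>(a - b) \<bullet> N a\<bar> \<le> 1 / 2 * dist a b"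
    "\<And>a b. a \<in> S \<Longrightarrow> b \<in> S \<Longrightarrow> dist a b < e \<Longrightarrow> 1 / 2 < N a \<bullet> N b"
proof -
  \<comment> \<open>Two quarters: the tilt against \<open>N z\<close> and the change from
    \<open>N z\<close> to \<open>N a\<close> add up to 1/2. Normals less than 1/2 apart have inner
    product above 7/8.\<close>
  have "\<exists>r>0. (\<forall>a\<in>S \<inter> ball z r. \<forall>b\<in>S \<inter> ball z r. \<bar>(a - b) \<bullet> N z\<bar> \<le> 1 / 4 * norm (a - b)) \<and>
      (\<forall>a\<in>S \<inter> ball z r. norm (N a - N z) < 1 / 4)" if z: "z \<in> S" for z
  proof -
    obtain x U u where x: "surface_chart S x U" "u \<in> U" "0 < u $ 1" "x u = z"
      and tp: "\<And>v. frechet_derivative x (at u) v \<in> tangent_plane S z"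
      by (rule closed_surface_chart[OF closed_surface z]) (rule that; assumption)
    have nD: "N z \<bullet> frechet_derivative x (at u) v = 0" for v
      using normal_orthogonal[OF z tp] by (simp add: orthogonal_def)
    have uh: "u \<in> U \<inter> half_plane" using x by (simp add: half_plane_def)
    have quarter: "(0::real) < 1 / 4" by simp
    obtain r1 where r1: "r1 > 0" "\<And>a b. a \<in> S \<inter> ball (x u) r1 \<Longrightarrow> b \<in> S \<inter> ball (x u) r1 \<Longrightarrow>
        \<bar>(a - b) \<bullet> N z\<bar> \<le> 1 / 4 * norm (a - b)"
      by (rule surface_cone[OF x(1) uh norm_normal[OF z] nD quarter]) (rule that; assumption)
    obtain r2 where r2: "r2 > 0" "\<And>a. a \<in> S \<Longrightarrow> dist a z < r2 \<Longrightarrow> dist (N a) (N z) < 1 / 4"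
      using continuous_normal z unfolding continuous_on_iff
      using quarter by blast
    show ?thesis
      using r1 r2 unfolding x(4)
      by (intro exI[of _ "min r1 r2"]) (auto simp: dist_norm norm_minus_commute)
  qed
  then obtain r where r: "\<And>z. z \<in> S \<Longrightarrow> r z > 0"
    "\<And>z a b. z \<in> S \<Longrightarrow> a \<in> S \<inter> ball z (r z) \<Longrightarrow> b \<in> S \<inter> ball z (r z) \<Longrightarrow> \<bar>(a - b) \<bullet> N z\<bar> \<le> 1 / 4 * norm (a - b)"
    "\<And>z a. z \<in> S \<Longrightarrow> a \<in> S \<inter> ball z (r z) \<Longrightarrow> norm (N a - N z) < 1 / 4"
    by metis
  have sub: "S \<subseteq> \<Union> ((\<lambda>z. ball z (r z)) ` S)" using r(1) by auto
  have opn: "open G" if "G \<in> (\<lambda>z. ball z (r z)) ` S" for G using that by auto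
  obtain e where e: "e > 0" "\<And>a. a \<in> S \<Longrightarrow> \<exists>G\<in>(\<lambda>z. ball z (r z)) ` S. ball a e \<subseteq> G"
    by (rule Heine_Borel_lemma[OF compact_S sub]) (erule opn, (rule that; assumption))
  have "\<bar>(a - b) \<bullet> N a\<bar> \<le> 1 / 2 * dist a b \<and> 1 / 2 < N a \<bullet> N b"
    if ab: "a \<in> S" "b \<in> S" "dist a b < e" for a b
  proof -
    obtain z where z: "z \<in> S" "ball a e \<subseteq> ball z (r z)" using e(2)[OF ab(1)] by blast
    have a: "a \<in> S \<inter> ball z (r z)" and b: "b \<in> S \<inter> ball z (r z)"
      using z(2) ab e(1) by (auto simp: subset_eq)
    have "\<bar>(a - b) \<bullet> (N a - N z)\<bar> \<le> norm (a - b) * norm (N a - N z)"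
      by (rule Cauchy_Schwarz_ineq2)
    also have "\<dots> \<le> norm (a - b) * (1 / 4)"
      using r(3)[OF z(1) a] by (intro mult_left_mono) auto
    finally have 1: "\<bar>(a - b) \<bullet> N a\<bar> \<le> 1 / 2 * dist a b"
      using r(2)[OF z(1) a b] unfolding inner_diff_right[of "a - b"] dist_norm by linarith
    have "norm (N a - N b) \<le> norm (N a - N z) + norm (N b - N z)"
      by (metis norm_triangle_ineq4 diff_diff_eq2 diff_add_cancel add_diff_cancel_right')
    then have "norm (N a - N b) < 1 / 2" using r(3)[OF z(1) a] r(3)[OF z(1) b] by simp
    then have "(norm (N a - N b))\<^sup>2 < (1 / 2)\<^sup>2" by (intro power_strict_mono) auto
    moreover have "(norm (N a - N b))\<^sup>2 = 2 - 2 * (N a \<bullet> N b)"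
    proof -
      have "N a \<bullet> N a = 1" "N b \<bullet> N b = 1" using norm_normal ab by (auto simp: dot_square_norm)
      then show ?thesis
        unfolding power2_norm_eq_inner by (simp add: inner_diff_left inner_diff_right inner_commute)
    qed
    ultimately show ?thesis using 1 by (simp add: power2_eq_square)
  qed
  with that e(1) show ?thesis by blast
qed

text \<open>Nearest points need not be unique, so the sides \<open>1\<close> and \<open>-1\<close> may overlap away from \<open>S\<close>.\<close>

definition side :: "real \<Rightarrow> (real^3) set" where
  "side s = {y. \<exists>z\<in>S. dist y z = infdist y S \<and> y - z = (s * infdist y S) *\<^sub>R N z}"

lemma sides_cover:
  assumes "S \<noteq> {}"
  shows "side 1 \<union> side (- 1) = UNIV"
proof -
  have "y \<in> side 1 \<union> side (- 1)" for y
  proof -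
    obtain z where z: "z \<in> S" "infdist y S = dist y z"
      using infdist_attains_inf[OF compact_imp_closed[OF compact_S] assms] by blast
    have "y - z = infdist y S *\<^sub>R N z \<or> y - z = - infdist y S *\<^sub>R N z"
      using nearest_point_normal[OF closed_surface z(1) z(2)[symmetric] norm_normal[OF z(1)] normal_orthogonal[OF z(1)]] .
    then show ?thesis using z by (auto simp: side_def)
  qed
  then show ?thesis by blast
qed

text \<open>The side is the projection of a closed set of pairs along the compact factor
  \<open>S\<close>. The function \<open>?g\<close> adds two defects so that its zero set expresses
  both conditions on the nearest point.\<close>

lemma closed_side: "closed (side s)"
proof -
  let ?g = "\<lambda>w :: (real^3) \<times> (real^3). norm (dist (snd w) (fst w) - infdist (snd w) S) +
      norm (snd w - fst w - (s * infdist (snd w) S) *\<^sub>R N (fst w))"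
  have cont: "continuous_on (S \<times> UNIV) ?g"
    by (intro continuous_intros continuous_on_infdist
        continuous_on_compose2[OF continuous_normal continuous_on_fst]) auto
  have "closedin (top_of_set (S \<times> UNIV)) (S \<times> UNIV \<inter> ?g -` {0})"
    by (rule continuous_closedin_preimage[OF cont]) simp
  from closedin_compact_projection[OF compact_S this]
  have "closed {y. \<exists>x. x \<in> S \<and> (x, y) \<in> S \<times> UNIV \<inter> ?g -` {0}}" by simp
  moreover have "{y. \<exists>x. x \<in> S \<and> (x, y) \<in> S \<times> UNIV \<inter> ?g -` {0}} = side s"
    by (auto simp: side_def add_nonneg_eq_0_iff)
  ultimately show ?thesis by simp
qed

text \<open>
  Below, \<open>\<psi>\<close> winds once around the circle along a path crossing \<open>S\<close>. Its angle is
  \<open>\<pi> \<sigma>\<close> near \<open>S\<close> and \<open>\<pi> \<sigma>'\<close> off \<open>S\<close>; these agree on side \<open>1\<close> and differ by a full turn on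
  side \<open>-1\<close>, so comparing both with a global lift of \<open>\<psi>\<close> gives the contradiction.
\<close>

lemma normal_points_separated:
  assumes p: "p \<in> S"
  obtains \<epsilon> where "\<epsilon> > 0"
    "\<And>t. 0 < t \<Longrightarrow> t < \<epsilon> \<Longrightarrow> \<not> connected_component (- S) (p + t *\<^sub>R N p) (p - t *\<^sub>R N p)"
proof -
  obtain e where e: "e > 0"
    and sec: "\<And>a b. a \<in> S \<Longrightarrow> b \<in> S \<Longrightarrow> dist a b < e \<Longrightarrow> \<bar>(a - b) \<bullet> N a\<bar> \<le> 1 / 2 * dist a b"
    and ang: "\<And>a b. a \<in> S \<Longrightarrow> b \<in> S \<Longrightarrow> dist a b < e \<Longrightarrow> 1 / 2 < N a \<bullet> N b"
    by (rule uniform_secant) (rule that; assumption)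
  have Sne: "S \<noteq> {}" and clS: "closed S" using p compact_S compact_imp_closed by auto
  define \<delta> where "\<delta> y = infdist y S" for y
  \<comment> \<open>The angle in units of \<open>pi\<close>: 0 on \<open>S\<close>, and 1 from
    distance \<open>e / 2\<close> on, where the angles \<open>pi\<close> and \<open>- pi\<close>
    give the same point of the circle.\<close>
  define f where "f y = min 1 (\<delta> y / (e / 2))" for y
  have \<delta>0: "0 \<le> \<delta> y" "\<delta> y = 0 \<longleftrightarrow> y \<in> S" for y
    using in_closed_iff_infdist_zero[OF clS Sne] by (auto simp: \<delta>_def infdist_nonneg)
  have cont\<delta>: "continuous_on T \<delta>" for T unfolding \<delta>_def by (intro continuous_on_infdist continuous_intros)
  have contf: "continuous_on T f" for T
    unfolding f_def by (intro continuous_intros cont\<delta>) (use e in auto)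
  have f1: "f y = 1" if "e / 2 \<le> \<delta> y" for y using that e by (simp add: f_def)
  have f0: "f y = 0" if "y \<in> S" for y using that \<delta>0(2)[of y] by (simp add: f_def)
  \<comment> \<open>Nearest points for opposite sides, at a positive distance below
    \<open>e / 2\<close>, would differ by a multiple of \<open>N z1 + N z2\<close>: a chord too
    steep for the secant bound.\<close>
  have both: "e / 2 \<le> \<delta> y \<or> y \<in> S" if y: "y \<in> side 1" "y \<in> side (- 1)" for y
  proof (rule ccontr)
    assume "\<not> (e / 2 \<le> \<delta> y \<or> y \<in> S)"
    then have d: "0 < \<delta> y" "\<delta> y < e / 2" using \<delta>0[of y] by auto
    obtain z1 where z1: "z1 \<in> S" "dist y z1 = \<delta> y" "y - z1 = \<delta> y *\<^sub>R N z1"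
      using y(1) by (auto simp: side_def \<delta>_def)
    obtain z2 where z2: "z2 \<in> S" "dist y z2 = \<delta> y" "y - z2 = - \<delta> y *\<^sub>R N z2"
      using y(2) by (auto simp: side_def \<delta>_def)
    have dz: "dist z1 z2 \<le> 2 * \<delta> y" using dist_triangle3[of z1 z2 y] z1 z2 by simp
    have "z1 - z2 = - (\<delta> y *\<^sub>R (N z1 + N z2))"
    proof -
      have "z1 - z2 = (y - z2) - (y - z1)" by simp
      then show ?thesis unfolding z1(3) z2(3) by (simp add: scaleR_add_right)
    qed
    moreover have "N z1 \<bullet> N z1 = 1" using norm_normal[OF z1(1)] by (simp add: dot_square_norm)
    ultimately have "(z1 - z2) \<bullet> N z1 = - (\<delta> y * (1 + N z1 \<bullet> N z2))"
      by (simp only: inner_minus_left inner_scaleR_left inner_add_left inner_commute[of "N z2" "N z1"])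
    moreover have "dist z1 z2 < e" using dz d by simp
    ultimately have "\<delta> y * (1 + N z1 \<bullet> N z2) \<le> 1 / 2 * dist z1 z2" "1 / 2 < N z1 \<bullet> N z2"
      using sec[OF z1(1) z2(1)] ang[OF z1(1) z2(1)] by auto
    then have "\<delta> y * (1 + N z1 \<bullet> N z2) \<le> \<delta> y * 1" using dz by simp
    then have "1 + N z1 \<bullet> N z2 \<le> 1" using d(1) by (simp only: mult_le_cancel_left_pos)
    then show False using \<open>1 / 2 < N z1 \<bullet> N z2\<close> by simp
  qed
  \<comment> \<open>A nearest point \<open>z\<close> that puts
    \<open>p + \<tau> *\<^sub>R N p\<close> on the wrong side would make the two normal
    displacements add up instead of cancel, and the chord between \<open>p\<close> and
    \<open>z\<close> would be too steep.\<close>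
  have wrong: "p + \<tau> *\<^sub>R N p \<notin> side s" if \<tau>: "\<tau> \<noteq> 0" "\<bar>\<tau>\<bar> < e / 2" and s: "s = - sgn \<tau>" for \<tau> s
  proof
    let ?y = "p + \<tau> *\<^sub>R N p"
    assume "?y \<in> side s"
    then obtain z where z: "z \<in> S" "dist ?y z = \<delta> ?y" "?y - z = (s * \<delta> ?y) *\<^sub>R N z"
      by (auto simp: side_def \<delta>_def)
    have dp: "dist ?y p = \<bar>\<tau>\<bar>" using norm_normal[OF p] by (simp add: dist_norm)
    have "\<delta> ?y \<le> \<bar>\<tau>\<bar>" unfolding \<delta>_def using infdist_le[OF p, of ?y] dp by simp
    have dpz: "dist p z \<le> \<bar>\<tau>\<bar> + \<delta> ?y" using dist_triangle3[of p z ?y] z(2) dp by simp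
    then have lt: "dist p z < e" using \<open>\<delta> ?y \<le> \<bar>\<tau>\<bar>\<close> \<tau>(2) by simp
    have "p - z = s *\<^sub>R (\<delta> ?y *\<^sub>R N z + \<bar>\<tau>\<bar> *\<^sub>R N p)"
    proof -
      have "s * \<bar>\<tau>\<bar> = - \<tau>" using s by (simp add: sgn_if abs_if)
      moreover have "p - z = (s * \<delta> ?y) *\<^sub>R N z - \<tau> *\<^sub>R N p"
        using z(3) by (simp add: algebra_simps)
      ultimately show ?thesis by (simp add: scaleR_add_right)
    qed
    moreover have "N p \<bullet> N p = 1" using norm_normal[OF p] by (simp add: dot_square_norm)
    ultimately have "(p - z) \<bullet> N p = s * (\<delta> ?y * (N p \<bullet> N z) + \<bar>\<tau>\<bar>)"
      by (simp only: inner_scaleR_left inner_add_left inner_commute[of "N z" "N p"] mult_1_right)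
    moreover have "\<bar>s\<bar> = 1" using s \<tau>(1) by (simp add: sgn_if)
    ultimately have "\<bar>(p - z) \<bullet> N p\<bar> = \<bar>\<delta> ?y * (N p \<bullet> N z) + \<bar>\<tau>\<bar>\<bar>" by (simp add: abs_mult)
    moreover have "\<delta> ?y * (1 / 2) \<le> \<delta> ?y * (N p \<bullet> N z)"
      using ang[OF p z(1) lt] \<delta>0 by (intro mult_left_mono) auto
    ultimately have "1 / 2 * \<delta> ?y + \<bar>\<tau>\<bar> \<le> 1 / 2 * dist p z"
      using sec[OF p z(1) lt] \<delta>0(1)[of ?y] by linarith
    then show False using dpz \<tau>(1) by simp
  qed
  define \<psi> where "\<psi> y = (if y \<in> side 1 then exp (\<i> * of_real (pi * f y)) else exp (- (\<i> * of_real (pi * f y))))" for y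
  define \<sigma> where "\<sigma> y = (if y \<in> side 1 then f y else - f y)" for y
  define \<sigma>' where "\<sigma>' y = (if y \<in> side 1 then f y else 2 - f y)" for y
  \<comment> \<open>The two closed sides cover space and meet only on \<open>S\<close> or at
    distance at least \<open>e / 2\<close>, so the branches have to agree only there.\<close>
  have paste: "continuous_on T (\<lambda>y. if y \<in> side 1 then g y else h y)"
    if "continuous_on T g" "continuous_on T h" "\<And>y. y \<in> T \<Longrightarrow> e / 2 \<le> \<delta> y \<or> y \<in> S \<Longrightarrow> g y = h y"
    for T and g h :: "real^3 \<Rightarrow> 'b::topological_space"
  proof -
    have T: "T = (T \<inter> side 1) \<union> (T \<inter> side (- 1))" using sides_cover[OF Sne] by blast
    have "continuous_on ((T \<inter> side 1) \<union> (T \<inter> side (- 1))) (\<lambda>y. if y \<in> side 1 then g y else h y)"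
    proof (rule continuous_on_cases_local)
      show "closedin (top_of_set ((T \<inter> side 1) \<union> (T \<inter> side (- 1)))) (T \<inter> side 1)"
        "closedin (top_of_set ((T \<inter> side 1) \<union> (T \<inter> side (- 1)))) (T \<inter> side (- 1))"
        unfolding T[symmetric] by (simp_all add: closedin_closed_Int closed_side)
      show "continuous_on (T \<inter> side 1) g" "continuous_on (T \<inter> side (- 1)) h"
        using that(1,2) by (auto intro: continuous_on_subset)
      show "g y = h y" if "y \<in> T \<inter> side 1 \<and> y \<notin> side 1 \<or> y \<in> T \<inter> side (- 1) \<and> y \<in> side 1" for y
        using that both[of y] \<open>\<And>y. y \<in> T \<Longrightarrow> e / 2 \<le> \<delta> y \<or> y \<in> S \<Longrightarrow> g y = h y\<close> by blast
    qed
    then show ?thesis using T by simp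
  qed
  have "continuous_on UNIV \<psi>"
    unfolding \<psi>_def
  proof (rule paste)
    show "exp (\<i> * of_real (pi * f y)) = exp (- (\<i> * of_real (pi * f y)))" if "e / 2 \<le> \<delta> y \<or> y \<in> S" for y
      using that f0 f1 by (auto simp: exp_minus)
  qed (intro continuous_intros contf)+
  then obtain g where g: "continuous_on UNIV g" "\<And>y. \<psi> y = exp (g y)"
    by (rule continuous_logarithm_on_contractible[OF _ contractible_UNIV]) (auto simp: \<psi>_def)
  \<comment> \<open>Off \<open>S\<close> the branches meet only where \<open>f\<close> is 1, and
    there \<open>f\<close> and \<open>2 - f\<close> agree. Close to \<open>S\<close> they meet only
    where \<open>f\<close> is 0, and there \<open>f\<close> and \<open>- f\<close> agree.\<close>
  have cont\<sigma>': "continuous_on (- S) \<sigma>'"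
    unfolding \<sigma>'_def by (rule paste) (auto intro!: continuous_intros contf simp: f1)
  have cont\<sigma>: "continuous_on {y. \<delta> y < e / 2} \<sigma>"
    unfolding \<sigma>_def by (rule paste) (auto intro!: continuous_intros contf simp: f0)
  \<comment> \<open>Two logarithms of the same function differ by a multiple of
    \<open>2 * pi * \<i>\<close>, so a continuous difference is constant on a connected set.\<close>
  have const: "h a = h b" if "connected T" "continuous_on T h" "\<And>y. y \<in> T \<Longrightarrow> exp (h y) = 1" "a \<in> T" "b \<in> T"
    for T and h :: "real^3 \<Rightarrow> complex" and a b
  proof -
    have "h constant_on T"
    proof (rule continuous_discrete_range_constant[OF that(1,2)])
      fix y assume y: "y \<in> T"
      have "2 * pi \<le> norm (h w - h y)" if w: "w \<in> T" "h w \<noteq> h y" for w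
      proof -
        have "exp (h w) = exp (h y)" using \<open>\<And>y. y \<in> T \<Longrightarrow> exp (h y) = 1\<close> y w by metis
        then obtain n where n: "h w = h y + of_int (2 * n) * pi * \<i>" unfolding exp_eq by blast
        then have "n \<noteq> 0" using w(2) by auto
        then have "1 \<le> \<bar>of_int n :: real\<bar>" by linarith
        then show ?thesis using n by (simp add: norm_mult)
      qed
      then show "\<exists>e>0. \<forall>w. w \<in> T \<and> h w \<noteq> h y \<longrightarrow> e \<le> norm (h w - h y)"
        by (intro exI[of _ "2 * pi"]) auto
    qed
    then show ?thesis using that(4,5) unfolding constant_on_def by metis
  qed
  have exp\<sigma>: "\<psi> y = exp (\<i> * of_real (pi * \<sigma> y))" for y
    by (simp add: \<psi>_def \<sigma>_def)
  have exp\<sigma>': "\<psi> y = exp (\<i> * of_real (pi * \<sigma>' y))" for y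
  proof (cases "y \<in> side 1")
    case False
    have "exp (\<i> * of_real (pi * \<sigma>' y)) = exp (- (\<i> * of_real (pi * f y)) + 2 * of_real pi * \<i>)"
      using False by (simp add: \<sigma>'_def algebra_simps)
    also have "\<dots> = exp (- (\<i> * of_real (pi * f y)))"
      by (simp only: exp_add exp_two_pi_i mult_1_right)
    finally show ?thesis using False by (simp add: \<psi>_def)
  qed (simp add: \<psi>_def \<sigma>'_def)
  show ?thesis
  proof (rule that[of "e / 2"])
    show "0 < e / 2" using e by simp
    fix t assume t: "0 < t" "t < e / 2"
    let ?a = "p + t *\<^sub>R N p" and ?b = "p - t *\<^sub>R N p"
    have a: "?a \<in> side 1" using wrong[of t "- 1"] t sides_cover[OF Sne] by auto
    have b: "?b \<notin> side 1" using wrong[of "- t" 1] t by auto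
    show "\<not> connected_component (- S) ?a ?b"
    proof
      assume "connected_component (- S) ?a ?b"
      then obtain C where C: "connected C" "C \<subseteq> - S" "?a \<in> C" "?b \<in> C"
        unfolding connected_component_def by blast
      have 1: "g ?a - \<i> * of_real (pi * \<sigma>' ?a) = g ?b - \<i> * of_real (pi * \<sigma>' ?b)"
      proof (rule const[OF C(1) _ _ C(3,4)])
        show "continuous_on C (\<lambda>y. g y - \<i> * of_real (pi * \<sigma>' y))"
          using g(1) cont\<sigma>' C(2) by (intro continuous_intros) (auto intro: continuous_on_subset)
        show "exp (g y - \<i> * of_real (pi * \<sigma>' y)) = 1" for y
          using g(2)[of y] exp\<sigma>'[of y] by (simp add: exp_diff)
      qed
      \<comment> \<open>The segment is the short way through \<open>S\<close>, along which
        \<open>\<sigma>\<close> is continuous; \<open>C\<close> is the supposed way around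
        \<open>S\<close>, along which \<open>\<sigma>'\<close> is continuous.\<close>
      let ?L = "closed_segment ?a ?b"
      have L: "?L \<subseteq> {y. \<delta> y < e / 2}"
      proof
        fix y assume "y \<in> ?L"
        moreover have "?a \<in> cball p t" "?b \<in> cball p t"
          using t norm_normal[OF p] by (auto simp: dist_norm)
        ultimately have "y \<in> cball p t"
          using closed_segment_subset[OF _ _ convex_cball] by blast
        then have "\<delta> y \<le> t" unfolding \<delta>_def using infdist_le2[OF p, of y t] by (simp add: dist_commute)
        then show "y \<in> {y. \<delta> y < e / 2}" using t by simp
      qed
      have 2: "g ?a - \<i> * of_real (pi * \<sigma> ?a) = g ?b - \<i> * of_real (pi * \<sigma> ?b)"
      proof (rule const[of ?L])
        show "continuous_on ?L (\<lambda>y. g y - \<i> * of_real (pi * \<sigma> y))"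
          using g(1) cont\<sigma> L by (intro continuous_intros) (auto intro: continuous_on_subset)
        show "exp (g y - \<i> * of_real (pi * \<sigma> y)) = 1" for y
          using g(2)[of y] exp\<sigma>[of y] by (simp add: exp_diff)
      qed auto
      have "\<sigma>' ?a = \<sigma> ?a" using a by (simp add: \<sigma>_def \<sigma>'_def)
      then have "g ?b - \<i> * of_real (pi * \<sigma>' ?b) = g ?b - \<i> * of_real (pi * \<sigma> ?b)"
        using 1 2 by metis
      then have "complex_of_real (pi * \<sigma>' ?b) = of_real (pi * \<sigma> ?b)" by (simp del: of_real_mult)
      then have "\<sigma>' ?b = \<sigma> ?b" by (simp del: of_real_mult)
      then show False using b by (simp add: \<sigma>_def \<sigma>'_def)
    qed
  qed
qed

end

section \<open>The enclosed volume of the inverted surface\<close>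

lemma measure_lborel_affine_preimage:
  fixes a :: "'a::euclidean_space"
  assumes "c \<noteq> 0" "A \<in> sets borel"
  shows "measure lborel A = \<bar>c\<bar> ^ DIM('a) * measure lborel ((\<lambda>x. a + c *\<^sub>R x) -` A)"
proof -
  have "emeasure lborel A =
      emeasure (density (distr lborel borel (\<lambda>x. a + c *\<^sub>R x)) (\<lambda>_. \<bar>c\<bar> ^ DIM('a))) A"
    using lborel_affine[OF assms(1), of a] by simp
  also have "\<dots> = ennreal (\<bar>c\<bar> ^ DIM('a)) * emeasure (distr lborel borel (\<lambda>x. a + c *\<^sub>R x)) A"
    using assms(2) by (simp add: emeasure_density nn_integral_cmult_indicator)
  also have "emeasure (distr lborel borel (\<lambda>x. a + c *\<^sub>R x)) A = emeasure lborel ((\<lambda>x. a + c *\<^sub>R x) -` A)"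
    using assms(2) by (subst emeasure_distr) auto
  finally show ?thesis by (simp add: measure_def enn2real_mult)
qed

text \<open>Inversion exchanges the scale \<open>1/t\<close> about the center with the scale
  \<open>t\<close> about \<open>p\<close>: a fixed \<open>w\<close> always probes \<open>S\<close>
  near \<open>p\<close> in the fixed direction \<open>n + w / |w|^2\<close>.\<close>

lemma sphere_inversion_scaled:
  assumes "t \<noteq> 0"
  shows "sphere_inversion (p + t *\<^sub>R n) (p + t *\<^sub>R n + (1 / t) *\<^sub>R w) = p + t *\<^sub>R (n + (1 / (norm w)\<^sup>2) *\<^sub>R w)"
  using assms by (simp add: sphere_inversion_def power_divide power2_eq_square algebra_simps)

text \<open>Only the component \<open>?C\<close> of \<open>q\<close> reaches infinity under
  inversion: without \<open>q\<close>, its image is connected, unbounded and off the inverted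
  surface, hence outside. Conversely the outside, inverted, is connected, avoids \<open>S\<close>
  and meets \<open>?C\<close>. Deleting \<open>q\<close>, where inversion is discontinuous, keeps
  open connected sets connected in dimension three.\<close>

lemma inside_sphere_inversion_iff:
  assumes S: "compact S" and q: "q \<notin> S" and y: "y \<noteq> q"
  shows "y \<in> inside (sphere_inversion q ` S) \<longleftrightarrow>
         sphere_inversion q y \<notin> S \<and> \<not> connected_component (- S) q (sphere_inversion q y)"
proof -
  let ?T = "sphere_inversion q ` S" and ?C = "connected_component_set (- S) q"
  have "compact ?T" using S q continuous_on_sphere_inversion compact_continuous_image by blast
  then have T: "closed ?T" "bounded ?T" by (auto simp: compact_imp_closed compact_imp_bounded)
  have opS: "open (- S)" using S compact_imp_closed by blast
  have opC: "open ?C" by (rule open_connected_component[OF opS])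
  have qC: "q \<in> ?C" using q by simp
  then obtain r where r: "r > 0" "ball q r \<subseteq> ?C" using opC openE by blast
  have dim: "2 \<le> DIM(real^3)" by simp
  have connC: "connected (?C - {q})"
    by (rule connected_open_delete[OF opC connected_connected_component dim])
  let ?C' = "sphere_inversion q ` (?C - {q})"
  have connC': "connected ?C'"
    by (rule connected_continuous_image[OF continuous_on_sphere_inversion connC]) simp
  have C'T: "?C' \<subseteq> - ?T" using connected_component_subset[of "- S" q] by auto
  have unb: "\<not> bounded ?C'"
  proof
    assume "bounded ?C'"
    then obtain B where B: "B > 0" "\<And>z. z \<in> ?C' \<Longrightarrow> norm z \<le> B" unfolding bounded_pos by blast
    \<comment> \<open>Below \<open>r\<close> the test point is still in \<open>?C\<close>; below the
      reciprocal of \<open>B + norm q + 1\<close> its image is farther than \<open>B\<close> from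
      the origin.\<close>
    define s where "s = min (r / 2) (1 / (B + norm q + 1))"
    have s: "0 < s" "s < r" "s \<le> 1 / (B + norm q + 1)"
      using r(1) B(1) by (auto simp: s_def add_pos_nonneg add_nonneg_pos)
    obtain b :: "real^3" where b: "b \<in> Basis" using nonempty_Basis by blast
    let ?z = "q + s *\<^sub>R b"
    have "?z \<in> ?C - {q}" using b s r(2) by (auto simp: dist_norm subset_eq)
    then have "norm (sphere_inversion q ?z) \<le> B" using B(2) by blast
    moreover have "norm (sphere_inversion q ?z - q) = 1 / s"
      unfolding norm_sphere_inversion using b s by simp
    moreover have "norm (sphere_inversion q ?z - q) \<le> norm (sphere_inversion q ?z) + norm q"
      by (rule norm_triangle_ineq4)
    moreover have "B + norm q + 1 \<le> 1 / s" using s B(1) by (simp add: field_simps add_pos_nonneg)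
    ultimately show False by linarith
  qed
  have C'O: "?C' \<subseteq> outside ?T"
  proof
    fix z assume z: "z \<in> ?C'"
    have "?C' \<subseteq> connected_component_set (- ?T) z" by (rule connected_component_maximal[OF z connC' C'T])
    then have "\<not> bounded (connected_component_set (- ?T) z)" using unb bounded_subset by blast
    then show "z \<in> outside ?T" using z C'T by (auto simp: outside)
  qed
  have "open (outside ?T)" by (rule open_outside[OF T(1)])
  then have connO: "connected (outside ?T - {q})"
    by (rule connected_open_delete[OF _ connected_outside[OF T(2) dim] dim])
  let ?O' = "sphere_inversion q ` (outside ?T - {q})"
  have connO': "connected ?O'"
    by (rule connected_continuous_image[OF continuous_on_sphere_inversion connO]) simp
  have O'S: "?O' \<subseteq> - S"
    using outside_no_overlap[of ?T] sphere_inversion_image_iff[of _ q S] by blast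
  have "?C' \<noteq> {}" using unb bounded_empty by metis
  then obtain c where c: "c \<in> ?C" "c \<noteq> q" by blast
  have cO': "c \<in> ?O'"
    using C'O c by (intro image_eqI[of _ _ "sphere_inversion q c"]) auto
  have O'C: "?O' \<subseteq> ?C"
    using connected_component_maximal[OF cO' connO' O'S] connected_component_eq[OF c(1)] by simp
  have "y \<in> outside ?T \<longleftrightarrow> sphere_inversion q y \<in> ?C"
  proof
    assume "y \<in> outside ?T"
    then show "sphere_inversion q y \<in> ?C" using y O'C by blast
  next
    assume "sphere_inversion q y \<in> ?C"
    then have "sphere_inversion q (sphere_inversion q y) \<in> ?C'"
      using y by (intro imageI) auto
    then show "y \<in> outside ?T" using C'O by auto
  qed
  then show ?thesis
    unfolding inside_outside by (auto simp: sphere_inversion_image_iff)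
qed

lemma inside_subset_cball:
  fixes T :: "'a::euclidean_space set"
  assumes "T \<subseteq> cball a r" "2 \<le> DIM('a)"
  shows "inside T \<subseteq> cball a r"
proof -
  have "connected (- cball a r)"
    by (rule connected_complement_bounded_convex) (use assms in auto)
  moreover have "\<not> bounded (- cball a r)"
    using cobounded_imp_unbounded[of "- cball a r"] by simp
  moreover have "(cball a r - T) \<union> - cball a r = - T" using assms by auto
  ultimately have "inside T \<subseteq> cball a r - T" by (rule inside_subset)
  then show ?thesis by auto
qed

text \<open>Within this block smoothness enters only as tangency at \<open>p\<close>: chords of
  \<open>S\<close> from \<open>p\<close> become orthogonal to \<open>n\<close>, in the uniform form
  \<open>cone\<close>.\<close>

context
  fixes S :: "(real^3) set" and p n :: "real^3"
  assumes p: "p \<in> S" and n: "norm n = 1"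
    and cone: "\<And>e. e > 0 \<Longrightarrow> \<exists>r>0. \<forall>a\<in>S \<inter> ball p r. \<bar>(a - p) \<bullet> n\<bar> \<le> e * norm (a - p)"
begin

text \<open>Keeps the center off \<open>S\<close> and the inverted surface within radius
  \<open>2/|t|\<close> of it. The cone condition handles points close to \<open>p\<close>; for the
  others \<open>|t| < r / 2\<close> suffices.\<close>

lemma normal_distance_ge:
  obtains \<epsilon> where "\<epsilon> > 0" "\<And>t x. \<bar>t\<bar> < \<epsilon> \<Longrightarrow> x \<in> S \<Longrightarrow> \<bar>t\<bar> / 2 \<le> norm (x - (p + t *\<^sub>R n))"
proof -
  obtain r where r: "r > 0" "\<And>a. a \<in> S \<inter> ball p r \<Longrightarrow> \<bar>(a - p) \<bullet> n\<bar> \<le> 1 / 2 * norm (a - p)"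
    using cone[of "1 / 2"] by auto
  have "\<bar>t\<bar> / 2 \<le> norm (x - (p + t *\<^sub>R n))" if t: "\<bar>t\<bar> < r / 2" and x: "x \<in> S" for t x
  proof (cases "x \<in> ball p r")
    case True
    have "1 / 2 * ((norm (x - p))\<^sup>2 + t\<^sup>2) \<le> (norm (x - p - t *\<^sub>R n))\<^sup>2"
      using r(2) True x by (intro norm_diff_normal_ge[OF n]) auto
    then have "1 / 2 * ((norm (x - p))\<^sup>2 + t\<^sup>2) \<le> (norm (x - (p + t *\<^sub>R n)))\<^sup>2"
      by (simp add: diff_diff_eq)
    then have "t\<^sup>2 / 4 \<le> (norm (x - (p + t *\<^sub>R n)))\<^sup>2"
      using zero_le_power2[of "norm (x - p)"] zero_le_power2[of t] by argo
    then have "(\<bar>t\<bar> / 2)\<^sup>2 \<le> (norm (x - (p + t *\<^sub>R n)))\<^sup>2"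
      by (simp add: power_divide)
    then show ?thesis by (rule power2_le_imp_le) simp
  next
    case False
    then have "r \<le> norm (x - p)" by (simp add: dist_norm norm_minus_commute)
    moreover have "norm (x - p) \<le> norm (x - (p + t *\<^sub>R n)) + norm (t *\<^sub>R n)"
      using norm_triangle_ineq[of "x - (p + t *\<^sub>R n)" "t *\<^sub>R n"] by simp
    ultimately show ?thesis using t n by simp
  qed
  then show ?thesis using that[of "r / 2"] r(1) by simp
qed

text \<open>The segment consists of points \<open>p + t s\<close> with \<open>s\<close> between
  \<open>a\<close> and \<open>b\<close>, all of positive slope towards \<open>n\<close>, while near
  \<open>p\<close> the surface rises with arbitrarily small slope. For negative \<open>t\<close>
  this speaks of the other side of \<open>S\<close>.\<close>

lemma segment_avoids:
  assumes "0 < a \<bullet> n" "0 < b \<bullet> n"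
  obtains \<epsilon> where "\<epsilon> > 0"
    "\<And>t. t \<noteq> 0 \<Longrightarrow> \<bar>t\<bar> < \<epsilon> \<Longrightarrow> closed_segment (p + t *\<^sub>R a) (p + t *\<^sub>R b) \<subseteq> - S"
proof -
  define \<mu> where "\<mu> = min (a \<bullet> n) (b \<bullet> n)"
  define K where "K = max (norm a) (norm b)"
  have \<mu>: "\<mu> > 0" using assms by (simp add: \<mu>_def)
  have K: "K > 0"
  proof -
    have "a \<noteq> 0" using assms(1) by auto
    then show ?thesis by (simp add: K_def less_max_iff_disj)
  qed
  \<comment> \<open>Vectors between \<open>a\<close> and \<open>b\<close> have slope at least
    \<open>\<mu> / K\<close> towards \<open>n\<close>; the cone around \<open>S\<close> is taken
    half as steep.\<close>
  obtain r where r: "r > 0" "\<And>a. a \<in> S \<inter> ball p r \<Longrightarrow> \<bar>(a - p) \<bullet> n\<bar> \<le> \<mu> / (2 * K) * norm (a - p)"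
    using cone[of "\<mu> / (2 * K)"] \<mu> K by auto
  have "closed_segment (p + t *\<^sub>R a) (p + t *\<^sub>R b) \<subseteq> - S" if t: "t \<noteq> 0" "\<bar>t\<bar> < r / K" for t
  proof
    fix x assume "x \<in> closed_segment (p + t *\<^sub>R a) (p + t *\<^sub>R b)"
    then obtain u where u: "0 \<le> u" "u \<le> 1" "x = (1 - u) *\<^sub>R (p + t *\<^sub>R a) + u *\<^sub>R (p + t *\<^sub>R b)"
      unfolding in_segment by blast
    define s where "s = (1 - u) *\<^sub>R a + u *\<^sub>R b"
    have x: "x = p + t *\<^sub>R s" unfolding u(3) s_def by (simp add: algebra_simps)
    have sn: "\<mu> \<le> s \<bullet> n"
    proof -
      have "(1 - u) * \<mu> + u * \<mu> \<le> (1 - u) * (a \<bullet> n) + u * (b \<bullet> n)"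
        using u by (intro add_mono mult_left_mono) (auto simp: \<mu>_def)
      then show ?thesis by (simp add: s_def inner_add_left algebra_simps)
    qed
    have sK: "norm s \<le> K"
    proof -
      have "norm s \<le> (1 - u) * norm a + u * norm b"
        unfolding s_def using u norm_triangle_ineq[of "(1 - u) *\<^sub>R a" "u *\<^sub>R b"] by simp
      also have "\<dots> \<le> (1 - u) * K + u * K"
        using u by (intro add_mono mult_left_mono) (auto simp: K_def)
      finally show ?thesis by (simp add: algebra_simps)
    qed
    show "x \<in> - S"
    proof
      assume "x \<in> S"
      have "norm (x - p) \<le> \<bar>t\<bar> * K" using sK by (simp add: x mult_left_mono)
      also have "\<dots> < r" using t K by (simp add: pos_less_divide_eq)
      finally have "x \<in> ball p r" by (simp add: dist_norm norm_minus_commute)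
      then have "\<bar>(x - p) \<bullet> n\<bar> \<le> \<mu> / (2 * K) * norm (x - p)" using r(2) \<open>x \<in> S\<close> by blast
      then have "\<bar>t\<bar> * \<bar>s \<bullet> n\<bar> \<le> \<bar>t\<bar> * (\<mu> / (2 * K) * norm s)"
        by (simp add: x abs_mult mult.left_commute)
      then have "\<bar>s \<bullet> n\<bar> \<le> \<mu> / (2 * K) * norm s"
        by (rule mult_left_le_imp_le) (use t(1) in simp)
      also have "\<dots> \<le> \<mu> / (2 * K) * K" using sK \<mu> K by (intro mult_left_mono) auto
      also have "\<dots> = \<mu> / 2" using K by simp
      finally show False using sn \<mu> by simp
    qed
  qed
  then show ?thesis using that[of "r / K"] r(1) K by simp
qed

text \<open>If \<open>m\<close> points to the side of \<open>n\<close>, a segment joins the two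
  points. Otherwise \<open>p + t m\<close> is \<open>p + (-t)(-m)\<close>, which a segment joins to
  \<open>p - t n\<close>, and that point is separated from \<open>p + t n\<close> by assumption.
  Both signs of \<open>t\<close> are covered.\<close>

lemma component_classification:
  assumes sep: "\<epsilon>0 > 0"
    "\<And>t. 0 < t \<Longrightarrow> t < \<epsilon>0 \<Longrightarrow> \<not> connected_component (- S) (p + t *\<^sub>R n) (p - t *\<^sub>R n)"
    and m: "m \<bullet> n \<noteq> 0"
  shows "\<forall>\<^sub>F t in at 0. p + t *\<^sub>R m \<notin> S \<and>
      (connected_component (- S) (p + t *\<^sub>R n) (p + t *\<^sub>R m) \<longleftrightarrow> 0 < m \<bullet> n)"
proof -
  have nn: "n \<bullet> n = 1" using n by (simp add: dot_square_norm)
  have seg: "connected_component (- S) x y" if "closed_segment x y \<subseteq> - S" for x y :: "real^3"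
    unfolding connected_component_def
    by (rule exI[of _ "closed_segment x y"]) (use that in auto)
  show ?thesis
  proof (cases "0 < m \<bullet> n")
    case True
    obtain \<epsilon> where e: "\<epsilon> > 0"
      "\<And>t. t \<noteq> 0 \<Longrightarrow> \<bar>t\<bar> < \<epsilon> \<Longrightarrow> closed_segment (p + t *\<^sub>R n) (p + t *\<^sub>R m) \<subseteq> - S"
      by (rule segment_avoids[of n m]) (use nn True in auto)
    show ?thesis
      unfolding eventually_at
    proof (intro exI[of _ \<epsilon>] conjI ballI impI)
      fix t :: real assume "t \<noteq> 0 \<and> dist t 0 < \<epsilon>"
      then have s: "closed_segment (p + t *\<^sub>R n) (p + t *\<^sub>R m) \<subseteq> - S" using e(2) by simp
      then show "p + t *\<^sub>R m \<notin> S" by auto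
      show "connected_component (- S) (p + t *\<^sub>R n) (p + t *\<^sub>R m) \<longleftrightarrow> 0 < m \<bullet> n"
        using seg[OF s] True by simp
    qed (use e in auto)
  next
    case False
    then have "0 < (- m) \<bullet> n" using m by simp
    then obtain \<epsilon> where e: "\<epsilon> > 0"
      "\<And>t. t \<noteq> 0 \<Longrightarrow> \<bar>t\<bar> < \<epsilon> \<Longrightarrow> closed_segment (p + t *\<^sub>R n) (p + t *\<^sub>R (- m)) \<subseteq> - S"
      by (rule segment_avoids[of n "- m", rotated]) (use nn in auto)
    show ?thesis
      unfolding eventually_at
    proof (intro exI[of _ "min \<epsilon> \<epsilon>0"] conjI ballI impI)
      fix t :: real assume t: "t \<noteq> 0 \<and> dist t 0 < min \<epsilon> \<epsilon>0"
      then have "closed_segment (p + (- t) *\<^sub>R n) (p + (- t) *\<^sub>R (- m)) \<subseteq> - S"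
        by (intro e(2)) auto
      then have s: "closed_segment (p - t *\<^sub>R n) (p + t *\<^sub>R m) \<subseteq> - S" by simp
      then show "p + t *\<^sub>R m \<notin> S" by auto
      have "\<not> connected_component (- S) (p + t *\<^sub>R n) (p - t *\<^sub>R n)"
      proof (cases "0 < t")
        case True
        then show ?thesis using sep(2)[of t] t by simp
      next
        case False
        then have "\<not> connected_component (- S) (p - t *\<^sub>R n) (p + t *\<^sub>R n)"
          using sep(2)[of "- t"] t by simp
        then show ?thesis using connected_component_sym by blast
      qed
      then have "\<not> connected_component (- S) (p + t *\<^sub>R n) (p + t *\<^sub>R m)"
        using connected_component_trans[OF _ connected_component_sym[OF seg[OF s]]] by blast
      then show "connected_component (- S) (p + t *\<^sub>R n) (p + t *\<^sub>R m) \<longleftrightarrow> 0 < m \<bullet> n"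
        using False by simp
    qed (use e sep in auto)
  qed
qed

lemma enclosed_volume_limit:
  assumes cS: "compact S"
    and sep: "\<epsilon>0 > 0"
    "\<And>t. 0 < t \<Longrightarrow> t < \<epsilon>0 \<Longrightarrow> \<not> connected_component (- S) (p + t *\<^sub>R n) (p - t *\<^sub>R n)"
  shows "((\<lambda>t. \<bar>t\<bar> ^ 3 * enclosed_volume (sphere_inversion (p + t *\<^sub>R n) ` S)) \<longlongrightarrow> pi / 6) (at 0)"
proof -
  define T where "T t = sphere_inversion (p + t *\<^sub>R n) ` S" for t
  define W where "W t = (\<lambda>w. p + t *\<^sub>R n + (1 / t) *\<^sub>R w) -` inside (T t)" for t
  obtain \<epsilon> where e: "\<epsilon> > 0" "\<And>t x. \<bar>t\<bar> < \<epsilon> \<Longrightarrow> x \<in> S \<Longrightarrow> \<bar>t\<bar> / 2 \<le> norm (x - (p + t *\<^sub>R n))"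
    by (rule normal_distance_ge) (rule that; assumption)
  have q: "p + t *\<^sub>R n \<notin> S" if "t \<noteq> 0" "\<bar>t\<bar> < \<epsilon>" for t
    using e(2)[OF that(2)] that(1) by fastforce
  have Topen: "open (inside (T t))" if t: "t \<noteq> 0" "\<bar>t\<bar> < \<epsilon>" for t
    unfolding T_def using q[OF t] cS continuous_on_sphere_inversion compact_continuous_image
    by (metis compact_imp_closed open_inside)
  have Wopen: "open (W t)" if t: "t \<noteq> 0" "\<bar>t\<bar> < \<epsilon>" for t
    unfolding W_def by (rule open_vimage[OF Topen[OF t]]) (intro continuous_intros)
  have scale: "\<bar>t\<bar> ^ 3 * enclosed_volume (T t) = measure lborel (W t)" if t: "t \<noteq> 0" "\<bar>t\<bar> < \<epsilon>" for t
  proof -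
    have "measure lborel (inside (T t)) = \<bar>1 / t\<bar> ^ DIM(real^3) * measure lborel (W t)"
      unfolding W_def using t Topen[OF t] by (intro measure_lborel_affine_preimage) auto
    moreover have "\<bar>1 / t\<bar> ^ DIM(real^3) = 1 / \<bar>t\<bar> ^ 3" by (simp add: power_one_over)
    ultimately have "measure lborel (inside (T t)) = 1 / \<bar>t\<bar> ^ 3 * measure lborel (W t)" by (simp only:)
    then show ?thesis using t(1) by (simp add: enclosed_volume_def)
  qed
  \<comment> \<open>The distance bound \<open>|t| / 2\<close> inverts to the radius
    \<open>2 / |t|\<close>, and scaling by \<open>t\<close> turns this into a fixed ball, which
    dominates.\<close>
  have Wsub: "W t \<subseteq> cball 0 2" if t: "t \<noteq> 0" "\<bar>t\<bar> < \<epsilon>" for t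
  proof -
    have "T t \<subseteq> cball (p + t *\<^sub>R n) (2 / \<bar>t\<bar>)"
    proof
      fix y assume "y \<in> T t"
      then obtain x where x: "x \<in> S" "y = sphere_inversion (p + t *\<^sub>R n) x" by (auto simp: T_def)
      have "norm (y - (p + t *\<^sub>R n)) = 1 / norm (x - (p + t *\<^sub>R n))"
        unfolding x(2) by (rule norm_sphere_inversion)
      also have "\<dots> \<le> 1 / (\<bar>t\<bar> / 2)"
        using e(2)[OF t(2) x(1)] t(1) by (intro divide_left_mono mult_pos_pos) (auto intro: less_le_trans[of _ "\<bar>t\<bar> / 2"])
      finally show "y \<in> cball (p + t *\<^sub>R n) (2 / \<bar>t\<bar>)" by (simp add: dist_norm norm_minus_commute)
    qed
    then have sub: "inside (T t) \<subseteq> cball (p + t *\<^sub>R n) (2 / \<bar>t\<bar>)"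
      by (rule inside_subset_cball) simp
    show ?thesis
    proof
      fix w assume "w \<in> W t"
      then have "p + t *\<^sub>R n + (1 / t) *\<^sub>R w \<in> cball (p + t *\<^sub>R n) (2 / \<bar>t\<bar>)" using sub by (auto simp: W_def)
      then have "norm w / \<bar>t\<bar> \<le> 2 / \<bar>t\<bar>" by (simp add: dist_norm)
      then show "w \<in> cball 0 2" using t(1) by (simp add: divide_le_cancel)
    qed
  qed
  let ?B = "ball (- (1 / 2) *\<^sub>R n) (1 / 2)"
  have B: "(norm (w + (1 / 2) *\<^sub>R n))\<^sup>2 = (norm w)\<^sup>2 + w \<bullet> n + 1 / 4" for w
  proof -
    have "n \<bullet> n = 1" using n by (simp add: dot_square_norm)
    then show ?thesis unfolding power2_norm_eq_inner
      by (simp add: inner_add_left inner_add_right inner_commute)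
  qed
  have Bdist: "dist (- (1 / 2) *\<^sub>R n) w = norm (w + (1 / 2) *\<^sub>R n)" for w
    by (simp add: dist_norm norm_minus_commute add.commute)
  \<comment> \<open>The condition \<open>m \<bullet> n < 0\<close> reads
    \<open>|w|^2 + w \<bullet> n < 0\<close>, and completing the square gives \<open>?B\<close>. On
    the sphere itself \<open>m\<close> would be tangent and nothing is decided; the sphere also
    contains \<open>w = 0\<close>, where \<open>m\<close> is not meaningful.\<close>
  have ev: "\<forall>\<^sub>F t in at 0. w \<in> W t \<longleftrightarrow> w \<in> ?B" if w: "w \<notin> sphere (- (1 / 2) *\<^sub>R n) (1 / 2)" for w
  proof -
    have "norm (w + (1 / 2) *\<^sub>R n) \<noteq> 1 / 2" using w unfolding mem_sphere Bdist .
    then have "(norm (w + (1 / 2) *\<^sub>R n))\<^sup>2 \<noteq> (1 / 2)\<^sup>2" by (simp only: power2_eq_iff_nonneg norm_ge_zero) simp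
    then have ne: "(norm w)\<^sup>2 + w \<bullet> n \<noteq> 0" unfolding B by (simp add: power2_eq_square)
    then have w0: "w \<noteq> 0" by auto
    define m where "m = n + (1 / (norm w)\<^sup>2) *\<^sub>R w"
    have mn: "m \<bullet> n = ((norm w)\<^sup>2 + w \<bullet> n) / (norm w)\<^sup>2"
      using n w0 by (simp add: m_def inner_add_left dot_square_norm add_divide_distrib)
    have inB: "w \<in> ?B \<longleftrightarrow> m \<bullet> n < 0"
    proof -
      have "w \<in> ?B \<longleftrightarrow> norm (w + (1 / 2) *\<^sub>R n) < 1 / 2" unfolding mem_ball Bdist ..
      also have "\<dots> \<longleftrightarrow> (norm (w + (1 / 2) *\<^sub>R n))\<^sup>2 < (1 / 2)\<^sup>2"
        using power_strict_mono[of "norm (w + (1 / 2) *\<^sub>R n)" "1 / 2" 2]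
          power2_less_imp_less[of "norm (w + (1 / 2) *\<^sub>R n)" "1 / 2"] by auto
      also have "(1 / 2 :: real)\<^sup>2 = 1 / 4" by (simp add: power2_eq_square)
      also have "(norm (w + (1 / 2) *\<^sub>R n))\<^sup>2 < 1 / 4 \<longleftrightarrow> (norm w)\<^sup>2 + w \<bullet> n < 0"
        unfolding B by argo
      also have "\<dots> \<longleftrightarrow> m \<bullet> n < 0" unfolding mn using w0 by (simp add: divide_less_0_iff)
      finally show ?thesis .
    qed
    have "m \<bullet> n \<noteq> 0" unfolding mn using ne w0 by simp
    from component_classification[OF sep this]
    have "\<forall>\<^sub>F t in at 0. p + t *\<^sub>R m \<notin> S \<and>
      (connected_component (- S) (p + t *\<^sub>R n) (p + t *\<^sub>R m) \<longleftrightarrow> 0 < m \<bullet> n)" by simp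
    moreover have "\<forall>\<^sub>F t in at 0. t \<noteq> 0 \<and> \<bar>t\<bar> < \<epsilon>"
      unfolding eventually_at using e(1) by (intro exI[of _ \<epsilon>]) simp
    ultimately show ?thesis
    proof eventually_elim
      case (elim t)
      let ?y = "p + t *\<^sub>R n + (1 / t) *\<^sub>R w"
      have "sphere_inversion (p + t *\<^sub>R n) ?y = p + t *\<^sub>R m"
        unfolding m_def using elim by (intro sphere_inversion_scaled) simp
      then have "w \<in> W t \<longleftrightarrow> p + t *\<^sub>R m \<notin> S \<and> \<not> connected_component (- S) (p + t *\<^sub>R n) (p + t *\<^sub>R m)"
        unfolding W_def T_def vimage_def mem_Collect_eq
        using inside_sphere_inversion_iff[OF cS q, of t ?y] elim w0 by simp
      then show ?case using elim inB \<open>m \<bullet> n \<noteq> 0\<close> by auto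
    qed
  qed
  have lim: "((\<lambda>t. measure lborel (W t)) \<longlongrightarrow> measure lborel ?B) (at 0)"
    unfolding tendsto_at_iff_sequentially comp_def
  proof (intro allI impI)
    fix X :: "nat \<Rightarrow> real" assume X: "\<forall>i. X i \<in> UNIV - {0}" "X \<longlonglongrightarrow> 0"
    have at0: "filterlim X (at 0) sequentially" using X by (simp add: filterlim_at)
    have evX: "\<forall>\<^sub>F i in sequentially. X i \<noteq> 0 \<and> \<bar>X i\<bar> < \<epsilon>"
      using eventually_compose_filterlim[OF _ at0, of "\<lambda>t. t \<noteq> 0 \<and> \<bar>t\<bar> < \<epsilon>"] e(1)
      by (simp add: eventually_at) (metis)
    \<comment> \<open>The estimates on \<open>W\<close> hold only for small nonzero arguments. The
      empty set at the remaining indices makes measurability and domination hold at every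
      index.\<close>
    define V where "V i = (if X i \<noteq> 0 \<and> \<bar>X i\<bar> < \<epsilon> then W (X i) else {})" for i
    have V: "open (V i)" "V i \<subseteq> cball 0 2" for i
      using Wopen Wsub by (auto simp: V_def)
    have "(\<lambda>i. integral\<^sup>L lborel (indicat_real (V i))) \<longlonglongrightarrow> integral\<^sup>L lborel (indicat_real ?B)"
    proof (rule integral_dominated_convergence)
      show "integrable lborel (indicat_real (cball (0 :: real^3) 2))"
        using emeasure_lborel_cball_finite[of "0 :: real^3" 2] by (simp add: integrable_indicator_iff)
      show "AE w in lborel. norm (indicat_real (V i) w) \<le> indicat_real (cball 0 2) w" for i
        using V(2)[of i] by (intro AE_I2) (auto simp: indicator_def)
      have "sphere (- (1 / 2) *\<^sub>R n) (1 / 2) \<in> null_sets lborel"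
        using negligible_sphere[of "- (1 / 2) *\<^sub>R n" "1 / 2"]
        by (simp add: negligible_iff_null_sets null_sets_completion_iff)
      then have "AE w in lborel. w \<notin> sphere (- (1 / 2) *\<^sub>R n) (1 / 2)" by (rule AE_not_in)
      then show "AE w in lborel. (\<lambda>i. indicat_real (V i) w) \<longlonglongrightarrow> indicat_real ?B w"
      proof eventually_elim
        case (elim w)
        have "\<forall>\<^sub>F i in sequentially. indicat_real ?B w = indicat_real (V i) w"
          using eventually_compose_filterlim[OF ev[OF elim] at0] evX
          by eventually_elim (auto simp: V_def indicator_def)
        then show ?case by (rule Lim_transform_eventually[OF tendsto_const])
      qed
      show "indicat_real ?B \<in> borel_measurable lborel"
        by (rule borel_measurable_indicator) simp
      show "indicat_real (V i) \<in> borel_measurable lborel" for i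
        using V(1)[of i] by (intro borel_measurable_indicator) simp
    qed
    then have "(\<lambda>i. measure lborel (V i)) \<longlonglongrightarrow> measure lborel ?B" by simp
    moreover have "\<forall>\<^sub>F i in sequentially. measure lborel (V i) = measure lborel (W (X i))"
      using evX by eventually_elim (simp add: V_def)
    ultimately show "(\<lambda>i. measure lborel (W (X i))) \<longlonglongrightarrow> measure lborel ?B"
      by (rule Lim_transform_eventually)
  qed
  have "\<forall>\<^sub>F t in at 0. measure lborel (W t) = \<bar>t\<bar> ^ 3 * enclosed_volume (T t)"
    unfolding eventually_at using e(1) scale by (intro exI[of _ \<epsilon>]) simp
  from Lim_transform_eventually[OF lim this]
  have vol: "((\<lambda>t. \<bar>t\<bar> ^ 3 * enclosed_volume (T t)) \<longlongrightarrow> measure lborel ?B) (at 0)" .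
  have ball: "measure lborel ?B = pi / 6"
    using sphere_volume[of "1 / 2" "- (1 / 2) *\<^sub>R n"] by (simp add: power3_eq_cube)
  show ?thesis using vol unfolding ball T_def .
qed

end

section \<open>The asymptotics\<close>

lemma normal_cone:
  assumes "surface_chart S x U" "u0 \<in> U \<inter> half_plane" "norm n = 1"
    "\<And>v. n \<bullet> frechet_derivative x (at u0) v = 0" "e > 0"
  shows "\<exists>r>0. \<forall>a\<in>S \<inter> ball (x u0) r. \<bar>(a - x u0) \<bullet> n\<bar> \<le> e * norm (a - x u0)"
proof -
  obtain r where r: "r > 0"
    "\<And>a b. a \<in> S \<inter> ball (x u0) r \<Longrightarrow> b \<in> S \<inter> ball (x u0) r \<Longrightarrow> \<bar>(a - b) \<bullet> n\<bar> \<le> e * norm (a - b)"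
    by (rule surface_cone[OF assms]) (rule that; assumption)
  have "x u0 \<in> S \<inter> ball (x u0) r" using surface_chartD(4)[OF assms(1)] assms(2) r(1) by auto
  then show ?thesis using r by blast
qed

lemma surface_area_limit:
  assumes S: "regular_surface S" "compact S"
    and x: "surface_chart S x U" "u0 \<in> U" "0 < u0 $ 1"
    and n: "norm n = 1" "\<And>v. n \<bullet> frechet_derivative x (at u0) v = 0"
  shows "((\<lambda>t. t\<^sup>2 * surface_area (sphere_inversion (x u0 + t *\<^sub>R n) ` S)) \<longlongrightarrow> pi) (at 0)"
proof -
  define p where "p = x u0"
  have uh: "u0 \<in> U \<inter> half_plane" using x by (simp add: half_plane_def)
  have pS: "p \<in> S" using surface_chartD(4)[OF x(1)] uh by (auto simp: p_def)
  obtain \<rho>0 where \<rho>0: "\<rho>0 > 0" "ball u0 \<rho>0 \<subseteq> U"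
    "(\<integral>\<^sup>+u\<in>ball u0 \<rho>0. ennreal (area_element x u) \<partial>lborel) < \<infinity>"
    and lim0: "\<And>\<rho>. 0 < \<rho> \<Longrightarrow> \<rho> \<le> \<rho>0 \<Longrightarrow>
      ((\<lambda>t. ennreal (t\<^sup>2) * (\<integral>\<^sup>+u\<in>ball u0 \<rho>. ennreal (area_element x u / norm (x u - (x u0 + t *\<^sub>R n)) ^ 4) \<partial>lborel))
        \<longlongrightarrow> ennreal pi) (at 0)"
    by (rule local_area_limit[OF x(1,2) n]) (rule that; assumption)
  \<comment> \<open>The bound \<open>u0 $ 1\<close> keeps the disc inside the half-plane, so that
    the first piece is a full disc. Here \<open>p\<close> must be an interior point.\<close>
  define \<rho> where "\<rho> = min \<rho>0 (u0 $ 1)"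
  have \<rho>: "0 < \<rho>" "\<rho> \<le> \<rho>0" using \<rho>0(1) x(3) by (auto simp: \<rho>_def)
  have sub: "ball u0 \<rho> \<subseteq> ball u0 \<rho>0" using \<rho>(2) by (rule subset_ball)
  have half: "ball u0 \<rho> \<subseteq> half_plane"
  proof
    fix u assume "u \<in> ball u0 \<rho>"
    then have "norm (u0 - u) < u0 $ 1" by (simp add: \<rho>_def dist_norm)
    then have "\<bar>(u0 - u) $ 1\<bar> < u0 $ 1" using component_le_norm_cart[of "u0 - u" 1] by simp
    then show "u \<in> half_plane" by (simp add: half_plane_def)
  qed
  have "U \<inter> ball u0 \<rho> = ball u0 \<rho>" using \<rho>0(2) sub by blast
  then have chart: "surface_chart S x (ball u0 \<rho>)"
    using surface_chart_Int_open[OF x(1), of "ball u0 \<rho>"] by simp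
  have "(\<integral>\<^sup>+u\<in>ball u0 \<rho>. ennreal (area_element x u) \<partial>lborel) \<le>
      (\<integral>\<^sup>+u\<in>ball u0 \<rho>0. ennreal (area_element x u) \<partial>lborel)"
    using sub by (intro nn_integral_mono) (auto simp: indicator_def)
  then have fin: "(\<integral>\<^sup>+u\<in>ball u0 \<rho>. ennreal (area_element x u) \<partial>lborel) < \<infinity>"
    using \<rho>0(3) by (meson le_less_trans)
  obtain m :: nat and X V A where m: "0 < m" "X 0 = x" "A 0 = ball u0 \<rho> \<inter> half_plane"
    and XV: "\<And>i. i < m \<Longrightarrow> surface_chart S (X i) (V i) \<and> A i \<in> sets borel \<and> A i \<subseteq> V i \<inter> half_plane"
    and dis: "disjoint_family_on (\<lambda>i. X i ` A i) {..<m}" and un: "(\<Union>i<m. X i ` A i) = S"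
    and finA: "\<And>i. i < m \<Longrightarrow> (\<integral>\<^sup>+u\<in>A i. ennreal (area_element (X i) u) \<partial>lborel) < \<infinity>"
    by (rule finite_chart_decomposition[OF S chart fin]) (rule that; assumption)
  have A0: "A 0 = ball u0 \<rho>" using m(3) half by blast
  \<comment> \<open>Piece 0 contains all of \<open>S\<close> within \<open>r\<close> of
    \<open>p\<close>, so the other pieces, being disjoint from it, stay at distance at least
    \<open>r\<close>.\<close>
  obtain r where r: "r > 0" "S \<inter> ball p r \<subseteq> X 0 ` A 0"
  proof -
    obtain r where "r > 0" "S \<inter> ball (x u0) r \<subseteq> x ` (ball u0 \<rho> \<inter> half_plane \<inter> UNIV)"
      by (rule surface_chart_nbhd[OF chart open_UNIV, of u0]) (use \<rho>(1) uh in auto)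
    then show ?thesis using that m by (simp add: p_def)
  qed
  define I where "I i t = (\<integral>\<^sup>+u\<in>A i. ennreal (area_element (X i) u / norm (X i u - (p + t *\<^sub>R n)) ^ 4) \<partial>lborel)" for i t
  have lim: "((\<lambda>t. ennreal (t\<^sup>2) * I i t) \<longlongrightarrow> ennreal (if i = 0 then pi else 0)) (at 0)" if i: "i < m" for i
  proof (cases "i = 0")
    case True
    then show ?thesis using lim0[OF \<rho>] A0 m(2) by (simp add: I_def p_def)
  next
    case False
    have far: "r \<le> norm (X i u - p)" if "u \<in> A i" for u
    proof (rule ccontr)
      assume "\<not> r \<le> norm (X i u - p)"
      then have "X i u \<in> ball p r" by (simp add: dist_norm norm_minus_commute)
      moreover have "X i u \<in> S" using un i that by blast
      ultimately have "X i u \<in> X 0 ` A 0" using r(2) by blast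
      moreover have "X i ` A i \<inter> X 0 ` A 0 = {}"
        using dis i m(1) False unfolding disjoint_family_on_def by simp
      ultimately show False using that by blast
    qed
    \<comment> \<open>For \<open>|t| < r / 2\<close> the center still has distance at least
      \<open>r / 2\<close> from these pieces.\<close>
    let ?c = "1 / (r / 2) ^ 4"
    have Ile: "I i t \<le> ennreal ?c * (\<integral>\<^sup>+u\<in>A i. ennreal (area_element (X i) u) \<partial>lborel)" if t: "\<bar>t\<bar> < r / 2" for t
    proof -
      have "I i t \<le> (\<integral>\<^sup>+u. ennreal ?c * (ennreal (area_element (X i) u) * indicator (A i) u) \<partial>lborel)"
        unfolding I_def
      proof (rule nn_integral_mono)
        fix u
        show "ennreal (area_element (X i) u / norm (X i u - (p + t *\<^sub>R n)) ^ 4) * indicator (A i) u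
            \<le> ennreal ?c * (ennreal (area_element (X i) u) * indicator (A i) u)"
        proof (cases "u \<in> A i")
          case True
          have "norm (X i u - p) \<le> norm (X i u - (p + t *\<^sub>R n)) + norm (t *\<^sub>R n)"
            using norm_triangle_ineq[of "X i u - (p + t *\<^sub>R n)" "t *\<^sub>R n"] by simp
          then have "r / 2 \<le> norm (X i u - (p + t *\<^sub>R n))" using far[OF True] t n(1) by simp
          then have "area_element (X i) u / norm (X i u - (p + t *\<^sub>R n)) ^ 4 \<le> area_element (X i) u / (r / 2) ^ 4"
            using r(1) area_element_nonneg by (intro frac_le power_mono) auto
          then have "ennreal (area_element (X i) u / norm (X i u - (p + t *\<^sub>R n)) ^ 4) \<le> ennreal (?c * area_element (X i) u)"
            by (intro ennreal_leI) simp
          also have "\<dots> = ennreal ?c * ennreal (area_element (X i) u)"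
            using area_element_nonneg by (intro ennreal_mult) auto
          finally show ?thesis using True by simp
        qed simp
      qed
      also have "\<dots> = ennreal ?c * (\<integral>\<^sup>+u\<in>A i. ennreal (area_element (X i) u) \<partial>lborel)"
      proof (rule nn_integral_cmult)
        have "(\<lambda>u. indicator (A i) u * area_element (X i) u) \<in> borel_measurable borel"
          using XV[OF i] surface_chartD(2)[of S "X i" "V i"] by (intro area_element_indicator_borel[of _ "V i"]) auto
        then have "(\<lambda>u. ennreal (indicator (A i) u * area_element (X i) u)) \<in> borel_measurable lborel" by simp
        then show "(\<lambda>u. ennreal (area_element (X i) u) * indicator (A i) u) \<in> borel_measurable lborel"
          by (rule measurable_cong[THEN iffD1, rotated]) (auto simp: indicator_def)
      qed
      finally show ?thesis .
    qed
    let ?K = "ennreal ?c * (\<integral>\<^sup>+u\<in>A i. ennreal (area_element (X i) u) \<partial>lborel)"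
    have K: "?K < \<infinity>" using finA[OF i] by (simp add: ennreal_mult_less_top)
    have "((\<lambda>t. ?K * ennreal (t\<^sup>2)) \<longlongrightarrow> ?K * ennreal (0\<^sup>2)) (at 0)"
      using K by (intro ennreal_tendsto_cmult tendsto_ennrealI tendsto_intros) auto
    then have up: "((\<lambda>t. ennreal (t\<^sup>2) * ?K) \<longlongrightarrow> 0) (at 0)" by (simp add: mult.commute)
    have le: "\<forall>\<^sub>F t in at 0. ennreal (t\<^sup>2) * I i t \<le> ennreal (t\<^sup>2) * ?K"
      unfolding eventually_at using r(1) Ile by (intro exI[of _ "r / 2"]) (auto intro: mult_left_mono)
    have "((\<lambda>t. ennreal (t\<^sup>2) * I i t) \<longlongrightarrow> 0) (at 0)"
      by (rule tendsto_sandwich[OF _ le tendsto_const up]) simp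
    then show ?thesis using False by simp
  qed
  have "((\<lambda>t. \<Sum>i<m. ennreal (t\<^sup>2) * I i t) \<longlongrightarrow> (\<Sum>i<m. ennreal (if i = 0 then pi else 0))) (at 0)"
    using lim by (intro tendsto_sum) auto
  also have "(\<Sum>i<m. ennreal (if i = 0 then pi else 0)) = ennreal pi"
    using m(1) by (simp add: if_distrib[of ennreal] cong: if_cong)
  finally have "((\<lambda>t. enn2real (\<Sum>i<m. ennreal (t\<^sup>2) * I i t)) \<longlongrightarrow> pi) (at 0)"
    by (rule tendsto_enn2real) simp
  moreover have "\<forall>\<^sub>F t in at 0. enn2real (\<Sum>i<m. ennreal (t\<^sup>2) * I i t) =
      t\<^sup>2 * surface_area (sphere_inversion (p + t *\<^sub>R n) ` S)"
  proof -
    have cone: "\<exists>r>0. \<forall>a\<in>S \<inter> ball p r. \<bar>(a - p) \<bullet> n\<bar> \<le> e * norm (a - p)" if "e > 0" for e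
      using normal_cone[OF x(1) uh n that] by (simp add: p_def)
    obtain \<epsilon> where e: "\<epsilon> > 0" "\<And>t y. \<bar>t\<bar> < \<epsilon> \<Longrightarrow> y \<in> S \<Longrightarrow> \<bar>t\<bar> / 2 \<le> norm (y - (p + t *\<^sub>R n))"
      by (rule normal_distance_ge[OF pS n(1) cone]) (assumption, (rule that; assumption))
    have "enn2real (\<Sum>i<m. ennreal (t\<^sup>2) * I i t) = t\<^sup>2 * surface_area (sphere_inversion (p + t *\<^sub>R n) ` S)"
      if t: "t \<noteq> 0" "\<bar>t\<bar> < \<epsilon>" for t
    proof -
      have "p + t *\<^sub>R n \<notin> S" using e(2)[OF t(2)] t(1) by fastforce
      from has_surface_area_inversion[OF XV dis un this]
      have "has_surface_area (sphere_inversion (p + t *\<^sub>R n) ` S) (\<Sum>i<m. I i t)" by (simp add: I_def)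
      then show ?thesis
        by (simp add: surface_area_eqI sum_distrib_left[symmetric] enn2real_mult)
    qed
    then show ?thesis unfolding eventually_at using e(1) by (intro exI[of _ \<epsilon>]) simp
  qed
  ultimately show ?thesis unfolding p_def[symmetric] by (rule Lim_transform_eventually)
qed

text \<open>Vectors orthogonal to the range of a chart derivative are multiples of \<open>n\<close>,
  so every admissible \<open>q\<close> lies on the normal line. The inequality in this direction
  carries limits along that line over to \<open>normal_approach\<close>.\<close>

lemma normal_approach_le:
  assumes x: "surface_chart S x U" "u0 \<in> U \<inter> half_plane"
    and n: "norm n = 1" "\<And>v. n \<bullet> frechet_derivative x (at u0) v = 0"
  shows "normal_approach S (x u0) \<le> filtermap (\<lambda>t. x u0 + t *\<^sub>R n) (at 0)"
proof (rule filter_leI)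
  let ?D = "frechet_derivative x (at u0)"
  fix P assume "eventually P (filtermap (\<lambda>t. x u0 + t *\<^sub>R n) (at 0))"
  then obtain d where d: "d > 0" "\<And>t. t \<noteq> 0 \<Longrightarrow> \<bar>t\<bar> < d \<Longrightarrow> P (x u0 + t *\<^sub>R n)"
    unfolding eventually_filtermap eventually_at by auto
  have uU: "u0 \<in> U" using x(2) by simp
  have linD: "linear ?D" and injD: "inj ?D"
    using surface_chartD(2,3)[OF x(1)] uU C1_on_linear by blast+
  have "P q" if q: "\<forall>v\<in>tangent_plane S (x u0). orthogonal (q - x u0) v" "q \<noteq> x u0" "dist q (x u0) < d" for q
  proof -
    have "?D v \<in> tangent_plane S (x u0)" for v
      using x unfolding tangent_plane_def by blast
    then have perp: "(q - x u0) \<bullet> ?D v = 0" for v using q(1) by (simp add: orthogonal_def)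
    define t where "t = (q - x u0) \<bullet> n"
    have t: "q - x u0 = t *\<^sub>R n"
      unfolding t_def by (rule parallel_normal[OF linD injD n perp])
    have "t \<noteq> 0" using t q(2) by auto
    moreover have "\<bar>t\<bar> < d" using t q(3) n(1) by (simp add: dist_norm)
    ultimately have "P (x u0 + t *\<^sub>R n)" by (rule d(2))
    then show ?thesis using t by (metis add.commute diff_add_cancel)
  qed
  then show "eventually P (normal_approach S (x u0))"
    unfolding normal_approach_def eventually_at using d(1) by blast
qed

theorem theorem3p1:
  fixes S :: "(real^3) set" and p :: "real^3"
  assumes "regular_surface S" and "compact S"
    and "p \<in> S" and "p \<notin> surface_boundary S"
  shows "(\<lambda>q. surface_area (sphere_inversion q ` S))
           \<sim>[normal_approach S p] (\<lambda>q. pi / (dist p q)\<^sup>2)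
    \<and> (closed_surface S \<and> orientable_surface S \<longrightarrow>
         (\<lambda>q. enclosed_volume (sphere_inversion q ` S))
           \<sim>[normal_approach S p] (\<lambda>q. pi / (6 * (dist p q) ^ 3))
       \<and> ((\<lambda>q. reduced_volume (sphere_inversion q ` S)) \<longlongrightarrow> 1) (normal_approach S p))"
proof (intro conjI impI)
  obtain x U u where x: "surface_chart S x U" "u \<in> U \<inter> half_plane" "p = x u"
    using assms(1,3) unfolding regular_surface_def by blast
  have "u $ 1 \<noteq> 0" using assms(4) x unfolding surface_boundary_def by blast
  then have u: "u \<in> U" "0 < u $ 1" using x(2) by (auto simp: half_plane_def)
  let ?D = "frechet_derivative x (at u)"
  have linD: "linear ?D" using C1_on_linear[OF surface_chartD(2)[OF x(1)] u(1)] .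
  let ?A = "\<lambda>q. surface_area (sphere_inversion q ` S)"
    and ?V = "\<lambda>q. enclosed_volume (sphere_inversion q ` S)"
  have transfer: "(f \<longlongrightarrow> l) (normal_approach S p)"
    if "norm n = 1" "\<And>v. n \<bullet> ?D v = 0" "((\<lambda>t. f (p + t *\<^sub>R n)) \<longlongrightarrow> l) (at 0)"
    for f :: "real^3 \<Rightarrow> real" and l n
  proof -
    have "normal_approach S p \<le> filtermap (\<lambda>t. p + t *\<^sub>R n) (at 0)"
      using normal_approach_le[OF x(1,2) that(1,2)] x(3) by simp
    moreover have "(f \<longlongrightarrow> l) (filtermap (\<lambda>t. p + t *\<^sub>R n) (at 0))"
      using that(3) by (simp add: filterlim_filtermap)
    ultimately show ?thesis by (rule tendsto_mono)
  qed
  have area: "((\<lambda>t. t\<^sup>2 * ?A (p + t *\<^sub>R n)) \<longlongrightarrow> pi) (at 0)"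
    if "norm n = 1" "\<And>v. n \<bullet> ?D v = 0" for n
    using surface_area_limit[OF assms(1,2) x(1) u that] x(3) by simp
  have dist: "dist p (p + t *\<^sub>R n) = \<bar>t\<bar>" if "norm n = 1" for n t
    using that by (simp add: dist_norm)
  show "?A \<sim>[normal_approach S p] (\<lambda>q. pi / (dist p q)\<^sup>2)"
  proof (rule asymp_equivI')
    \<comment> \<open>At the single point \<open>p\<close> a unit normal exists without any
      orientation of \<open>S\<close>.\<close>
    obtain n where n: "norm n = 1" "\<And>v. n \<bullet> ?D v = 0"
      by (rule unit_normal_exists[OF linD]) (rule that; assumption)
    have "((\<lambda>t. t\<^sup>2 * ?A (p + t *\<^sub>R n) / pi) \<longlongrightarrow> pi / pi) (at 0)"
      by (intro tendsto_intros area[OF n]) simp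
    then have "((\<lambda>t. ?A (p + t *\<^sub>R n) / (pi / (dist p (p + t *\<^sub>R n))\<^sup>2)) \<longlongrightarrow> 1) (at 0)"
      by (simp add: dist[OF n(1)] mult.commute)
    then show "((\<lambda>q. ?A q / (pi / (dist p q)\<^sup>2)) \<longlongrightarrow> 1) (normal_approach S p)"
      by (rule transfer[OF n])
  qed
  assume "closed_surface S \<and> orientable_surface S"
  then have closed: "closed_surface S" and "orientable_surface S" by auto
  then obtain N where N: "continuous_on S N" "\<And>z. z \<in> S \<Longrightarrow> norm (N z) = 1"
    "\<And>z v. z \<in> S \<Longrightarrow> v \<in> tangent_plane S z \<Longrightarrow> orthogonal (N z) v"
    unfolding orientable_surface_def by blast
  interpret oriented_surface S N
    by unfold_locales (use closed N in auto)
  define n where "n = N p"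
  have n1: "norm n = 1" using N(2) assms(3) by (simp add: n_def)
  have "?D v \<in> tangent_plane S p" for v using x unfolding tangent_plane_def by blast
  then have nD: "n \<bullet> ?D v = 0" for v using N(3)[OF assms(3)] by (simp add: n_def orthogonal_def)
  have cone: "\<exists>r>0. \<forall>a\<in>S \<inter> ball p r. \<bar>(a - p) \<bullet> n\<bar> \<le> e * norm (a - p)" if "e > 0" for e
    using normal_cone[OF x(1,2) n1 nD that] by (simp add: x(3))
  obtain \<epsilon> where "\<epsilon> > 0"
    "\<And>t. 0 < t \<Longrightarrow> t < \<epsilon> \<Longrightarrow> \<not> connected_component (- S) (p + t *\<^sub>R N p) (p - t *\<^sub>R N p)"
    by (rule normal_points_separated[OF assms(3)]) (rule that; assumption)
  note sep = this[folded n_def]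
  have vol: "((\<lambda>t. \<bar>t\<bar> ^ 3 * ?V (p + t *\<^sub>R n)) \<longlongrightarrow> pi / 6) (at 0)"
    by (rule enclosed_volume_limit[OF assms(3) n1 cone assms(2) sep])
  note ar = area[OF n1 nD]
  show "?V \<sim>[normal_approach S p] (\<lambda>q. pi / (6 * (dist p q) ^ 3))"
  proof (rule asymp_equivI')
    have "((\<lambda>t. \<bar>t\<bar> ^ 3 * ?V (p + t *\<^sub>R n) * 6 / pi) \<longlongrightarrow> pi / 6 * 6 / pi) (at 0)"
      by (intro tendsto_intros vol) simp
    then have "((\<lambda>t. ?V (p + t *\<^sub>R n) / (pi / (6 * (dist p (p + t *\<^sub>R n)) ^ 3))) \<longlongrightarrow> 1) (at 0)"
      by (simp add: dist[OF n1] mult.commute mult.left_commute)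
    then show "((\<lambda>q. ?V q / (pi / (6 * (dist p q) ^ 3))) \<longlongrightarrow> 1) (normal_approach S p)"
      by (rule transfer[OF n1 nD])
  qed
  show "((\<lambda>q. reduced_volume (sphere_inversion q ` S)) \<longlongrightarrow> 1) (normal_approach S p)"
  proof (rule transfer[OF n1 nD])
    \<comment> \<open>The reduced volume as a function of area and volume. Scaling these by
      \<open>t\<^sup>2\<close> and \<open>|t| ^ 3\<close> leaves it unchanged, and at area
      \<open>pi\<close> the denominator is \<open>pi / 6\<close>, equal to the limit volume.\<close>
    let ?r = "\<lambda>a v. v / ((4 * pi / 3) * (a / (4 * pi)) powr (3 / 2))"
    have quarter: "(1 / 4 :: real) powr (3 / 2) = 1 / 8"
    proof -
      have "(1 / 4 :: real) = (1 / 2) powr 2" by (simp add: power2_eq_square)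
      then have "(1 / 4 :: real) powr (3 / 2) = (1 / 2) powr 3" by (simp only: powr_powr) simp
      then show ?thesis by (simp add: power3_eq_cube)
    qed
    have "((\<lambda>t. ?r (t\<^sup>2 * ?A (p + t *\<^sub>R n)) (\<bar>t\<bar> ^ 3 * ?V (p + t *\<^sub>R n))) \<longlongrightarrow> ?r pi (pi / 6)) (at 0)"
      by (intro tendsto_intros ar vol) auto
    moreover have "?r pi (pi / 6) = 1" by (simp add: quarter)
    ultimately have lim: "((\<lambda>t. ?r (t\<^sup>2 * ?A (p + t *\<^sub>R n)) (\<bar>t\<bar> ^ 3 * ?V (p + t *\<^sub>R n))) \<longlongrightarrow> 1) (at 0)"
      by (simp only:)
    have eq: "?r (t\<^sup>2 * ?A (p + t *\<^sub>R n)) (\<bar>t\<bar> ^ 3 * ?V (p + t *\<^sub>R n)) =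
        reduced_volume (sphere_inversion (p + t *\<^sub>R n) ` S)" if "t \<noteq> 0" for t
    proof -
      have "(t\<^sup>2) powr (3 / 2) = \<bar>t\<bar> ^ 3"
      proof -
        have "t\<^sup>2 = \<bar>t\<bar> powr 2" using that by (simp add: powr_numeral)
        then have "(t\<^sup>2) powr (3 / 2) = \<bar>t\<bar> powr 3" by (simp only: powr_powr) simp
        then show ?thesis using that by (simp add: powr_numeral)
      qed
      moreover have "0 \<le> ?A (p + t *\<^sub>R n)" by (simp add: surface_area_def)
      ultimately have "(t\<^sup>2 * ?A (p + t *\<^sub>R n) / (4 * pi)) powr (3 / 2) =
          \<bar>t\<bar> ^ 3 * (?A (p + t *\<^sub>R n) / (4 * pi)) powr (3 / 2)"
        by (simp add: powr_mult times_divide_eq_right[symmetric] del: times_divide_eq_right)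
      then show ?thesis using that by (simp add: reduced_volume_def)
    qed
    show "((\<lambda>t. reduced_volume (sphere_inversion (p + t *\<^sub>R n) ` S)) \<longlongrightarrow> 1) (at 0)"
      by (rule Lim_transform_eventually[OF lim]) (use eq in \<open>simp add: eventually_at_filter\<close>)
  qed
qed

end
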